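(* Let $A$ be a unital C*-algebra, $B$ a unital semisimple complex Banach algebra, and $T\colon A\to B$ a surjective spectrally bounded linear operator. Suppose that either (i) $A$ is a properly infinite von Neumann algebra, or (ii) $A$ is a purely infinite C*-algebra with real rank zero. Then there is a unique Jordan epimorphism $J\colon A\to B$ such that $Tx=(T1)\,Jx$ for all $x\in A$. Moreover, $T1$ is a central invertible element of $B$.
   Context: $r(x)$ denotes the spectral radius. A linear map $T\colon A\to B$ between unital Banach algebras is spectrally bounded if there is $M\ge0$ with $r(Tx)\le M\,r(x)$ for all $x\in A$. A Banach algebra is semisimple if its Jacobson radical is zero. A Jordan epimorphism is a surjective linear map $S$ with $S(x\circ y)=Sx\circ Sy$ for all $x,y$, where $x\circ y=\tfrac12(xy+yx)$. *)

theory Defs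
  imports "HOL-Analysis.Analysis"
begin

class cbanach_algebra = real_normed_algebra_1 + banach +
  fixes cscale :: "complex \<Rightarrow> 'a \<Rightarrow> 'a"
  assumes cscale_of_real: "cscale (of_real r) x = r *\<^sub>R x"
    and cscale_add_right: "cscale c (x + y) = cscale c x + cscale c y"
    and cscale_add_left: "cscale (c + d) x = cscale c x + cscale d x"
    and cscale_cscale: "cscale c (cscale d x) = cscale (c * d) x"
    and cscale_mult_left: "cscale c x * y = cscale c (x * y)"
    and cscale_mult_right: "x * cscale c y = cscale c (x * y)"
    and norm_cscale: "norm (cscale c x) = cmod c * norm x"

definition c_linear :: "('a::cbanach_algebra \<Rightarrow> 'b::cbanach_algebra) \<Rightarrow> bool" where
  "c_linear T \<longleftrightarrow> (\<forall>x y. T (x + y) = T x + T y) \<and> (\<forall>c x. T (cscale c x) = cscale c (T x))"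

definition inv_el :: "'a::cbanach_algebra \<Rightarrow> bool" where
  "inv_el u \<longleftrightarrow> (\<exists>v. u * v = 1 \<and> v * u = 1)"

definition cspectrum :: "'a::cbanach_algebra \<Rightarrow> complex set" where
  "cspectrum x = {z. \<not> inv_el (x - cscale z 1)}"

definition spectral_radius :: "'a::cbanach_algebra \<Rightarrow> real" where
  "spectral_radius x = Sup (cmod ` cspectrum x)"

definition spectrally_bounded :: "('a::cbanach_algebra \<Rightarrow> 'b::cbanach_algebra) \<Rightarrow> bool" where
  "spectrally_bounded T \<longleftrightarrow>
     (\<exists>M\<ge>0. \<forall>x. spectral_radius (T x) \<le> M * spectral_radius x)"

definition left_ideal :: "'a::cbanach_algebra set \<Rightarrow> bool" where
  "left_ideal L \<longleftrightarrow> 0 \<in> L \<and> (\<forall>x\<in>L. \<forall>y\<in>L. x + y \<in> L) \<and> (\<forall>c. \<forall>x\<in>L. cscale c x \<in> L)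
     \<and> (\<forall>a. \<forall>x\<in>L. a * x \<in> L)"

definition maximal_left_ideal :: "'a::cbanach_algebra set \<Rightarrow> bool" where
  "maximal_left_ideal L \<longleftrightarrow> left_ideal L \<and> L \<noteq> UNIV \<and>
     (\<forall>M. left_ideal M \<and> M \<noteq> UNIV \<and> L \<subseteq> M \<longrightarrow> M = L)"

definition jacobson_radical :: "'a::cbanach_algebra itself \<Rightarrow> 'a set" where
  "jacobson_radical _ = \<Inter> {L. maximal_left_ideal L}"

definition semisimple :: "'a::cbanach_algebra itself \<Rightarrow> bool" where
  "semisimple t \<longleftrightarrow> jacobson_radical t = {0}"

definition jprod :: "'a::cbanach_algebra \<Rightarrow> 'a \<Rightarrow> 'a" where
  "jprod x y = (1/2) *\<^sub>R (x * y + y * x)"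

definition jordan_epi :: "('a::cbanach_algebra \<Rightarrow> 'b::cbanach_algebra) \<Rightarrow> bool" where
  "jordan_epi S \<longleftrightarrow> c_linear S \<and> surj S \<and> (\<forall>x y. S (jprod x y) = jprod (S x) (S y))"

definition central :: "'a::cbanach_algebra \<Rightarrow> bool" where
  "central x \<longleftrightarrow> (\<forall>y. x * y = y * x)"

class cstar_algebra = cbanach_algebra +
  fixes cstar :: "'a \<Rightarrow> 'a"
  assumes cstar_cstar: "cstar (cstar x) = x"
    and cstar_add: "cstar (x + y) = cstar x + cstar y"
    and cstar_cscale: "cstar (cscale c x) = cscale (cnj c) (cstar x)"
    and cstar_mult: "cstar (x * y) = cstar y * cstar x"
    and cstar_identity: "norm (cstar x * x) = (norm x)\<^sup>2"

definition is_proj :: "'a::cstar_algebra \<Rightarrow> bool" where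
  "is_proj p \<longleftrightarrow> cstar p = p \<and> p * p = p"

definition mvn_equiv :: "'a::cstar_algebra \<Rightarrow> 'a \<Rightarrow> bool" where
  "mvn_equiv p q \<longleftrightarrow> (\<exists>v. cstar v * v = p \<and> v * cstar v = q)"

definition infinite_proj :: "'a::cstar_algebra \<Rightarrow> bool" where
  "infinite_proj p \<longleftrightarrow> is_proj p \<and>
     (\<exists>q. is_proj q \<and> p * q = q \<and> q * p = q \<and> q \<noteq> p \<and> mvn_equiv p q)"

definition c_functional :: "('a::cbanach_algebra \<Rightarrow> complex) \<Rightarrow> bool" where
  "c_functional f \<longleftrightarrow> (\<forall>x y. f (x + y) = f x + f y) \<and> (\<forall>c x. f (cscale c x) = c * f x)
     \<and> (\<exists>K. \<forall>x. cmod (f x) \<le> K * norm x)"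

definition fnorm :: "('a::cbanach_algebra \<Rightarrow> complex) \<Rightarrow> real" where
  "fnorm f = Sup {cmod (f x) | x. norm x \<le> 1}"

text \<open>W*-algebra (= abstract von Neumann algebra, Sakai): a C*-algebra which is, as a
  Banach space, the dual of a Banach space.  The predual is realised as a subspace
  P of the dual such that the canonical map A \<rightarrow> P* is an isometric isomorphism.\<close>
definition von_neumann_algebra :: "'a::cstar_algebra itself \<Rightarrow> bool" where
  "von_neumann_algebra _ \<longleftrightarrow> (\<exists>P :: ('a \<Rightarrow> complex) set.
     P \<subseteq> {f. c_functional f} \<and> (\<lambda>_. 0) \<in> P \<and>
     (\<forall>f\<in>P. \<forall>g\<in>P. (\<lambda>x. f x + g x) \<in> P) \<and> (\<forall>c. \<forall>f\<in>P. (\<lambda>x. c * f x) \<in> P) \<and>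
     (\<forall>x::'a. norm x = Sup {cmod (f x) | f. f \<in> P \<and> fnorm f \<le> 1}) \<and>
     (\<forall>\<psi> :: ('a \<Rightarrow> complex) \<Rightarrow> complex.
        (\<forall>f\<in>P. \<forall>g\<in>P. \<psi> (\<lambda>x. f x + g x) = \<psi> f + \<psi> g) \<and>
        (\<forall>c. \<forall>f\<in>P. \<psi> (\<lambda>x. c * f x) = c * \<psi> f) \<and>
        (\<exists>K. \<forall>f\<in>P. cmod (\<psi> f) \<le> K * fnorm f)
        \<longrightarrow> (\<exists>a::'a. \<forall>f\<in>P. \<psi> f = f a)))"

definition properly_infinite_vN :: "'a::cstar_algebra itself \<Rightarrow> bool" where
  "properly_infinite_vN _ \<longleftrightarrow>
     (\<forall>z::'a. is_proj z \<and> central z \<and> z \<noteq> 0 \<longrightarrow> infinite_proj z)"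

definition is_positive :: "'a::cstar_algebra \<Rightarrow> bool" where
  "is_positive a \<longleftrightarrow> cstar a = a \<and> cspectrum a \<subseteq> {z. z \<in> \<real> \<and> 0 \<le> Re z}"

definition ideal_gen :: "'a::cstar_algebra \<Rightarrow> 'a set" where
  "ideal_gen a = closure {(\<Sum>i<n. x i * a * y i) | (n::nat) x y. True}"

definition cuntz_below :: "'a::cstar_algebra \<Rightarrow> 'a \<Rightarrow> bool" where
  "cuntz_below b a \<longleftrightarrow> (\<exists>r. (\<lambda>n. cstar (r n) * a * r n) \<longlonglongrightarrow> b)"

definition character :: "('a::cbanach_algebra \<Rightarrow> complex) \<Rightarrow> bool" where
  "character \<omega> \<longleftrightarrow> (\<forall>x y. \<omega> (x + y) = \<omega> x + \<omega> y) \<and> (\<forall>c x. \<omega> (cscale c x) = c * \<omega> x)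
     \<and> (\<forall>x y. \<omega> (x * y) = \<omega> x * \<omega> y) \<and> (\<exists>x. \<omega> x \<noteq> 0)"

text \<open>Purely infinite C*-algebra in the sense of Kirchberg--Rordam.\<close>
definition purely_infinite :: "'a::cstar_algebra itself \<Rightarrow> bool" where
  "purely_infinite _ \<longleftrightarrow> \<not> (\<exists>\<omega> :: 'a \<Rightarrow> complex. character \<omega>) \<and>
     (\<forall>a b :: 'a. is_positive a \<and> is_positive b \<and> b \<in> ideal_gen a \<longrightarrow> cuntz_below b a)"

definition real_rank_zero :: "'a::cstar_algebra itself \<Rightarrow> bool" where
  "real_rank_zero _ \<longleftrightarrow>
     (\<forall>h::'a. cstar h = h \<longrightarrow> h \<in> closure {k. cstar k = k \<and> inv_el k})"

end

theory Submission
  imports Defs "HOL-Computational_Algebra.Fundamental_Theorem_Algebra" "HOL-Computational_Algebra.Formal_Power_Series"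
begin

text \<open>A spectrally bounded surjection \<open>T\<close> onto a semisimple algebra maps square-zero elements to square-zero elements.
  If the unit of \<open>A\<close> is properly infinite, the corners of a suitable projection are spanned by off-diagonal
  (hence square-zero) elements, and polarising \<open>(T a)\<^sup>2 = 0\<close> over them yields
  \<open>T x T y + T y T x = T 1 T (x \<circ> y) + T (x \<circ> y) T 1\<close>, which makes \<open>T 1\<close> central and invertible and \<open>(T 1)\<^sup>-\<^sup>1 T\<close> a
  Jordan map. Both alternatives of the hypothesis are used only to show that the unit is properly infinite. In a von
  Neumann algebra this is comparison theory, with weak* compactness of balls supplying the suprema of projections. For
  a purely infinite algebra of real rank zero, square-zero elements are approximated by elements of the ideal generated
  by the properly infinite projections; were this ideal proper, a maximal left ideal containing it would contain all
  square-zero elements and hence be the kernel of a character.\<close>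

subsection \<open>Complex Banach algebras\<close>

text \<open>\<open>T\<close> is not assumed continuous and controls only spectral radii, so
  everything about \<open>T a\<close> has to be read off from spectra. If \<open>a * a = 0\<close>
  and \<open>b = T a\<close>, conjugation by \<open>1 + x/t\<close> turns the line
  \<open>[x,b] + t b\<close> into the image of some \<open>t a + z/t\<close> with \<open>z\<close>
  bounded; the square of that element stays bounded in \<open>t\<close>, because
  \<open>a * a = 0\<close> removes the only growing term. A bounded spectral radius along a complex
  line is constant, which makes suitable products with commutators quasinilpotent, and the density
  of the action on \<open>B/L\<close>, for maximal left ideals \<open>L\<close>, then excludes
  \<open>b * b \<notin> L\<close>. The analysis is elementary: analytic functions are replaced by
  the polynomials \<open>(u + \<mu> v)^n\<close> and averages over roots of unity, spectral
  projections by square roots and suprema. In the von Neumann case the predual gives compactness but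
  no weak* continuity of multiplication, so equations for limit elements have to be encoded as
  families of norm balls.\<close>

lemma cscale_zero_left [simp]: "cscale 0 x = (0::'a::cbanach_algebra)"
  using cscale_of_real[of 0 x] by simp

lemma cscale_one [simp]: "cscale 1 x = (x::'a::cbanach_algebra)"
  using cscale_of_real[of 1 x] by simp

lemma cscale_zero_right [simp]: "cscale c 0 = (0::'a::cbanach_algebra)"
  using norm_cscale[of c "0::'a"] by simp

lemma cscale_minus_left [simp]: "cscale (- c) x = - cscale c (x::'a::cbanach_algebra)"
  using cscale_add_left[of c "-c" x] by (simp add: eq_neg_iff_add_eq_0 add.commute)

lemma cscale_minus_right [simp]: "cscale c (- x) = - cscale c (x::'a::cbanach_algebra)"
  using cscale_add_right[of c x "-x"] by (simp add: eq_neg_iff_add_eq_0 add.commute)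

lemma cscale_diff_left: "cscale (c - d) x = cscale c x - cscale d (x::'a::cbanach_algebra)"
  using cscale_add_left[of c "-d" x] by simp

lemma cscale_diff_right: "cscale c (x - y) = cscale c x - cscale c (y::'a::cbanach_algebra)"
  using cscale_add_right[of c x "-y"] by simp

lemma cscale_eq_0_iff [simp]: "cscale c x = 0 \<longleftrightarrow> c = 0 \<or> (x::'a::cbanach_algebra) = 0"
  using norm_cscale[of c x] by (metis mult_eq_0_iff norm_eq_zero)

lemma cscale_scaleR: "cscale c (r *\<^sub>R x) = r *\<^sub>R cscale c (x::'a::cbanach_algebra)"
  by (metis cscale_cscale cscale_of_real mult.commute)

lemma scaleR_eq_cscale: "r *\<^sub>R x = cscale (of_real r) (x::'a::cbanach_algebra)"
  by (simp add: cscale_of_real)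

lemma bounded_linear_cscale_right: "bounded_linear (cscale c :: 'a::cbanach_algebra \<Rightarrow> 'a)"
proof (rule bounded_linear_intro[of _ "cmod c"])
qed (simp_all add: cscale_add_right cscale_scaleR norm_cscale mult.commute)

lemma bounded_linear_cscale_left: "bounded_linear (\<lambda>c. cscale c (x::'a::cbanach_algebra))"
proof (rule bounded_linear_intro[of _ "norm x"])
  show "cscale (r *\<^sub>R c) x = r *\<^sub>R cscale c x" for r c
    by (metis cscale_cscale cscale_of_real scaleR_conv_of_real)
qed (simp_all add: cscale_add_left norm_cscale)

lemma cscale_sum_right: "cscale c (sum f A) = (\<Sum>i\<in>A. cscale c (f i :: 'a::cbanach_algebra))"
  using bounded_linear.linear[OF bounded_linear_cscale_right] by (rule linear_sum)

lemma cscale_sum_left: "cscale (sum f A) x = (\<Sum>i\<in>A. cscale (f i) (x :: 'a::cbanach_algebra))"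
  using bounded_linear.linear[OF bounded_linear_cscale_left] by (rule linear_sum)

lemma cscale_power: "(cscale c x)^n = cscale (c^n) ((x::'a::cbanach_algebra)^n)"
  by (induction n) (simp_all add: cscale_mult_left cscale_mult_right cscale_cscale mult.commute)

lemma tendsto_cscale [tendsto_intros]:
  assumes "(f \<longlongrightarrow> c) F" "(g \<longlongrightarrow> x) F"
  shows "((\<lambda>i. cscale (f i) (g i :: 'a::cbanach_algebra)) \<longlongrightarrow> cscale c x) F"
proof -
  have eq: "cscale a y = cscale a 1 * y" for a and y :: 'a
    by (simp add: cscale_mult_left)
  have "((\<lambda>i. cscale (f i) (1::'a)) \<longlongrightarrow> cscale c 1) F"
    by (rule bounded_linear.tendsto[OF bounded_linear_cscale_left assms(1)])
  from tendsto_mult[OF this assms(2)] show ?thesis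
    by (simp add: cscale_mult_left)
qed

lemma continuous_on_cscale [continuous_intros]:
  assumes "continuous_on S f" "continuous_on S g"
  shows "continuous_on S (\<lambda>x. cscale (f x) (g x :: 'a::cbanach_algebra))"
  using assms unfolding continuous_on_def by (auto intro: tendsto_intros)

definition alg_inv :: "'a::cbanach_algebra \<Rightarrow> 'a" where
  "alg_inv u = (SOME v. u * v = 1 \<and> v * u = 1)"

lemma alg_inv: assumes "inv_el u" shows "u * alg_inv u = 1" "alg_inv u * u = 1"
proof -
  have "u * alg_inv u = 1 \<and> alg_inv u * u = 1"
    unfolding alg_inv_def using assms unfolding inv_el_def by (rule someI_ex)
  then show "u * alg_inv u = 1" "alg_inv u * u = 1" by auto
qed

lemma inv_elI: "u * v = 1 \<Longrightarrow> v * u = 1 \<Longrightarrow> inv_el u"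
  by (auto simp: inv_el_def)

lemma alg_inv_eq:
  assumes "u * v = 1" "v * u = 1" shows "alg_inv u = (v::'a::cbanach_algebra)"
proof -
  have "alg_inv u = alg_inv u * (u * v)" using assms by simp
  also have "\<dots> = v" using alg_inv[of u] inv_elI[OF assms] by (simp add: mult.assoc[symmetric])
  finally show ?thesis .
qed

lemma inv_el_one [simp]: "inv_el 1" by (rule inv_elI[of _ 1]) auto

lemma alg_inv_cancel:
  assumes "inv_el u"
  shows "u * (alg_inv u * x) = x" "alg_inv u * (u * x) = x" "x * u * alg_inv u = x" "x * alg_inv u * u = x"
  using alg_inv[OF assms] by (simp_all add: mult.assoc[symmetric]) (simp_all add: mult.assoc)

lemma inv_el_mult: assumes "inv_el u" "inv_el v" shows "inv_el (u * v)"
proof (rule inv_elI)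
  show "u * v * (alg_inv v * alg_inv u) = 1"
    by (simp add: mult.assoc alg_inv_cancel alg_inv assms)
  show "(alg_inv v * alg_inv u) * (u * v) = 1"
    by (simp add: mult.assoc alg_inv_cancel alg_inv assms)
qed

lemma inv_el_alg_inv: "inv_el u \<Longrightarrow> inv_el (alg_inv u)"
  using alg_inv by (blast intro: inv_elI)

lemma inv_el_cscale_iff: assumes "c \<noteq> 0" shows "inv_el (cscale c u) \<longleftrightarrow> inv_el (u::'a::cbanach_algebra)"
proof -
  have "inv_el (cscale c u)" if "c \<noteq> 0" "inv_el u" for c and u :: 'a
    by (rule inv_elI[of _ "cscale (inverse c) (alg_inv u)"])
      (use that in \<open>simp_all add: cscale_mult_left cscale_mult_right cscale_cscale alg_inv\<close>)
  from this[of "inverse c" "cscale c u"] this[of c u] show ?thesis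
    using assms by (auto simp: cscale_cscale)
qed

lemma inv_el_minus_iff [simp]: "inv_el (- u) \<longleftrightarrow> inv_el u"
  using inv_el_cscale_iff[of "-1" u] by simp

lemma inv_el_factor:
  assumes "inv_el (x * y)" "x * y = y * x" shows "inv_el (x::'a::cbanach_algebra)"
proof -
  define w where "w = alg_inv (x * y)"
  have w: "x * y * w = 1" "w * (x * y) = 1" using alg_inv[OF assms(1)] by (auto simp: w_def)
  have "w * y * x = 1" using w assms(2) by (simp add: mult.assoc)
  moreover have "x * (y * w) = 1" using w by (simp add: mult.assoc)
  ultimately have "y * w = w * y"
    by (metis mult.assoc mult.left_neutral mult.right_neutral)
  then show ?thesis using \<open>w * y * x = 1\<close> \<open>x * (y * w) = 1\<close> by (intro inv_elI[of x "y * w"]) auto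
qed

lemma neumann:
  assumes "norm (x::'a::cbanach_algebra) < 1"
  shows "inv_el (1 - x)" "norm (alg_inv (1 - x)) \<le> 1 / (1 - norm x)"
proof -
  have s: "summable (\<lambda>n. x ^ n)" using assms by (rule complete_algebra_summable_geometric)
  have *: "(\<Sum>n. x ^ Suc n) = (\<Sum>n. x ^ n) - 1"
    using suminf_split_head[OF s] by simp
  have 1: "(1 - x) * (\<Sum>n. x ^ n) = 1"
    using suminf_mult[OF s, of x] * by (simp add: algebra_simps)
  have 2: "(\<Sum>n. x ^ n) * (1 - x) = 1"
    using suminf_mult2[OF s, of x] * by (simp add: algebra_simps power_commutes)
  show "inv_el (1 - x)" using 1 2 by (rule inv_elI)
  have g: "summable (\<lambda>n. norm x ^ n)" using assms by (simp add: summable_geometric)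
  have g': "summable (\<lambda>n. norm (x ^ n))"
    by (rule summable_comparison_test'[OF g]) (simp add: norm_power_ineq)
  have "norm (\<Sum>n. x ^ n) \<le> (\<Sum>n. norm (x ^ n))" using g' by (rule summable_norm)
  also have "\<dots> \<le> (\<Sum>n. norm x ^ n)" by (rule suminf_le[OF _ g' g]) (simp add: norm_power_ineq)
  also have "\<dots> = 1 / (1 - norm x)" using assms by (simp add: suminf_geometric)
  finally show "norm (alg_inv (1 - x)) \<le> 1 / (1 - norm x)"
    using alg_inv_eq[OF 1 2] by simp
qed

lemma inv_el_perturb:
  assumes u: "inv_el (u::'a::cbanach_algebra)" and h: "norm h * norm (alg_inv u) \<le> 1/2"
  shows "inv_el (u + h)" "norm (alg_inv (u + h) - alg_inv u) \<le> 2 * (norm (alg_inv u))\<^sup>2 * norm h"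
proof -
  define v where "v = alg_inv u"
  have v: "u * v = 1" "v * u = 1" using alg_inv[OF u] by (auto simp: v_def)
  have n: "norm (- (v * h)) \<le> 1/2" using norm_mult_ineq[of v h] h by (simp add: v_def mult.commute)
  then have i: "inv_el (1 - (- (v * h)))" using neumann(1)[of "- (v * h)"] by linarith
  have "norm (alg_inv (1 - (- (v * h)))) \<le> 1 / (1 - norm (- (v * h)))"
    using neumann(2)[of "- (v * h)"] n by linarith
  also have "\<dots> \<le> 1 / (1/2)" by (rule divide_left_mono) (use n in auto)
  finally have ni: "norm (alg_inv (1 - (- (v * h)))) \<le> 2" by simp
  have eq: "u + h = u * (1 - (- (v * h)))" using v by (simp add: algebra_simps mult.assoc[symmetric])
  show iu: "inv_el (u + h)" unfolding eq using u i by (rule inv_el_mult)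
  define w where "w = alg_inv (u + h)"
  have w: "(u + h) * w = 1" "w * (u + h) = 1" using alg_inv[OF iu] by (auto simp: w_def)
  define k where "k = alg_inv (1 - (- (v * h)))"
  have k: "k * (1 + v * h) = 1" "(1 + v * h) * k = 1" using alg_inv[OF i] by (auto simp: k_def)
  have "w = k * v"
    unfolding w_def eq
  proof (rule alg_inv_eq)
    show "u * (1 - - (v * h)) * (k * v) = 1"
      using k v by (metis (no_types, lifting) diff_minus_eq_add mult.assoc mult.right_neutral)
    show "k * v * (u * (1 - - (v * h))) = 1"
      using k v by (metis (no_types, lifting) diff_minus_eq_add mult.assoc mult.left_neutral)
  qed
  then have nw: "norm w \<le> 2 * norm v"
    using norm_mult_ineq[of k v] ni mult_right_mono[of "norm k" 2 "norm v"] by (simp add: k_def)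
  have "w * (u + h) * v = v" using w by simp
  then have "w - v = - (w * h * v)" using v by (simp add: algebra_simps mult.assoc)
  then have "norm (w - v) = norm (w * h * v)" by simp
  also have "\<dots> \<le> norm w * norm h * norm v"
    by (metis mult_right_mono norm_ge_zero norm_mult_ineq order_trans)
  also have "\<dots> \<le> (2 * norm v) * norm h * norm v"
    by (intro mult_right_mono nw) auto
  finally show "norm (alg_inv (u + h) - alg_inv u) \<le> 2 * (norm (alg_inv u))\<^sup>2 * norm h"
    by (simp add: w_def v_def power2_eq_square mult_ac)
qed

lemma tendsto_alg_inv:
  assumes f: "(f \<longlongrightarrow> u) F" and u: "inv_el (u::'a::cbanach_algebra)"
  shows "((\<lambda>x. alg_inv (f x)) \<longlongrightarrow> alg_inv u) F"
proof -
  have f0: "((\<lambda>x. norm (f x - u)) \<longlongrightarrow> 0) F" using f by (simp add: LIM_zero tendsto_norm_zero)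
  then have "((\<lambda>x. norm (f x - u) * norm (alg_inv u)) \<longlongrightarrow> 0) F"
    by (rule tendsto_mult_left_zero)
  then have ev: "\<forall>\<^sub>F x in F. norm (f x - u) * norm (alg_inv u) < 1/2"
    by (rule order_tendstoD) simp
  have "((\<lambda>x. 2 * (norm (alg_inv u))\<^sup>2 * norm (f x - u)) \<longlongrightarrow> 0) F"
    using f0 by (rule tendsto_mult_right_zero)
  then have "((\<lambda>x. alg_inv (f x) - alg_inv u) \<longlongrightarrow> 0) F"
    by (rule Lim_null_comparison[rotated])
      (use ev in \<open>eventually_elim, use inv_el_perturb(2)[OF u, of "f _ - u"] in force\<close>)
  then show ?thesis by (simp add: LIM_zero_cancel)
qed

lemma eventually_inv_el:
  assumes f: "(f \<longlongrightarrow> u) F" and u: "inv_el (u::'a::cbanach_algebra)"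
  shows "\<forall>\<^sub>F x in F. inv_el (f x)"
proof -
  have "((\<lambda>x. norm (f x - u)) \<longlongrightarrow> 0) F" using f by (simp add: LIM_zero tendsto_norm_zero)
  then have "((\<lambda>x. norm (f x - u) * norm (alg_inv u)) \<longlongrightarrow> 0) F"
    by (rule tendsto_mult_left_zero)
  then have "\<forall>\<^sub>F x in F. norm (f x - u) * norm (alg_inv u) < 1/2"
    by (rule order_tendstoD) simp
  then show ?thesis
    by eventually_elim (use inv_el_perturb(1)[OF u, of "f _ - u"] in force)
qed

subsection \<open>The spectral radius\<close>

text \<open>Sums over roots of unity stand in for contour integrals: they annihilate every power
  whose exponent is not divisible by \<open>N\<close>.\<close>

lemma roots_of_unity_sum:
  assumes "N > 0"
  shows "(\<Sum>j<N. (exp (2 * of_real pi * \<i> * of_nat j / of_nat N) :: complex) ^ i)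
           = (if N dvd i then of_nat N else 0)"
proof -
  define w :: complex where "w = exp (2 * of_real pi * \<i> * of_nat i / of_nat N)"
  have e: "(exp (2 * of_real pi * \<i> * of_nat j / of_nat N) :: complex) ^ i = w ^ j" for j
    unfolding w_def exp_of_nat_mult[symmetric] by (simp add: mult_ac)
  have w1: "w = 1 \<longleftrightarrow> N dvd i" unfolding w_def using assms by (intro complex_root_unity_eq_1) auto
  have wN: "w ^ N = 1" unfolding w_def using assms by (intro complex_root_unity) auto
  show ?thesis
  proof (cases "N dvd i")
    case True
    then show ?thesis unfolding e using w1 by simp
  next
    case False
    then show ?thesis unfolding e using w1 wN geometric_sum[of w N] by simp
  qed
qed

lemma power_geometric:
  fixes y :: "'a::ring_1"
  shows "(1 - y) * (\<Sum>i<n. y ^ i) = 1 - y ^ n" "(\<Sum>i<n. y ^ i) * (1 - y) = 1 - y ^ n"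
proof (induction n)
  case (Suc n)
  { case 1
    have "(1 - y) * (S + a) = (1 - y) * S + (a - y * a)" for S a by (simp add: algebra_simps)
    then show ?case using Suc by simp }
  { case 2
    have "(S + a) * (1 - y) = S * (1 - y) + (a - a * y)" for S a by (simp add: algebra_simps)
    then show ?case using Suc by (simp add: power_commutes) }
qed auto

text \<open>With \<open>N = n + 1\<close> sample points the degree stays below \<open>N\<close>, so
  weighting the samples by \<open>w j ^ (N - m)\<close> isolates \<open>c m\<close> without
  aliasing; the weights have modulus one.\<close>

lemma Cauchy_estimate:
  fixes c :: "nat \<Rightarrow> 'a::cbanach_algebra"
  assumes K: "\<And>\<mu>. cmod \<mu> = R \<Longrightarrow> norm (\<Sum>k\<le>n. cscale (\<mu> ^ k) (c k)) \<le> K"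
    and R: "R > 0" and m: "m \<le> n"
  shows "norm (c m) * R ^ m \<le> K"
proof -
  define N where "N = Suc n"
  define w :: "nat \<Rightarrow> complex" where "w j = exp (2 * of_real pi * \<i> * of_nat j / of_nat N)" for j
  have sw: "(\<Sum>j<N. w j ^ i) = (if N dvd i then of_nat N else 0)" for i
    using roots_of_unity_sum[of N i] by (simp add: w_def N_def)
  have nw: "cmod (w j) = 1" for j by (simp add: w_def)
  have dv: "N dvd k + (N - m) \<longleftrightarrow> k = m" if "k \<le> n" for k
  proof
    assume "N dvd k + (N - m)"
    then obtain q where q: "k + (N - m) = N * q" by (auto simp: dvd_def)
    have "0 < k + (N - m)" "k + (N - m) < N * 2" using that m by (auto simp: N_def)
    then have "q = 1" unfolding q by (cases q) auto
    then show "k = m" using q m by (simp add: N_def)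
  qed (use m in \<open>auto simp: N_def\<close>)
  have "(\<Sum>j<N. cscale (w j ^ (N - m)) (\<Sum>k\<le>n. cscale ((of_real R * w j) ^ k) (c k)))
      = (\<Sum>k\<le>n. cscale (of_real R ^ k * (\<Sum>j<N. w j ^ (k + (N - m)))) (c k))"
    unfolding cscale_sum_right sum_distrib_left cscale_sum_left
    by (subst sum.swap) (simp add: cscale_cscale power_mult_distrib power_add mult_ac)
  also have "\<dots> = (\<Sum>k\<le>n. if k = m then cscale (of_real R ^ m * of_nat N) (c m) else 0)"
    by (rule sum.cong) (auto simp: sw dv)
  also have "\<dots> = cscale (of_real R ^ m * of_nat N) (c m)" using m by simp
  finally have eq: "cscale (of_real R ^ m * of_nat N) (c m)
      = (\<Sum>j<N. cscale (w j ^ (N - m)) (\<Sum>k\<le>n. cscale ((of_real R * w j) ^ k) (c k)))" by simp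
  have "R ^ m * N * norm (c m) = norm (cscale (of_real R ^ m * of_nat N) (c m))"
    using R by (simp add: norm_cscale norm_mult norm_power)
  also have "\<dots> \<le> (\<Sum>j<N. K)" unfolding eq
    by (rule order_trans[OF norm_sum sum_mono])
      (use R in \<open>auto simp: norm_cscale norm_power nw norm_mult intro!: K\<close>)
  finally have "N * (norm (c m) * R ^ m) \<le> N * K" by (simp add: mult_ac)
  then show ?thesis by (simp add: N_def)
qed

section \<open>Resolvents, non-emptiness of the spectrum and the spectral radius formula\<close>

lemma cspectrum_iff: "z \<in> cspectrum x \<longleftrightarrow> \<not> inv_el (x - cscale z 1)"
  by (simp add: cspectrum_def)

lemma inv_el_one_sub_iff:
  assumes "w \<noteq> 0"
  shows "inv_el (1 - cscale w (x::'a::cbanach_algebra)) \<longleftrightarrow> inv_el (x - cscale (inverse w) 1)"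
proof -
  have "1 - cscale w x = cscale (- w) (x - cscale (inverse w) 1)"
    using assms by (simp add: cscale_diff_right cscale_cscale)
  then show ?thesis using assms inv_el_cscale_iff[of "- w"] by simp
qed

text \<open>\<open>1 - y\<close> is a commuting factor of \<open>1 - y ^ n\<close>, which the
  Neumann series inverts, so smallness of a single power is enough.\<close>

lemma inv_el_beyond_norm_power:
  assumes "norm ((x::'a::cbanach_algebra) ^ n) < cmod z ^ n"
  shows "inv_el (x - cscale z 1)"
proof -
  have z: "z \<noteq> 0" and n: "n > 0"
  proof -
    show "n > 0" using assms by (cases n) auto
    then show "z \<noteq> 0" using assms by (auto simp: power_0_left)
  qed
  define y where "y = cscale (inverse z) x"
  have "norm (y ^ n) = norm (x ^ n) / cmod z ^ n"
    by (simp add: y_def cscale_power norm_cscale norm_power norm_inverse norm_divide field_simps)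
  then have "norm (y ^ n) < 1" using assms z by simp
  then have "inv_el (1 - y ^ n)" by (rule neumann)
  then have "inv_el (1 - y)"
    using inv_el_factor[of "1 - y" "\<Sum>i<n. y ^ i"] power_geometric[of y n] by simp
  then show ?thesis unfolding y_def using z by (subst (asm) inv_el_one_sub_iff) auto
qed

lemma norm_cspectrum_le: "z \<in> cspectrum x \<Longrightarrow> cmod z \<le> norm (x::'a::cbanach_algebra)"
  using inv_el_beyond_norm_power[of x 1 z] by (force simp: cspectrum_iff)

text \<open>Rickart's elementary form of the spectral radius formula: the mean of the resolvent over the
  vertices of a regular \<open>N\<close>-gon is \<open>(1 - w\<^sup>N x\<^sup>N)\<inverse>\<close>, and uniform continuity of
  the resolvent propagates the convergence \<open>w\<^sup>N x\<^sup>N \<rightarrow> 0\<close> outwards from \<open>w = 0\<close>.\<close>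

lemma power_tendsto_zero:
  fixes x :: "'a::cbanach_algebra"
  assumes s: "s > 0" and inv: "\<And>z. cmod z \<ge> s \<Longrightarrow> inv_el (x - cscale z 1)"
    and t: "0 \<le> t" "t < 1 / s"
  shows "(\<lambda>N. t ^ N * norm (x ^ N)) \<longlonglongrightarrow> 0"
proof -
  define G where "G w = alg_inv (1 - cscale w x)" for w
  have iG: "inv_el (1 - cscale w x)" if "cmod w \<le> 1 / s" for w
  proof (cases "w = 0")
    case False
    then show ?thesis using that s
      by (subst inv_el_one_sub_iff) (auto intro!: inv simp: norm_inverse norm_divide field_simps)
  qed simp
  have "continuous_on (cball 0 (1/s)) G"
    unfolding continuous_on_def G_def
    by (intro ballI tendsto_alg_inv iG tendsto_intros) auto
  then have "uniformly_continuous_on (cball 0 (1/s)) G"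
    by (intro compact_uniformly_continuous) auto
  then obtain d where d: "d > 0" and
    dG: "\<And>w w'. cmod w \<le> 1/s \<Longrightarrow> cmod w' \<le> 1/s \<Longrightarrow> cmod (w' - w) < d \<Longrightarrow> norm (G w' - G w) < 1/4"
    unfolding uniformly_continuous_on_def
    by (metis dist_norm mem_cball_0 zero_less_divide_1_iff zero_less_numeral)
  define om :: "nat \<Rightarrow> nat \<Rightarrow> complex" where "om N j = exp (2 * of_real pi * \<i> * of_nat j / of_nat N)" for N j
  have nom: "cmod (om N j) = 1" for N j by (simp add: om_def)
  define H where "H N w = (1 / real N) *\<^sub>R (\<Sum>j<N. G (om N j * w))" for N w
  have omN: "om N j ^ N = 1" if "N > 0" for N j
    unfolding om_def using that by (intro complex_root_unity) auto
  \<comment> \<open>As \<open>om N j ^ N = 1\<close>, multiplying \<open>G (om N j * w)\<close> by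
    this factor leaves a finite geometric sum, and the average over \<open>j\<close> keeps only its
    term \<open>k = 0\<close>.\<close>
  have HI: "(1 - cscale (w ^ N) (x ^ N)) * H N w = 1" if N: "N > 0" and w: "cmod w \<le> 1/s" for N w
  proof -
    have 1: "(1 - cscale (w ^ N) (x ^ N)) * G (om N j * w) = (\<Sum>k<N. cscale ((om N j * w) ^ k) (x ^ k))" for j
    proof -
      define y where "y = cscale (om N j * w) x"
      have "y ^ N = cscale (w ^ N) (x ^ N)" using omN[OF N] by (simp add: y_def cscale_power power_mult_distrib)
      then have "1 - cscale (w ^ N) (x ^ N) = (\<Sum>i<N. y ^ i) * (1 - y)"
        using power_geometric(2)[of y N] by simp
      then have "(1 - cscale (w ^ N) (x ^ N)) * alg_inv (1 - y) = (\<Sum>i<N. y ^ i)"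
        using iG[of "om N j * w"] w by (simp add: alg_inv_cancel y_def norm_mult nom)
      then show ?thesis by (simp add: y_def G_def cscale_power)
    qed
    have "(1 - cscale (w ^ N) (x ^ N)) * H N w
        = (1 / real N) *\<^sub>R (\<Sum>j<N. \<Sum>k<N. cscale ((om N j * w) ^ k) (x ^ k))"
      by (simp add: H_def sum_distrib_left 1)
    also have "(\<Sum>j<N. \<Sum>k<N. cscale ((om N j * w) ^ k) (x ^ k))
        = (\<Sum>k<N. cscale (w ^ k * (\<Sum>j<N. om N j ^ k)) (x ^ k))"
      by (subst sum.swap) (simp add: sum_distrib_left cscale_sum_left power_mult_distrib mult_ac)
    also have "\<dots> = (\<Sum>k<N. if k = 0 then cscale (of_nat N) 1 else 0)"
      using roots_of_unity_sum[OF N] by (intro sum.cong) (auto simp: om_def[symmetric] dest: dvd_imp_le)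
    also have "\<dots> = real N *\<^sub>R 1" using N by (simp add: scaleR_eq_cscale)
    finally show ?thesis using N by simp
  qed
  have nH: "norm (H N w' - H N w) \<le> 1/4" if "N > 0" "cmod w \<le> 1/s" "cmod w' \<le> 1/s" "cmod (w' - w) < d" for N w w'
  proof -
    have "H N w' - H N w = (1 / real N) *\<^sub>R (\<Sum>j<N. G (om N j * w') - G (om N j * w))"
      by (simp add: H_def sum_subtractf scaleR_diff_right)
    moreover have "norm (\<Sum>j<N. G (om N j * w') - G (om N j * w)) \<le> (\<Sum>j<N. 1/4)"
    proof (rule order_trans[OF norm_sum sum_mono])
      fix j
      have "om N j * w' - om N j * w = om N j * (w' - w)" by (simp add: algebra_simps)
      then show "norm (G (om N j * w') - G (om N j * w)) \<le> 1/4"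
        using that by (intro less_imp_le[OF dG]) (simp_all add: norm_mult nom)
    qed
    ultimately show ?thesis using that by (simp add: field_simps)
  qed
  \<comment> \<open>Decay at \<open>t0\<close> puts the mean \<open>H\<close> within
    \<open>1/4\<close> of \<open>1\<close>; uniform continuity keeps it within \<open>1/2\<close> of
    \<open>1\<close> at \<open>t1\<close>. Its inverse there has norm at most \<open>2\<close>,
    which bounds the powers at \<open>t1\<close>, and boundedness at \<open>t1\<close> is geometric
    decay at every \<open>t2 < t1\<close>.\<close>
  have step: "(\<lambda>N. t2 ^ N * norm (x ^ N)) \<longlonglongrightarrow> 0"
    if P: "(\<lambda>N. t0 ^ N * norm (x ^ N)) \<longlonglongrightarrow> 0" and t: "0 \<le> t0" "t0 \<le> t1" "t1 < t0 + d" "t1 \<le> 1/s" "0 \<le> t2" "t2 < t1"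
    for t0 t1 t2
  proof -
    have "\<forall>\<^sub>F N in sequentially. t0 ^ N * norm (x ^ N) < 1/5"
      using P by (rule order_tendstoD) simp
    then have "\<forall>\<^sub>F N in sequentially. t1 ^ N * norm (x ^ N) \<le> 3"
      using eventually_gt_at_top[of 0]
    proof eventually_elim
      case (elim N)
      define y0 y1 where "y0 = cscale (of_real t0 ^ N) (x ^ N)" and "y1 = cscale (of_real t1 ^ N) (x ^ N)"
      have n0: "norm y0 < 1/5" using elim t by (simp add: y0_def norm_cscale norm_power)
      define h0 h1 where "h0 = H N (of_real t0)" and "h1 = H N (of_real t1)"
      have h0: "(1 - y0) * h0 = 1" using HI[of N "of_real t0"] elim t by (simp add: y0_def h0_def)
      have h1: "(1 - y1) * h1 = 1" using HI[of N "of_real t1"] elim t by (simp add: y1_def h1_def)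
      have "cmod (complex_of_real t1 - of_real t0) = \<bar>t1 - t0\<bar>"
        by (metis norm_of_real of_real_diff)
      then have h: "norm (h1 - h0) \<le> 1/4"
        unfolding h0_def h1_def using elim t by (intro nH) auto
      have "h0 - 1 = y0 * (h0 - 1) + y0" using h0 by (simp add: algebra_simps)
      then have "norm (h0 - 1) \<le> norm y0 * norm (h0 - 1) + norm y0"
        by (metis norm_mult_ineq norm_triangle_ineq add_right_mono order_trans)
      also have "\<dots> \<le> 1/5 * norm (h0 - 1) + 1/5" using n0 by (intro add_mono mult_right_mono) auto
      finally have "norm (h0 - 1) \<le> 1/4" by simp
      then have h11: "norm (h1 - 1) \<le> 1/2" using h norm_triangle_ineq[of "h1 - h0" "h0 - 1"] by simp
      have "1 - y1 = 1 - (1 - y1) * (h1 - 1)" using h1 by (simp add: algebra_simps)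
      then have "norm (1 - y1) \<le> 1 + norm ((1 - y1) * (h1 - 1))"
        by (metis norm_one norm_triangle_ineq4)
      also have "\<dots> \<le> 1 + norm (1 - y1) * (1/2)"
        by (intro add_left_mono order_trans[OF norm_mult_ineq] mult_left_mono h11) auto
      finally have "norm (1 - y1) \<le> 2" by simp
      then have "norm y1 \<le> 3" using norm_triangle_ineq4[of 1 "1 - y1"] by simp
      then show ?case using t by (simp add: y1_def norm_cscale norm_power)
    qed
    then have ev: "\<forall>\<^sub>F N in sequentially. norm (t2 ^ N * norm (x ^ N)) \<le> 3 * (t2 / t1) ^ N"
    proof eventually_elim
      case (elim N)
      have "t2 ^ N * norm (x ^ N) = (t2/t1) ^ N * (t1 ^ N * norm (x ^ N))"
        using t by (simp add: power_divide)
      also have "\<dots> \<le> (t2/t1) ^ N * 3" using elim t by (intro mult_left_mono) auto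
      finally show ?case using t by (simp add: mult_ac)
    qed
    have "(\<lambda>N. 3 * (t2/t1) ^ N) \<longlonglongrightarrow> 3 * 0"
      by (rule tendsto_mult[OF tendsto_const LIMSEQ_realpow_zero]) (use t in auto)
    then have "(\<lambda>N. 3 * (t2/t1) ^ N) \<longlonglongrightarrow> 0" by simp
    with ev show ?thesis by (rule Lim_null_comparison)
  qed
  have main: "t < 1/s \<Longrightarrow> 0 \<le> t \<Longrightarrow> t \<le> real m * (d/2) \<Longrightarrow> (\<lambda>N. t ^ N * norm (x ^ N)) \<longlonglongrightarrow> 0" for t m
  proof (induction m arbitrary: t)
    case 0
    then have "t = 0" by simp
    have "(\<lambda>N. 0 ^ N * norm (x ^ N)) \<longlonglongrightarrow> 0"
      by (rule tendsto_eventually) (auto intro!: eventually_sequentiallyI[of 1] simp: power_0_left)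
    then show ?case using \<open>t = 0\<close> by simp
  next
    case (Suc m)
    \<comment> \<open>Going back by \<open>d/2\<close> and forward by at most \<open>d/4\<close>
      keeps \<open>t1\<close> within \<open>d\<close> of \<open>t0\<close> while leaving
      \<open>t\<close> strictly below \<open>t1\<close>, where boundedness turns into decay.\<close>
    define t0 where "t0 = max 0 (t - d/2)"
    have "(\<lambda>N. t0 ^ N * norm (x ^ N)) \<longlonglongrightarrow> 0"
      by (rule Suc.IH) (use Suc.prems d s in \<open>auto simp: t0_def algebra_simps max_def\<close>)
    then show ?case
      by (rule step[where ?t1.0 = "min (1/s) (t + d/4)"]) (use Suc.prems d s in \<open>auto simp: t0_def\<close>)
  qed
  obtain m where "t / (d/2) < real m" using reals_Archimedean2 by blast
  then show ?thesis using main[of t m] t d by (simp add: field_simps)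
qed

text \<open>With empty spectrum \<open>x\<close> would be invertible and
  \<open>power_tendsto_zero\<close> would apply at every radius; the powers of \<open>x\<close>
  would then decay faster than those of its inverse can grow.\<close>

lemma cspectrum_nonempty: "cspectrum (x::'a::cbanach_algebra) \<noteq> {}"
proof
  assume "cspectrum x = {}"
  then have inv: "inv_el (x - cscale z 1)" for z by (auto simp: cspectrum_def)
  from inv[of 0] have ix: "inv_el x" by simp
  define v where "v = alg_inv x"
  define s where "s = 1 / (norm v + 2)"
  have s: "s > 0" by (simp add: s_def add_nonneg_pos)
  have "(\<lambda>N. (norm v + 1) ^ N * norm (x ^ N)) \<longlonglongrightarrow> 0"
    by (rule power_tendsto_zero[OF s inv]) (auto simp: s_def)
  then have "\<forall>\<^sub>F N in sequentially. (norm v + 1) ^ N * norm (x ^ N) < 1"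
    by (rule order_tendstoD) simp
  then obtain N where N: "(norm v + 1) ^ N * norm (x ^ N) < 1" by (auto simp: eventually_sequentially)
  have xv: "x * v = 1" "v * x = 1" using alg_inv[OF ix] by (auto simp: v_def)
  have "x ^ n * v ^ n = 1" for n
  proof (induction n)
    case (Suc n)
    have "x ^ Suc n * v ^ Suc n = x ^ n * (x * v) * v ^ n"
      by (simp only: power_Suc2[of x] power_Suc[of v] mult.assoc)
    then show ?case using Suc xv by simp
  qed simp
  then have "1 \<le> norm (x ^ N) * norm (v ^ N)" by (metis norm_mult_ineq norm_one)
  also have "\<dots> \<le> norm (x ^ N) * (norm v + 1) ^ N"
    by (intro mult_left_mono order_trans[OF norm_power_ineq] power_mono) auto
  finally show False using N by (simp add: mult.commute)
qed

lemma bdd_above_cspectrum: "bdd_above (cmod ` cspectrum (x::'a::cbanach_algebra))"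
  by (rule bdd_aboveI[of _ "norm x"]) (auto intro: norm_cspectrum_le)

lemma cmod_le_spectral_radius: "z \<in> cspectrum x \<Longrightarrow> cmod z \<le> spectral_radius (x::'a::cbanach_algebra)"
  unfolding spectral_radius_def using bdd_above_cspectrum by (intro cSup_upper) auto

lemma spectral_radius_leI:
  assumes "\<And>z. z \<in> cspectrum x \<Longrightarrow> cmod z \<le> K" shows "spectral_radius (x::'a::cbanach_algebra) \<le> K"
  unfolding spectral_radius_def using assms cspectrum_nonempty by (intro cSup_least) auto

lemma spectral_radius_nonneg [simp]: "spectral_radius (x::'a::cbanach_algebra) \<ge> 0"
  using cspectrum_nonempty[of x] cmod_le_spectral_radius[of _ x] norm_ge_zero order_trans by blast

lemma inv_el_beyond: "spectral_radius x < cmod z \<Longrightarrow> inv_el (x - cscale z (1::'a::cbanach_algebra))"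
  using cmod_le_spectral_radius[of z x] by (force simp: cspectrum_iff)

lemma spectral_radius_power_le:
  assumes "norm ((x::'a::cbanach_algebra) ^ n) \<le> K ^ n" "n > 0" "K \<ge> 0" shows "spectral_radius x \<le> K"
proof (rule spectral_radius_leI, rule ccontr)
  fix z assume z: "z \<in> cspectrum x" and "\<not> cmod z \<le> K"
  then have "K ^ n < cmod z ^ n" using assms by (intro power_strict_mono) auto
  then show False using inv_el_beyond_norm_power[of x n z] z assms by (auto simp: cspectrum_iff)
qed

lemma spectral_radius_le_norm: "spectral_radius (x::'a::cbanach_algebra) \<le> norm x"
  using spectral_radius_power_le[of x 1 "norm x"] by simp

text \<open>The hard half of the spectral radius formula. The strict inequality leaves room for a
  radius \<open>s'\<close> at which \<open>power_tendsto_zero\<close> applies.\<close>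

lemma spectral_radius_lt_imp:
  fixes x :: "'a::cbanach_algebra"
  assumes "spectral_radius x < s" shows "\<forall>\<^sub>F N in sequentially. norm (x ^ N) < s ^ N"
proof -
  obtain s' where s': "spectral_radius x < s'" "s' < s" using assms dense by blast
  have p: "s' > 0" "s > 0" using s' spectral_radius_nonneg[of x] by linarith+
  have "(\<lambda>N. (1/s) ^ N * norm (x ^ N)) \<longlonglongrightarrow> 0"
    by (rule power_tendsto_zero[of s']) (use s' p in \<open>auto intro!: inv_el_beyond simp: field_simps\<close>)
  then have "\<forall>\<^sub>F N in sequentially. (1/s) ^ N * norm (x ^ N) < 1" by (rule order_tendstoD) simp
  then show ?thesis by eventually_elim (use p in \<open>simp add: field_simps\<close>)
qed

lemma qn_power_tendsto:
  fixes x :: "'a::cbanach_algebra"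
  assumes "spectral_radius x = 0" shows "(\<lambda>N. t ^ N * norm (x ^ N)) \<longlonglongrightarrow> 0"
proof -
  have "(\<lambda>N. \<bar>t\<bar> ^ N * norm (x ^ N)) \<longlonglongrightarrow> 0"
    by (rule power_tendsto_zero[of "1 / (\<bar>t\<bar> + 1)"]) (use assms in \<open>auto intro!: inv_el_beyond intro: less_le_trans[rotated] simp: field_simps add_nonneg_pos\<close>)
  then show ?thesis by (rule Lim_null_comparison[rotated]) (auto simp: abs_mult power_abs)
qed

lemma cspectrum_cscale:
  assumes "c \<noteq> 0" shows "z \<in> cspectrum (cscale c x) \<longleftrightarrow> inverse c * z \<in> cspectrum (x::'a::cbanach_algebra)"
proof -
  have "cscale c x - cscale z 1 = cscale c (x - cscale (inverse c * z) 1)"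
    using assms by (simp add: cscale_diff_right cscale_cscale mult.assoc[symmetric])
  then show ?thesis using assms by (simp add: cspectrum_iff inv_el_cscale_iff)
qed

lemma spectral_radius_cscale: "spectral_radius (cscale c x) = cmod c * spectral_radius (x::'a::cbanach_algebra)"
proof (cases "c = 0")
  case True
  have "spectral_radius (0::'a) \<le> 0" using spectral_radius_le_norm[of "0::'a"] by simp
  then show ?thesis using True by (simp add: antisym)
next
  case False
  have le: "spectral_radius (cscale c x) \<le> cmod c * spectral_radius x" if "c \<noteq> 0" for c and x :: 'a
  proof (rule spectral_radius_leI)
    fix z assume "z \<in> cspectrum (cscale c x)"
    then have "cmod (inverse c * z) \<le> spectral_radius x"
      using that by (simp add: cspectrum_cscale cmod_le_spectral_radius)
    then show "cmod z \<le> cmod c * spectral_radius x" using that by (simp add: norm_mult norm_inverse norm_divide field_simps)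
  qed
  have "spectral_radius x \<le> cmod (inverse c) * spectral_radius (cscale c x)"
    using le[of "inverse c" "cscale c x"] False by (simp add: cscale_cscale)
  then have "cmod c * spectral_radius x \<le> spectral_radius (cscale c x)"
    using False by (simp add: norm_inverse norm_divide field_simps)
  then show ?thesis using le[OF False, of x] by simp
qed

lemma inv_el_conj_iff:
  assumes "inv_el u" shows "inv_el (u * x * alg_inv u) \<longleftrightarrow> inv_el (x::'a::cbanach_algebra)"
proof
  assume "inv_el (u * x * alg_inv u)"
  then have "inv_el (alg_inv u * (u * x * alg_inv u) * u)"
    by (rule inv_el_mult[OF inv_el_mult[OF inv_el_alg_inv[OF assms]] assms])
  moreover have "alg_inv u * (u * x * alg_inv u) * u = x"
    using alg_inv_cancel(2,4)[OF assms] by (simp add: mult.assoc)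
  ultimately show "inv_el x" by simp
qed (use assms in \<open>intro inv_el_mult inv_el_alg_inv\<close>)

lemma cspectrum_conj:
  assumes "inv_el u" shows "cspectrum (u * x * alg_inv u) = cspectrum (x::'a::cbanach_algebra)"
proof -
  have "u * x * alg_inv u - cscale z 1 = u * (x - cscale z 1) * alg_inv u" for z
    using assms by (simp add: algebra_simps cscale_mult_left cscale_mult_right alg_inv)
  then show ?thesis using assms by (simp add: cspectrum_def inv_el_conj_iff)
qed

lemma spectral_radius_conj:
  "inv_el u \<Longrightarrow> spectral_radius (u * x * alg_inv u) = spectral_radius (x::'a::cbanach_algebra)"
  by (simp add: spectral_radius_def cspectrum_conj)

section \<open>The spectral radius along affine lines: maximum principle, three circles,
  Liouville\<close>

lemma power_linear_expand:
  fixes u v :: "'a::cbanach_algebra"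
  shows "\<exists>c. c 0 = u ^ n \<and> (\<forall>k>n. c k = 0) \<and> (\<forall>\<mu>. (u + cscale \<mu> v) ^ n = (\<Sum>k\<le>n. cscale (\<mu> ^ k) (c k)))"
proof (induction n)
  case 0
  show ?case by (rule exI[of _ "\<lambda>k. if k = 0 then 1 else 0"]) auto
next
  case (Suc n)
  then obtain c where c: "c 0 = u ^ n" "\<And>k. k > n \<Longrightarrow> c k = 0"
    and e: "\<And>\<mu>. (u + cscale \<mu> v) ^ n = (\<Sum>k\<le>n. cscale (\<mu> ^ k) (c k))" by blast
  define d where "d k = u * c k + (case k of 0 \<Rightarrow> 0 | Suc j \<Rightarrow> v * c j)" for k
  have "(u + cscale \<mu> v) ^ Suc n = (\<Sum>k\<le>Suc n. cscale (\<mu> ^ k) (d k))" for \<mu>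
  proof -
    have "(u + cscale \<mu> v) ^ Suc n = u * (\<Sum>k\<le>n. cscale (\<mu> ^ k) (c k)) + cscale \<mu> v * (\<Sum>k\<le>n. cscale (\<mu> ^ k) (c k))"
      by (simp add: e distrib_right)
    also have "u * (\<Sum>k\<le>n. cscale (\<mu> ^ k) (c k)) = (\<Sum>k\<le>Suc n. cscale (\<mu> ^ k) (u * c k))"
      by (simp add: sum_distrib_left cscale_mult_right c)
    also have "cscale \<mu> v * (\<Sum>k\<le>n. cscale (\<mu> ^ k) (c k)) = (\<Sum>k\<le>n. cscale (\<mu> ^ Suc k) (v * c k))"
      by (simp add: sum_distrib_left cscale_mult_right cscale_mult_left cscale_cscale mult.commute)
    also have "\<dots> = (\<Sum>k\<le>Suc n. cscale (\<mu> ^ k) (case k of 0 \<Rightarrow> 0 | Suc j \<Rightarrow> v * c j))"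
      by (subst sum.atMost_Suc_shift) simp
    finally show ?thesis by (simp add: d_def cscale_add_right sum.distrib)
  qed
  moreover have "d 0 = u ^ Suc n" by (simp add: d_def c)
  moreover have "\<forall>k>Suc n. d k = 0" by (auto simp: d_def c split: nat.split)
  ultimately show ?case by blast
qed

lemma spectral_radius_power_le_norm: "spectral_radius x ^ n \<le> norm ((x::'a::cbanach_algebra) ^ n)"
proof (cases "n = 0")
  case False
  have e: "root n (norm (x ^ n)) ^ n = norm (x ^ n)" using False by simp
  have "spectral_radius x \<le> root n (norm (x ^ n))"
    by (rule spectral_radius_power_le) (use False in auto)
  then have "spectral_radius x ^ n \<le> root n (norm (x ^ n)) ^ n" by (rule power_mono) simp
  then show ?thesis using e by simp
qed simp

text \<open>One exponent \<open>N\<close> certifies the strict bound at \<open>x\<close>, and the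
  norm of the \<open>N\<close>-th power is continuous.\<close>

lemma spectral_radius_usc:
  fixes x :: "'a::cbanach_algebra"
  assumes "spectral_radius x < s" shows "\<forall>\<^sub>F y in nhds x. spectral_radius y < s"
proof -
  obtain t where t: "spectral_radius x < t" "t < s" using assms dense by blast
  have t0: "t > 0" using t spectral_radius_nonneg[of x] by linarith
  have "\<forall>\<^sub>F N in sequentially. norm (x ^ N) < t ^ N \<and> N > 0"
    using spectral_radius_lt_imp[OF t(1)] eventually_gt_at_top[of 0] by eventually_elim auto
  then obtain N where N: "norm (x ^ N) < t ^ N" "N > 0" by (auto simp: eventually_sequentially)
  have "((\<lambda>y. norm (y ^ N)) \<longlongrightarrow> norm (x ^ N)) (nhds x)"
    by (intro tendsto_intros filterlim_ident)
  then have "\<forall>\<^sub>F y in nhds x. norm (y ^ N) < t ^ N" using N(1) by (rule order_tendstoD)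
  then show ?thesis
  proof eventually_elim
    case (elim y)
    then have "spectral_radius y \<le> t" using N t0 by (intro spectral_radius_power_le) auto
    then show ?case using t by simp
  qed
qed

text \<open>Compactness of the circle makes the exponent uniform in \<open>\<mu>\<close>. Exponents
  of the form \<open>2 ^ j\<close> make the open sets \<open>U j\<close> increase, since squaring
  preserves the strict bound.\<close>

lemma uniform_power_bound:
  fixes u v :: "'a::cbanach_algebra"
  assumes K: "\<And>\<mu>. cmod \<mu> = R \<Longrightarrow> spectral_radius (u + cscale \<mu> v) < K"
  shows "\<forall>\<^sub>F j in sequentially. \<forall>\<mu>. cmod \<mu> = R \<longrightarrow> norm ((u + cscale \<mu> v) ^ (2 ^ j)) \<le> K ^ (2 ^ j)"
proof -
  define U where "U j = {\<mu>. norm ((u + cscale \<mu> v) ^ (2 ^ j)) < K ^ (2 ^ j)}" for j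
  have "open (U j)" for j unfolding U_def by (intro open_Collect_less continuous_intros)
  have suc: "U j \<subseteq> U (Suc j)" for j
  proof
    fix \<mu> assume "\<mu> \<in> U j"
    define y where "y = (u + cscale \<mu> v) ^ (2 ^ j)"
    have y: "norm y < K ^ (2 ^ j)" using \<open>\<mu> \<in> U j\<close> by (simp add: U_def y_def)
    have "norm (y * y) \<le> norm y * norm y" by (rule norm_mult_ineq)
    also have "\<dots> < K ^ (2 ^ j) * K ^ (2 ^ j)" using y by (intro mult_strict_mono) (auto intro: le_less_trans[OF norm_ge_zero])
    finally show "\<mu> \<in> U (Suc j)" by (simp add: U_def y_def power_add[symmetric] mult_2)
  qed
  have mono: "j \<le> k \<Longrightarrow> U j \<subseteq> U k" for j k using lift_Suc_mono_le[of U j k] suc by blast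
  have "sphere 0 R \<subseteq> (\<Union>j. U j)"
  proof
    fix \<mu> :: complex assume "\<mu> \<in> sphere 0 R"
    then have "\<forall>\<^sub>F N in sequentially. norm ((u + cscale \<mu> v) ^ N) < K ^ N"
      using K by (intro spectral_radius_lt_imp) auto
    then obtain N0 where N0: "\<And>N. N \<ge> N0 \<Longrightarrow> norm ((u + cscale \<mu> v) ^ N) < K ^ N"
      by (auto simp: eventually_sequentially)
    have "N0 \<le> 2 ^ N0" by (simp add: less_imp_le)
    then show "\<mu> \<in> (\<Union>j. U j)" using N0[of "2 ^ N0"] by (auto simp: U_def)
  qed
  then obtain J where J: "finite J" "sphere 0 R \<subseteq> (\<Union>j\<in>J. U j)"
    using compactE_image[of "sphere 0 R" UNIV U] \<open>\<And>j. open (U j)\<close> by auto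
  have "\<forall>\<mu>. cmod \<mu> = R \<longrightarrow> norm ((u + cscale \<mu> v) ^ (2 ^ j)) \<le> K ^ (2 ^ j)" if "j \<ge> Max (insert 0 J)" for j
  proof (intro allI impI)
    fix \<mu> :: complex assume "cmod \<mu> = R"
    then obtain i where i: "i \<in> J" "\<mu> \<in> U i" using J by auto
    then have "i \<le> j" using that J by auto
    then have "\<mu> \<in> U j" using mono i by blast
    then show "norm ((u + cscale \<mu> v) ^ (2 ^ j)) \<le> K ^ (2 ^ j)" by (simp add: U_def)
  qed
  then show ?thesis by (auto simp: eventually_sequentially)
qed

text \<open>The constant coefficient of \<open>(u + cscale \<mu> v) ^ (2 ^ j)\<close> is
  \<open>u ^ (2 ^ j)\<close>, and the Cauchy estimate bounds it by the values on the circle. This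
  takes the place of subharmonicity of the spectral radius.\<close>

lemma spectral_max_principle:
  fixes u v :: "'a::cbanach_algebra"
  assumes R: "R > 0" and K: "\<And>\<mu>. cmod \<mu> = R \<Longrightarrow> spectral_radius (u + cscale \<mu> v) \<le> K"
  shows "spectral_radius u \<le> K"
proof (rule dense_ge)
  fix K' assume K': "K < K'"
  have "K \<ge> 0" using K[of "of_real R"] R spectral_radius_nonneg[of "u + cscale (of_real R) v"] by (simp del: spectral_radius_nonneg)
  have "\<forall>\<^sub>F j in sequentially. \<forall>\<mu>. cmod \<mu> = R \<longrightarrow> norm ((u + cscale \<mu> v) ^ (2 ^ j)) \<le> K' ^ (2 ^ j)"
    by (rule uniform_power_bound) (use K K' in force)
  then obtain j where j: "\<And>\<mu>. cmod \<mu> = R \<Longrightarrow> norm ((u + cscale \<mu> v) ^ (2 ^ j)) \<le> K' ^ (2 ^ j)"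
    by (auto simp: eventually_sequentially)
  obtain c where c: "c 0 = u ^ (2 ^ j)"
    "\<And>\<mu>. (u + cscale \<mu> v) ^ (2 ^ j) = (\<Sum>k\<le>2 ^ j. cscale (\<mu> ^ k) (c k))"
    using power_linear_expand[of u "2 ^ j" v] by blast
  have "norm (c 0) * R ^ 0 \<le> K' ^ (2 ^ j)"
    by (rule Cauchy_estimate[where n = "2 ^ j"]) (use j c R in auto)
  then show "spectral_radius u \<le> K'"
    using c K' \<open>K \<ge> 0\<close> by (intro spectral_radius_power_le[of u "2 ^ j"]) auto
qed

text \<open>Hadamard's three circles: interpolating the two Cauchy estimates for each coefficient of the
  polynomial \<open>(u + \<mu> v)\<^sup>n\<close> costs only a factor \<open>n + 1\<close>, which disappears in the \<open>n\<close>-th root.\<close>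

lemma spectral_three_circles:
  fixes u v :: "'a::cbanach_algebra"
  assumes eR: "0 < \<epsilon>" "\<epsilon> < 1" "1 < R"
    and K0: "\<And>\<mu>. cmod \<mu> = \<epsilon> \<Longrightarrow> spectral_radius (u + cscale \<mu> v) < K0"
    and K1: "\<And>\<mu>. cmod \<mu> = R \<Longrightarrow> spectral_radius (u + cscale \<mu> v) < K1"
    and \<theta>: "\<theta> = ln (1 / \<epsilon>) / ln (R / \<epsilon>)"
  shows "spectral_radius (u + v) \<le> K0 powr (1 - \<theta>) * K1 powr \<theta>"
proof (rule ccontr)
  define Q where "Q = K0 powr (1 - \<theta>) * K1 powr \<theta>"
  define r where "r = spectral_radius (u + v)"
  assume "\<not> spectral_radius (u + v) \<le> K0 powr (1 - \<theta>) * K1 powr \<theta>"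
  then have Qr: "Q < r" by (simp add: Q_def r_def)
  have pos: "K0 > 0" "K1 > 0"
    using K0[of "of_real \<epsilon>"] K1[of "of_real R"] eR
      spectral_radius_nonneg[of "u + cscale (of_real \<epsilon>) v"] spectral_radius_nonneg[of "u + cscale (of_real R) v"]
    by (auto simp del: spectral_radius_nonneg)
  then have Q0: "Q > 0" by (simp add: Q_def)
  have l: "ln (R / \<epsilon>) > 0" "ln (1 / \<epsilon>) > 0" "ln (1 / \<epsilon>) < ln (R / \<epsilon>)"
    using eR by (auto simp: ln_div intro: divide_strict_right_mono)
  then have th: "0 < \<theta>" "\<theta> < 1" by (auto simp: \<theta>)
  \<comment> \<open>\<open>\<theta>\<close> locates the unit circle between the two given circles on
    a logarithmic scale; with this balance the radii cancel when the two estimates of one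
    coefficient are interpolated.\<close>
  have "\<epsilon> powr (1 - \<theta>) * R powr \<theta> = exp ((1 - \<theta>) * ln \<epsilon> + \<theta> * ln R)"
    using eR by (simp add: powr_def exp_add)
  also have "(1 - \<theta>) * ln \<epsilon> + \<theta> * ln R = ln \<epsilon> + \<theta> * ln (R / \<epsilon>)"
    using eR by (simp add: ln_div algebra_simps)
  also have "\<dots> = 0" using l eR by (simp add: \<theta> ln_div)
  finally have bal: "\<epsilon> powr (1 - \<theta>) * R powr \<theta> = 1" by simp
  have e0: "\<forall>\<^sub>F j in sequentially. \<forall>\<mu>. cmod \<mu> = \<epsilon> \<longrightarrow> norm ((u + cscale \<mu> v) ^ (2 ^ j)) \<le> K0 ^ (2 ^ j)"
    by (rule uniform_power_bound) (rule K0)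
  have e1: "\<forall>\<^sub>F j in sequentially. \<forall>\<mu>. cmod \<mu> = R \<longrightarrow> norm ((u + cscale \<mu> v) ^ (2 ^ j)) \<le> K1 ^ (2 ^ j)"
    by (rule uniform_power_bound) (rule K1)
  from e0 e1 have "\<forall>\<^sub>F j in sequentially. r ^ (2 ^ j) \<le> (real (2 ^ j) + 1) * Q ^ (2 ^ j)"
  proof eventually_elim
    case (elim j)
    define n where "n = (2::nat) ^ j"
    obtain c where c: "\<And>\<mu>. (u + cscale \<mu> v) ^ n = (\<Sum>k\<le>n. cscale (\<mu> ^ k) (c k))"
      using power_linear_expand[of u n v] by blast
    have ck: "norm (c k) \<le> Q ^ n" if "k \<le> n" for k
    proof (cases "c k = 0")
      case False
      define A where "A = norm (c k)"
      have A: "A > 0" using False by (simp add: A_def)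
      have 0: "A * \<epsilon> ^ k \<le> K0 ^ n" unfolding A_def
        by (rule Cauchy_estimate[OF _ _ that]) (use elim eR c in \<open>auto simp: n_def\<close>)
      have 1: "A * R ^ k \<le> K1 ^ n" unfolding A_def
        by (rule Cauchy_estimate[OF _ _ that]) (use elim eR c in \<open>auto simp: n_def\<close>)
      have pw: "(x ^ m) powr a = (x powr a) ^ m" if "x > 0" for x a :: real and m
        using that by (simp add: powr_realpow[symmetric] powr_powr mult.commute)
      have "A = A * (\<epsilon> powr (1 - \<theta>) * R powr \<theta>) ^ k" using bal by simp
      also have "\<dots> = (A * \<epsilon> ^ k) powr (1 - \<theta>) * (A * R ^ k) powr \<theta>"
        using A eR by (simp add: powr_mult pw power_mult_distrib powr_diff power_divide)
      also have "\<dots> \<le> (K0 ^ n) powr (1 - \<theta>) * (K1 ^ n) powr \<theta>"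
        using 0 1 th A eR by (intro mult_mono powr_mono2) auto
      also have "\<dots> = Q ^ n" using pos by (simp add: pw Q_def power_mult_distrib)
      finally show ?thesis by (simp add: A_def)
    qed (use Q0 in simp)
    have "r ^ n \<le> norm ((u + v) ^ n)" unfolding r_def by (rule spectral_radius_power_le_norm)
    also have "(u + v) ^ n = (\<Sum>k\<le>n. c k)" using c[of 1] by simp
    also have "norm (\<Sum>k\<le>n. c k) \<le> (\<Sum>k\<le>n. Q ^ n)" by (rule order_trans[OF norm_sum sum_mono]) (use ck in auto)
    finally show ?case by (simp add: n_def add.commute)
  qed
  moreover have "\<forall>\<^sub>F j in sequentially. (real (2 ^ j) + 1) * Q ^ (2 ^ j) < r ^ (2 ^ j)"
  proof -
    define q where "q = Q / r"
    have q: "0 < q" "q < 1" using Qr Q0 by (auto simp: q_def)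
    have "(\<lambda>n. of_nat n * q ^ n + q ^ n) \<longlonglongrightarrow> 0 + 0"
      by (intro tendsto_add powser_times_n_limit_0 LIMSEQ_realpow_zero) (use q in auto)
    then have "\<forall>\<^sub>F n in sequentially. real n * q ^ n + q ^ n < 1"
      by (intro order_tendstoD) auto
    moreover have "filterlim (\<lambda>j. (2::nat) ^ j) sequentially sequentially"
      by (rule filterlim_subseq) (auto simp: strict_mono_def)
    ultimately have "\<forall>\<^sub>F j in sequentially. real (2 ^ j) * q ^ (2 ^ j) + q ^ (2 ^ j) < 1"
      by (rule eventually_compose_filterlim)
    then show ?thesis
      by eventually_elim (use Qr Q0 in \<open>simp add: q_def power_divide field_simps\<close>)
  qed
  ultimately have "\<forall>\<^sub>F j::nat in sequentially. False" by eventually_elim auto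
  then show False by simp
qed

text \<open>The weight of the outer bound tends to zero as \<open>R\<close> grows, so a bound
  \<open>K1\<close> independent of \<open>R\<close> disappears from the estimate.\<close>

lemma three_circles_limit:
  fixes a \<epsilon> K0 K1 :: real
  assumes \<epsilon>: "0 < \<epsilon>" and K: "K0 > 0" "K1 > 0"
    and le: "\<And>R. R > 1 \<Longrightarrow> a \<le> K0 powr (1 - ln (1 / \<epsilon>) / ln (R / \<epsilon>)) * K1 powr (ln (1 / \<epsilon>) / ln (R / \<epsilon>))"
  shows "a \<le> K0"
proof -
  define \<theta> where "\<theta> R = ln (1 / \<epsilon>) / ln (R / \<epsilon>)" for R
  have "filterlim (\<lambda>R. R / \<epsilon>) at_top at_top"
    using \<epsilon> filterlim_tendsto_pos_mult_at_top[OF tendsto_const, of "inverse \<epsilon>" "\<lambda>R. R" at_top] filterlim_ident[of at_top]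
    by (simp add: field_simps)
  then have "filterlim (\<lambda>R. ln (R / \<epsilon>)) at_top at_top"
    by (rule filterlim_compose[OF ln_at_top])
  then have th: "(\<theta> \<longlongrightarrow> 0) at_top" unfolding \<theta>_def
    by (rule real_tendsto_divide_at_top[OF tendsto_const])
  have "((\<lambda>R. K0 powr (1 - \<theta> R) * K1 powr \<theta> R) \<longlongrightarrow> K0 powr (1 - 0) * K1 powr 0) at_top"
    by (intro tendsto_intros th) (use K in auto)
  moreover have "\<forall>\<^sub>F R in at_top. a \<le> K0 powr (1 - \<theta> R) * K1 powr \<theta> R"
    using eventually_gt_at_top[of 1] by eventually_elim (use le in \<open>auto simp: \<theta>_def\<close>)
  ultimately have "a \<le> K0 powr (1 - 0) * K1 powr 0"
    by (intro tendsto_lowerbound[where F = at_top]) auto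
  then show ?thesis using K by simp
qed

text \<open>Semicontinuity supplies an inner circle on which the radius is below \<open>K0\<close>;
  the global bound holds on every outer circle and is removed by letting \<open>R\<close> tend to
  infinity.\<close>

lemma spectral_Liouville_aux:
  fixes u v :: "'a::cbanach_algebra"
  assumes K: "\<And>t. spectral_radius (u + cscale t v) \<le> K"
  shows "spectral_radius (u + v) \<le> spectral_radius u"
proof (rule dense_ge)
  fix K0 assume K0: "spectral_radius u < K0"
  have K1: "K \<ge> 0" using K[of 0] spectral_radius_nonneg[of u] by (simp del: spectral_radius_nonneg)
  have K00: "K0 > 0" using K0 spectral_radius_nonneg[of u] by linarith
  have "((\<lambda>\<mu>. u + cscale \<mu> v) \<longlongrightarrow> u + cscale 0 v) (nhds 0)" by (intro tendsto_intros filterlim_ident)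
  then have "((\<lambda>\<mu>. u + cscale \<mu> v) \<longlongrightarrow> u) (nhds 0)" by simp
  then have "\<forall>\<^sub>F \<mu> in nhds 0. spectral_radius (u + cscale \<mu> v) < K0"
    using eventually_compose_filterlim[OF spectral_radius_usc[OF K0]] by blast
  then obtain d where d: "d > 0" "\<And>\<mu>. cmod \<mu> < d \<Longrightarrow> spectral_radius (u + cscale \<mu> v) < K0"
    by (auto simp: eventually_nhds_metric)
  define \<epsilon> where "\<epsilon> = min (1/2) (d/2)"
  have \<epsilon>: "0 < \<epsilon>" "\<epsilon> < 1" "\<epsilon> < d" using d by (auto simp: \<epsilon>_def)
  have K': "spectral_radius (u + cscale t v) < K + 1" for t using K[of t] by linarith
  show "spectral_radius (u + v) \<le> K0"
    by (rule three_circles_limit[OF \<epsilon>(1) K00, of "K + 1"], use K1 in simp,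
        rule spectral_three_circles[OF \<epsilon>(1,2)]) (use d \<epsilon> K' in auto)
qed

text \<open>Equality follows by running the line backwards from \<open>u + cscale t v\<close>. For
  the second claim, \<open>v + cscale \<mu> u\<close> is \<open>\<mu>\<close> times a point of the
  line, so the maximum principle on a circle of radius \<open>\<rho>\<close> bounds the radius of
  \<open>v\<close> by \<open>\<rho>\<close> times that of \<open>u\<close>.\<close>

lemma spectral_Liouville:
  fixes u v :: "'a::cbanach_algebra"
  assumes K: "\<And>t. spectral_radius (u + cscale t v) \<le> K"
  shows "spectral_radius (u + cscale t v) = spectral_radius u" "spectral_radius v = 0"
proof -
  have le: "spectral_radius (u + cscale t v) \<le> spectral_radius u" for t
    by (rule spectral_Liouville_aux[where K = K]) (use K in \<open>simp add: cscale_cscale\<close>)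
  have "spectral_radius (u + cscale t v + - cscale t v) \<le> spectral_radius (u + cscale t v)"
  proof (rule spectral_Liouville_aux[where K = K])
    show "spectral_radius (u + cscale t v + cscale s (- cscale t v)) \<le> K" for s
      using K[of "t - s * t"] by (simp add: cscale_cscale cscale_diff_left add_diff_eq)
  qed
  then show "spectral_radius (u + cscale t v) = spectral_radius u" using le[of t] by simp
  have "spectral_radius v \<le> R" if "R > 0" for R
  proof -
    define \<rho> where "\<rho> = R / (spectral_radius u + 1)"
    have \<rho>: "\<rho> > 0" using that by (simp add: \<rho>_def add_nonneg_pos)
    have "spectral_radius v \<le> \<rho> * spectral_radius u"
    proof (rule spectral_max_principle[OF \<rho>])
      fix \<mu> :: complex assume m: "cmod \<mu> = \<rho>"
      then have "v + cscale \<mu> u = cscale \<mu> (u + cscale (inverse \<mu>) v)"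
        using \<rho> by (auto simp: cscale_add_right cscale_cscale add.commute)
      then show "spectral_radius (v + cscale \<mu> u) \<le> \<rho> * spectral_radius u"
        using m le[of "inverse \<mu>"] \<rho> by (simp add: spectral_radius_cscale)
    qed
    also have "\<dots> \<le> R" using that spectral_radius_nonneg[of u]
      by (simp add: \<rho>_def divide_le_eq add_nonneg_pos mult_le_cancel_left del: spectral_radius_nonneg)
    finally show ?thesis .
  qed
  then show "spectral_radius v = 0"
    by (metis dual_order.irrefl linorder_not_le order_le_less spectral_radius_nonneg dense)
qed

subsection \<open>Maximal left ideals and the open mapping theorem\<close>

lemma maximal_left_idealD:
  assumes "maximal_left_ideal L"
  shows "left_ideal L" "L \<noteq> UNIV" "\<And>M. left_ideal M \<Longrightarrow> M \<noteq> UNIV \<Longrightarrow> L \<subseteq> M \<Longrightarrow> M = L"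
  using assms by (auto simp: maximal_left_ideal_def)

lemma left_idealD:
  assumes "left_ideal L"
  shows "0 \<in> L" "x \<in> L \<Longrightarrow> y \<in> L \<Longrightarrow> x + y \<in> L" "x \<in> L \<Longrightarrow> cscale c x \<in> L" "x \<in> L \<Longrightarrow> a * x \<in> L"
    "x \<in> L \<Longrightarrow> - x \<in> L" "x \<in> L \<Longrightarrow> y \<in> L \<Longrightarrow> x - y \<in> L"
proof -
  show 1: "0 \<in> L" "x \<in> L \<Longrightarrow> y \<in> L \<Longrightarrow> x + y \<in> L" "x \<in> L \<Longrightarrow> cscale c x \<in> L" "x \<in> L \<Longrightarrow> a * x \<in> L"
    for x y c a using assms by (auto simp: left_ideal_def)
  show 2: "x \<in> L \<Longrightarrow> - x \<in> L" for x using 1(3)[of x "-1"] by simp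
  show "x \<in> L \<Longrightarrow> y \<in> L \<Longrightarrow> x - y \<in> L" using 1(2)[of x "-y"] 2[of y] by simp
qed

lemma left_ideal_eq_UNIV:
  assumes "left_ideal L" "inv_el x" "x \<in> L" shows "L = UNIV"
proof -
  have "1 \<in> L" using left_idealD(4)[OF assms(1,3), of "alg_inv x"] alg_inv[OF assms(2)] by simp
  then have "a \<in> L" for a using left_idealD(4)[OF assms(1), of 1 a] by simp
  then show ?thesis by auto
qed

lemma maximal_left_ideal_no_inv: "maximal_left_ideal L \<Longrightarrow> x \<in> L \<Longrightarrow> \<not> inv_el x"
  using left_ideal_eq_UNIV maximal_left_idealD by blast

text \<open>Simplicity of the left module \<open>A/L\<close>: the vector \<open>x + L\<close> is
  nonzero and therefore generates it.\<close>

lemma maximal_left_ideal_solve: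
  fixes x :: "'a::cbanach_algebra"
  assumes L: "maximal_left_ideal L" and x: "x \<notin> L"
  obtains y where "y * x - 1 \<in> L"
proof -
  note Ld = left_idealD[OF maximal_left_idealD(1)[OF L]]
  define M where "M = {l + y * x | l y. l \<in> L}"
  have MI: "l \<in> L \<Longrightarrow> l + y * x \<in> M" for l y by (auto simp: M_def)
  have "left_ideal M" unfolding left_ideal_def
  proof (intro conjI ballI allI)
    show "0 \<in> M" using MI[OF Ld(1), of 0] by simp
  next
    fix u v assume "u \<in> M" "v \<in> M"
    then obtain l y l' y' where "u = l + y * x" "v = l' + y' * x" "l \<in> L" "l' \<in> L" by (auto simp: M_def)
    then have "u + v = (l + l') + (y + y') * x" "l + l' \<in> L" by (auto simp: algebra_simps Ld)
    then show "u + v \<in> M" using MI by metis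
  next
    fix c u assume "u \<in> M"
    then obtain l y where "u = l + y * x" "l \<in> L" by (auto simp: M_def)
    then have "cscale c u = cscale c l + cscale c y * x" "cscale c l \<in> L"
      by (auto simp: cscale_add_right cscale_mult_left Ld)
    then show "cscale c u \<in> M" using MI by metis
  next
    fix a u assume "u \<in> M"
    then obtain l y where "u = l + y * x" "l \<in> L" by (auto simp: M_def)
    then have "a * u = a * l + (a * y) * x" "a * l \<in> L" by (auto simp: algebra_simps Ld)
    then show "a * u \<in> M" using MI by metis
  qed
  moreover have "L \<subseteq> M" using MI[of _ 0] by auto
  moreover have "x \<in> M" using MI[OF Ld(1), of 1] by simp
  ultimately have "M = UNIV" using maximal_left_idealD(3)[OF L] x by blast
  then have "1 \<in> M" by simp
  then obtain l y where "1 = l + y * x" "l \<in> L" by (auto simp: M_def)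
  then have "y * x - 1 = - l" by (simp add: algebra_simps)
  then have "y * x - 1 \<in> L" using \<open>l \<in> L\<close> Ld by simp
  then show ?thesis by (rule that)
qed

lemma spectral_radius_ge_one:
  assumes "maximal_left_ideal L" "e - 1 \<in> L" shows "1 \<le> spectral_radius (e::'a::cbanach_algebra)"
proof -
  have "1 \<in> cspectrum e" using maximal_left_ideal_no_inv[OF assms] by (simp add: cspectrum_iff)
  then show ?thesis using cmod_le_spectral_radius by force
qed

text \<open>Under the stability assumption \<open>d\<close> acts on \<open>A/L\<close> by a module
  endomorphism. If \<open>v * d\<close> is \<open>1\<close> modulo \<open>L\<close>, this iterates
  to \<open>v ^ n * d ^ n\<close> being \<open>1\<close> modulo \<open>L\<close> for all
  \<open>n\<close>, but the powers of a quasinilpotent \<open>d\<close> decay faster than those of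
  \<open>v\<close> grow.\<close>

lemma maximal_left_ideal_qn_stable:
  fixes d :: "'a::cbanach_algebra"
  assumes L: "maximal_left_ideal L" and d: "spectral_radius d = 0" and st: "\<And>x. x \<in> L \<Longrightarrow> x * d \<in> L"
  shows "d \<in> L"
proof (rule ccontr)
  note Ld = left_idealD[OF maximal_left_idealD(1)[OF L]]
  assume "d \<notin> L"
  then obtain v where v: "v * d - 1 \<in> L" using maximal_left_ideal_solve[OF L] by blast
  have stn: "x * d ^ n \<in> L" if "x \<in> L" for x n
    using that by (induction n) (simp_all add: power_Suc2 mult.assoc[symmetric] st del: power_Suc)
  have vn: "v ^ n * d ^ n - 1 \<in> L" for n
  proof (induction n)
    case (Suc n)
    have "v ^ Suc n * d ^ Suc n - 1 = v ^ n * ((v * d - 1) * d ^ n) + (v ^ n * d ^ n - 1)"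
      by (simp only: power_Suc2[of v] power_Suc[of d]) (simp add: algebra_simps)
    then show ?case using Ld(2)[OF Ld(4)[OF stn[OF v]] Suc] by (simp only:)
  qed (use Ld in simp)
  have "(\<lambda>N. norm v ^ N * norm (d ^ N)) \<longlonglongrightarrow> 0" by (rule qn_power_tendsto[OF d])
  then have "\<forall>\<^sub>F N in sequentially. norm v ^ N * norm (d ^ N) < 1" by (rule order_tendstoD) simp
  then obtain N where N: "norm v ^ N * norm (d ^ N) < 1" by (auto simp: eventually_sequentially)
  have "norm (v ^ N * d ^ N) \<le> norm (v ^ N) * norm (d ^ N)" by (rule norm_mult_ineq)
  also have "\<dots> \<le> norm v ^ N * norm (d ^ N)" by (intro mult_right_mono norm_power_ineq) auto
  finally have "inv_el (1 - v ^ N * d ^ N)" using N by (intro neumann) auto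
  then have "inv_el (v ^ N * d ^ N - 1)" using inv_el_minus_iff[of "1 - v ^ N * d ^ N"] by simp
  then show False using maximal_left_ideal_no_inv[OF L vn] by blast
qed

text \<open>The instance of Jacobson's density theorem that is used: some \<open>x\<close> kills the
  vector \<open>1 + L\<close> and sends \<open>d + L\<close> to \<open>1 + L\<close>.
  Quasinilpotence of \<open>d\<close> plays the role of linear independence of the two
  vectors.\<close>

lemma maximal_left_ideal_qn_density:
  fixes d :: "'a::cbanach_algebra"
  assumes L: "maximal_left_ideal L" and d: "spectral_radius d = 0" "d \<notin> L"
  obtains x where "x \<in> L" "x * d - 1 \<in> L"
proof -
  obtain x where x: "x \<in> L" "x * d \<notin> L" using maximal_left_ideal_qn_stable[OF L d(1)] d(2) by blast
  obtain y where "y * (x * d) - 1 \<in> L" using maximal_left_ideal_solve[OF L x(2)] .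
  moreover have "y * x \<in> L" using left_idealD(4)[OF maximal_left_idealD(1)[OF L] x(1)] .
  ultimately show ?thesis by (intro that[of "y * x"]) (simp_all add: mult.assoc)
qed

text \<open>This is the annihilator of the nonzero vector \<open>b + L\<close> of
  \<open>A/L\<close>. A larger left ideal contains some \<open>m\<close> with
  \<open>m * b \<notin> L\<close>; solving \<open>y * (m * b) = 1\<close> modulo \<open>L\<close>
  shows that \<open>b * y * m - 1\<close> annihilates \<open>b + L\<close>, which forces
  \<open>1\<close> into the ideal.\<close>

lemma maximal_left_ideal_transporter:
  fixes b :: "'a::cbanach_algebra"
  assumes L: "maximal_left_ideal L" and b: "b \<notin> L"
  shows "maximal_left_ideal {x. x * b \<in> L}"
proof -
  note Ld = left_idealD[OF maximal_left_idealD(1)[OF L]]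
  have "left_ideal {x. x * b \<in> L}"
    unfolding left_ideal_def using Ld by (auto simp: distrib_right cscale_mult_left mult.assoc)
  moreover have "1 \<notin> {x. x * b \<in> L}" using b by simp
  then have "{x. x * b \<in> L} \<noteq> UNIV" by blast
  moreover have "M = {x. x * b \<in> L}" if M: "left_ideal M" "M \<noteq> UNIV" "{x. x * b \<in> L} \<subseteq> M" for M
  proof (rule ccontr)
    note Md = left_idealD[OF M(1)]
    assume "M \<noteq> {x. x * b \<in> L}"
    then obtain m where m: "m \<in> M" "m * b \<notin> L" using M by auto
    obtain y where y: "y * (m * b) - 1 \<in> L" using maximal_left_ideal_solve[OF L m(2)] .
    have "(b * y * m - 1) * b = b * (y * (m * b) - 1)" by (simp add: algebra_simps mult.assoc)
    then have "(b * y * m - 1) * b \<in> L" using Ld(4)[OF y, of b] by (simp only:)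
    then have "b * y * m - 1 \<in> M" using M(3) by blast
    then have "b * y * m - (b * y * m - 1) \<in> M" by (rule Md(6)[OF Md(4)[OF m(1)]])
    then show False using left_ideal_eq_UNIV[OF M(1), of 1] M(2) by simp
  qed
  ultimately show ?thesis unfolding maximal_left_ideal_def by blast
qed

lemma semisimpleD:
  assumes "semisimple TYPE('a::cbanach_algebra)" "\<And>L. maximal_left_ideal L \<Longrightarrow> (x::'a) \<in> L"
  shows "x = 0"
  using assms by (auto simp: semisimple_def jacobson_radical_def)

section \<open>Baire category and the open mapping theorem\<close>

lemma Baire_ball:
  fixes F :: "nat \<Rightarrow> 'a::banach set"
  assumes "(\<Union>n. F n) = UNIV"
  obtains n x r where "r > 0" "ball x r \<subseteq> closure (F n)"
proof -
  have mc: "Met_TC.mcomplete (TYPE('a))"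
    by (metis complete_UNIV mcomplete_iff_complete)
  show ?thesis
  proof (rule ccontr)
    assume "\<not> thesis"
    then have emp: "interior (closure (F n)) = {}" for n
      using that by (metis all_not_in_conv mem_interior)
    have "Met_TC.mtopology interior_of \<Union>(range (\<lambda>n. closure (F n))) = {}"
      by (rule Met_TC.metric_Baire_category_alt[OF mc]) (auto simp: emp)
    moreover have "\<Union>(range (\<lambda>n. closure (F n))) = UNIV" using assms closure_subset by blast
    ultimately show False by simp
  qed
qed

text \<open>Formulated for a closed relation so that a closed graph is the only analytic input:
  openness is obtained directly from it.\<close>

lemma open_mapping_closed_relation:
  fixes G :: "('a::banach \<times> 'b::banach) set"
  assumes G: "subspace G" "closed G" and surj: "\<And>y. \<exists>x. (x, y) \<in> G"
  obtains K where "K > 0" "\<And>y. \<exists>x. (x, y) \<in> G \<and> norm x \<le> K * norm y"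
proof -
  have Gadd: "(x + x', y + y') \<in> G" if "(x, y) \<in> G" "(x', y') \<in> G" for x y x' y'
    using subspace_add[OF G(1) that] by simp
  have Gdiff: "(x - x', y - y') \<in> G" if "(x, y) \<in> G" "(x', y') \<in> G" for x y x' y'
    using subspace_diff[OF G(1) that] by simp
  have Gscale: "(c *\<^sub>R x, c *\<^sub>R y) \<in> G" if "(x, y) \<in> G" for x y c
    using subspace_scale[OF G(1) that] by simp
  define B where "B n = {y. \<exists>x. (x, y) \<in> G \<and> norm x \<le> real n}" for n
  have "y \<in> (\<Union>n. B n)" for y
  proof -
    obtain x where "(x, y) \<in> G" using surj by blast
    moreover obtain n where "norm x \<le> real n" using real_arch_simple by blast
    ultimately show ?thesis by (auto simp: B_def)
  qed
  then have "(\<Union>n. B n) = UNIV" by blast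
  then obtain n y0 r where r: "r > 0" "ball y0 r \<subseteq> closure (B n)" using Baire_ball by metis
  \<comment> \<open>Approximating the centre and a shifted point and subtracting moves the ball to
    the origin, at the price of the factor \<open>2\<close>.\<close>
  have approx: "\<exists>x y'. (x, y') \<in> G \<and> norm x \<le> 2 * n \<and> norm (y - y') < \<epsilon>" if "norm y < r" "\<epsilon> > 0" for y \<epsilon>
  proof -
    have "y0 + y \<in> ball y0 r" "y0 \<in> ball y0 r" using r that by (auto simp: dist_norm)
    then have "y0 + y \<in> closure (B n)" "y0 \<in> closure (B n)" using r(2) by blast+
    moreover have "\<epsilon>/2 > 0" using that by simp
    ultimately have "\<exists>y1\<in>B n. dist y1 (y0 + y) < \<epsilon>/2" "\<exists>y2\<in>B n. dist y2 y0 < \<epsilon>/2"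
      unfolding closure_approachable by blast+
    then obtain y1 y2 where "y1 \<in> B n" "dist y1 (y0 + y) < \<epsilon>/2" "y2 \<in> B n" "dist y2 y0 < \<epsilon>/2" by blast
    then obtain x1 x2 where x: "(x1, y1) \<in> G" "norm x1 \<le> n" "(x2, y2) \<in> G" "norm x2 \<le> n"
      and d: "norm (y0 + y - y1) < \<epsilon>/2" "norm (y2 - y0) < \<epsilon>/2" by (auto simp: B_def dist_norm norm_minus_commute)
    have "y - (y1 - y2) = (y0 + y - y1) + (y2 - y0)" by simp
    then have "norm (y - (y1 - y2)) \<le> norm (y0 + y - y1) + norm (y2 - y0)"
      by (simp only: norm_triangle_ineq)
    then have "norm (y - (y1 - y2)) < \<epsilon>" using d by linarith
    moreover have "norm (x1 - x2) \<le> 2 * n" using norm_triangle_ineq4[of x1 x2] x by simp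
    ultimately show ?thesis using Gdiff[OF x(1,3)] by blast
  qed
  \<comment> \<open>Rescaling \<open>y\<close> to norm \<open>r/2\<close> turns the bound
    \<open>2 * n\<close> into \<open>4 * n / r\<close>; the extra \<open>1\<close> keeps
    \<open>c\<close> positive when \<open>n = 0\<close>.\<close>
  define c where "c = (4 * n + 1) / r"
  have c: "c > 0" using r by (simp add: c_def add_nonneg_pos)
  have half: "\<exists>x y'. (x, y') \<in> G \<and> norm x \<le> c * norm y \<and> norm (y - y') \<le> norm y / 2" for y
  proof (cases "y = 0")
    case True
    then show ?thesis using subspace_0[OF G(1)] by (intro exI[of _ 0]) (auto simp: zero_prod_def)
  next
    case False
    define t where "t = r / (2 * norm y)"
    have t: "t > 0" using r False by (simp add: t_def)
    have ty: "norm (t *\<^sub>R y) = r / 2" using r False by (simp add: t_def)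
    then obtain x y' where x: "(x, y') \<in> G" "norm x \<le> 2 * n" "norm (t *\<^sub>R y - y') < r / 4"
      using approx[of "t *\<^sub>R y" "r/4"] r by auto
    have "((1/t) *\<^sub>R x, (1/t) *\<^sub>R y') \<in> G" by (rule Gscale[OF x(1)])
    moreover have "norm ((1/t) *\<^sub>R x) \<le> c * norm y"
    proof -
      have "norm ((1/t) *\<^sub>R x) = norm x / t" using t by simp
      also have "\<dots> \<le> (2 * n) / t" using x t by (intro divide_right_mono) auto
      also have "\<dots> = 4 * n / r * norm y" using r False by (simp add: t_def field_simps)
      also have "\<dots> \<le> c * norm y" using r by (intro mult_right_mono) (auto simp: c_def divide_right_mono)
      finally show ?thesis .
    qed
    moreover have "norm (y - (1/t) *\<^sub>R y') \<le> norm y / 2"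
    proof -
      have "y - (1/t) *\<^sub>R y' = (1/t) *\<^sub>R (t *\<^sub>R y - y')" using t by (simp add: scaleR_diff_right)
      then have "norm (y - (1/t) *\<^sub>R y') = norm (t *\<^sub>R y - y') / t" using t by simp
      also have "\<dots> \<le> (r / 4) / t" using x t by (intro divide_right_mono) auto
      also have "\<dots> = norm y / 2" using r False by (simp add: t_def)
      finally show ?thesis .
    qed
    ultimately show ?thesis by blast
  qed
  then obtain X Y where XY: "\<And>y. (X y, Y y) \<in> G" "\<And>y. norm (X y) \<le> c * norm y" "\<And>y. norm (y - Y y) \<le> norm y / 2"
    by metis
  have "\<exists>x. (x, y) \<in> G \<and> norm x \<le> 2 * c * norm y" for y
  proof -
    \<comment> \<open>Successive approximation: \<open>z k\<close> is the error left after
      \<open>k\<close> corrections, and every correction at least halves it.\<close>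
    define z where "z k = ((\<lambda>y. y - Y y) ^^ k) y" for k
    have z0: "z 0 = y" and zS: "z (Suc k) = z k - Y (z k)" for k by (simp_all add: z_def)
    have nz: "norm (z k) \<le> norm y * (1/2) ^ k" for k
    proof (induction k)
      case (Suc k) then show ?case using XY(3)[of "z k"] by (simp add: zS)
    qed (simp add: z0)
    define x where "x k = X (z k)" for k
    have nx: "norm (x k) \<le> c * norm y * (1/2) ^ k" for k
    proof -
      have "norm (x k) \<le> c * norm (z k)" unfolding x_def by (rule XY(2))
      also have "\<dots> \<le> c * (norm y * (1/2) ^ k)" using c nz by (intro mult_left_mono) auto
      finally show ?thesis by simp
    qed
    have sg: "(\<lambda>k. c * norm y * (1/2) ^ k) sums (c * norm y * 2)"
      using sums_mult[OF geometric_sums[of "1/2::real"], of "c * norm y"] by simp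
    have sn: "summable (\<lambda>k. norm (x k))"
      by (rule summable_comparison_test'[OF sums_summable[OF sg]]) (use nx in auto)
    then have sx: "summable x" by (rule summable_norm_cancel)
    have "norm (suminf x) \<le> (\<Sum>k. norm (x k))" by (rule summable_norm[OF sn])
    also have "\<dots> \<le> c * norm y * 2"
      using suminf_le[OF nx sn sums_summable[OF sg]] sums_unique[OF sg] by simp
    finally have bound: "norm (suminf x) \<le> 2 * c * norm y" by simp
    have part: "((\<Sum>k<m. x k), y - z m) \<in> G" for m
    proof (induction m)
      case 0 then show ?case using subspace_0[OF G(1)] by (simp add: z0 zero_prod_def)
    next
      case (Suc m)
      have "(x m, Y (z m)) \<in> G" unfolding x_def by (rule XY(1))
      from Gadd[OF Suc this] show ?case by (simp add: zS algebra_simps)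
    qed
    have "(\<lambda>m. norm y * (1/2) ^ m) \<longlonglongrightarrow> norm y * 0"
      by (rule tendsto_mult[OF tendsto_const LIMSEQ_realpow_zero]) auto
    then have "(\<lambda>m. norm y * (1/2) ^ m) \<longlonglongrightarrow> 0" by simp
    then have "z \<longlonglongrightarrow> 0" by (rule Lim_null_comparison[rotated]) (use nz in simp)
    then have "(\<lambda>m. y - z m) \<longlonglongrightarrow> y - 0" by (rule tendsto_diff[OF tendsto_const])
    then have "(\<lambda>m. ((\<Sum>k<m. x k), y - z m)) \<longlonglongrightarrow> (suminf x, y)"
      using summable_LIMSEQ[OF sx] by (intro tendsto_Pair) auto
    then have "(suminf x, y) \<in> G"
      by (rule closed_sequentially[OF G(2), rotated]) (use part in auto)
    then show ?thesis using bound by blast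
  qed
  then show ?thesis using c by (intro that[of "2 * c"]) auto
qed

section \<open>Compactness of the spectrum and peripheral points along affine lines\<close>

lemma closed_cspectrum: "closed (cspectrum (x::'a::cbanach_algebra))"
proof -
  have "open (- cspectrum x)"
  proof (subst open_subopen, rule ballI)
    fix z assume "z \<in> - cspectrum x"
    then have i: "inv_el (x - cscale z 1)" by (simp add: cspectrum_iff)
    have "((\<lambda>w. x - cscale w 1) \<longlongrightarrow> x - cscale z 1) (nhds z)" by (intro tendsto_intros filterlim_ident)
    then have "\<forall>\<^sub>F w in nhds z. inv_el (x - cscale w 1)" by (rule eventually_inv_el[OF _ i])
    then show "\<exists>T. open T \<and> z \<in> T \<and> T \<subseteq> - cspectrum x"
      by (auto simp: eventually_nhds cspectrum_iff)
  qed
  then show ?thesis by (simp only: closed_def)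
qed

lemma compact_cspectrum: "compact (cspectrum (x::'a::cbanach_algebra))"
proof -
  have "bounded (cspectrum x)"
    unfolding bounded_iff by (rule exI[of _ "norm x"]) (auto intro: norm_cspectrum_le)
  then show ?thesis using closed_cspectrum compact_eq_bounded_closed by blast
qed

lemma spectral_radius_attained:
  obtains z where "z \<in> cspectrum (x::'a::cbanach_algebra)" "cmod z = spectral_radius x"
proof -
  have "continuous_on (cspectrum x) cmod" by (intro continuous_intros)
  then obtain z where z: "z \<in> cspectrum x" "\<And>w. w \<in> cspectrum x \<Longrightarrow> cmod w \<le> cmod z"
    using continuous_attains_sup[OF compact_cspectrum cspectrum_nonempty, of x cmod] by blast
  have "spectral_radius x \<le> cmod z" using z by (intro spectral_radius_leI)
  then show ?thesis using that[of z] z cmod_le_spectral_radius[of z x] by simp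
qed

lemma cspectrum_shift: "z \<in> cspectrum (x + cscale c 1) \<longleftrightarrow> z - c \<in> cspectrum (x::'a::cbanach_algebra)"
  by (simp add: cspectrum_iff cscale_diff_left algebra_simps)

lemma spectral_radius_shift_le: "spectral_radius (x + cscale c 1) \<le> spectral_radius (x::'a::cbanach_algebra) + cmod c"
proof (rule spectral_radius_leI)
  fix z assume "z \<in> cspectrum (x + cscale c 1)"
  then have "cmod (z - c) \<le> spectral_radius x" by (simp add: cspectrum_shift cmod_le_spectral_radius)
  then show "cmod z \<le> spectral_radius x + cmod c" using norm_triangle_ineq[of "z - c" c] by simp
qed

lemma complex_extreme_sum:
  fixes a b :: complex assumes "cmod a \<le> \<rho>" "cmod b \<le> \<rho>" "cmod (a + b) = 2 * \<rho>" shows "a = b"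
proof -
  have p: "(cmod (a - b))\<^sup>2 = 2 * (cmod a)\<^sup>2 + 2 * (cmod b)\<^sup>2 - (cmod (a + b))\<^sup>2"
    unfolding cmod_power2 by (simp add: power2_eq_square algebra_simps)
  have "(cmod a)\<^sup>2 \<le> \<rho>\<^sup>2" "(cmod b)\<^sup>2 \<le> \<rho>\<^sup>2" using assms by (auto intro: power_mono)
  then have "(cmod (a - b))\<^sup>2 \<le> 0" unfolding p assms(3) by (simp add: power_mult_distrib)
  then show ?thesis by simp
qed

text \<open>Shifting by \<open>z\<close> doubles the peripheral point: the radius of
  \<open>u + z\<close> is \<open>2 * \<rho>\<close>, and by Liouville it stays so along the line. A
  spectral point attaining it is the sum of \<open>z\<close> and a spectral value of modulus at most
  \<open>\<rho>\<close>, and strict convexity of the disc makes that value equal to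
  \<open>z\<close>.\<close>

lemma peripheral_spectrum_constant:
  fixes u v :: "'a::cbanach_algebra"
  assumes K: "\<And>t. spectral_radius (u + cscale t v) \<le> K"
    and z: "z \<in> cspectrum u" "cmod z = spectral_radius u"
  shows "z \<in> cspectrum (u + cscale t v)"
proof -
  define \<rho> where "\<rho> = spectral_radius u"
  have e: "(u + cscale z 1) + cscale t v = (u + cscale t v) + cscale z 1" for t by simp
  have "spectral_radius ((u + cscale z 1) + cscale t v) \<le> K + cmod z" for t
    unfolding e using spectral_radius_shift_le[of "u + cscale t v" z] K[of t] by linarith
  then have "spectral_radius ((u + cscale t v) + cscale z 1) = spectral_radius (u + cscale z 1)"
    using spectral_Liouville(1) e by metis
  moreover have "2 * z \<in> cspectrum (u + cscale z 1)" using z by (simp add: cspectrum_shift)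
  then have "2 * \<rho> \<le> spectral_radius (u + cscale z 1)"
    using cmod_le_spectral_radius z by (fastforce simp: norm_mult \<rho>_def)
  moreover have "spectral_radius (u + cscale z 1) \<le> 2 * \<rho>"
    using spectral_radius_shift_le[of u z] z by (simp add: \<rho>_def)
  ultimately have r: "spectral_radius ((u + cscale t v) + cscale z 1) = 2 * \<rho>" by linarith
  obtain w where w: "w \<in> cspectrum ((u + cscale t v) + cscale z 1)" "cmod w = 2 * \<rho>"
    using spectral_radius_attained r by metis
  have w': "w - z \<in> cspectrum (u + cscale t v)" using w by (simp add: cspectrum_shift)
  have "cmod (w - z) \<le> spectral_radius (u + cscale t v)" using w' by (rule cmod_le_spectral_radius)
  also have "\<dots> = \<rho>" unfolding \<rho>_def by (rule spectral_Liouville(1)[OF K])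
  finally have "w - z = z" using w z by (intro complex_extreme_sum[of _ \<rho>]) (auto simp: \<rho>_def)
  then show ?thesis using w' by simp
qed

subsection \<open>Square-zero elements under spectrally bounded maps\<close>

lemma spectral_radius_le_sqrt: "spectral_radius (x::'a::cbanach_algebra) \<le> sqrt (norm (x * x))"
  using spectral_radius_power_le[of x 2 "sqrt (norm (x * x))"] by (simp add: power2_eq_square)

lemma inv_el_one_sub_qn: "spectral_radius (b::'a::cbanach_algebra) = 0 \<Longrightarrow> inv_el (1 - cscale w b)"
  by (cases "w = 0") (auto simp: inv_el_one_sub_iff norm_inverse intro!: inv_el_beyond)

text \<open>A commutator \<open>[x, s]\<close> multiplied by the inverse of \<open>1 + \<mu> x\<close> is a difference of two conjugates of \<open>s\<close>.\<close>

lemma radical_criterion: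
  fixes s :: "'a::cbanach_algebra"
  assumes ss: "semisimple TYPE('a)" and s: "\<And>y t. spectral_radius (y + cscale t s) \<le> norm y"
  shows "s = 0"
proof (rule semisimpleD[OF ss], rule ccontr)
  fix L assume L: "maximal_left_ideal L" "s \<notin> L"
  note Ld = left_idealD[OF maximal_left_idealD(1)[OF L(1)]]
  have rs: "spectral_radius s = 0" using spectral_Liouville(2)[of y s "norm y" for y] s by blast
  have eq: "spectral_radius (y + cscale t s) = spectral_radius y" for y t
    by (rule spectral_Liouville(1)[where K = "norm y"]) (rule s)
  obtain x where x: "x \<in> L" "x * s - 1 \<in> L" using maximal_left_ideal_qn_density[OF L(1) rs L(2)] .
  define \<mu> :: complex where "\<mu> = of_real (1 / (norm x + 1))"
  have p: "norm x + 1 > 0" using norm_ge_zero[of x] by linarith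
  have "\<mu> \<noteq> 0" unfolding \<mu>_def of_real_eq_0_iff using p by simp
  moreover have "cmod \<mu> = 1 / (norm x + 1)" unfolding \<mu>_def norm_of_real using p by simp
  then have "norm (cscale \<mu> x) < 1" using p by (simp add: norm_cscale divide_less_eq)
  ultimately have m: "\<mu> \<noteq> 0" "norm (cscale \<mu> x) < 1" by auto
  define u where "u = 1 - (- cscale \<mu> x)"
  have iu: "inv_el u" unfolding u_def using m by (intro neumann) auto
  \<comment> \<open>Since \<open>x\<close> lies in \<open>L\<close> and \<open>x * s\<close> is
    \<open>1\<close> modulo \<open>L\<close>, this element is \<open>1\<close> modulo
    \<open>L\<close>. Thus \<open>1\<close> lies in its spectrum, although its spectral radius will
    turn out to be zero.\<close>
  define e where "e = (x * s - s * x) * alg_inv u"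
  have "u * s - s * u = cscale \<mu> (x * s - s * x)"
    by (simp add: u_def algebra_simps cscale_mult_left cscale_mult_right cscale_diff_right)
  then have "cscale \<mu> e = (u * s - s * u) * alg_inv u" by (simp add: e_def cscale_mult_left)
  also have "\<dots> = u * s * alg_inv u + cscale (-1) s"
    using alg_inv_cancel(3)[OF iu] by (simp add: left_diff_distrib)
  finally have "spectral_radius (cscale \<mu> e) = spectral_radius (u * s * alg_inv u)" by (simp only: eq)
  then have "spectral_radius e = 0" using m rs by (simp add: spectral_radius_conj[OF iu] spectral_radius_cscale)
  moreover have "e * u = x * s - s * x" using alg_inv_cancel(4)[OF iu] by (simp add: e_def)
  then have "e - 1 = (x * s - 1) - s * x - cscale \<mu> (e * x)" by (simp add: u_def algebra_simps cscale_mult_right)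
  then have "e - 1 \<in> L" using Ld(6)[OF Ld(6)[OF x(2) Ld(4)[OF x(1)]] Ld(3)[OF Ld(4)[OF x(1)]]] by (simp only:)
  ultimately show False using spectral_radius_ge_one[OF L(1)] by force
qed

text \<open>The line \<open>t \<mapsto> [x,b] + t b\<close> has constant spectral radius for every \<open>x\<close>; applied to \<open>x (1 - w b)\<close>, this
  bounds the spectral radius of \<open>[x,b] - w [x,b] b\<close> independently of \<open>w\<close>.\<close>

lemma commutator_mult_qn:
  fixes b :: "'a::cbanach_algebra"
  assumes rb: "spectral_radius b = 0"
    and bdd: "\<And>x. \<exists>K. \<forall>t. spectral_radius ((x * b - b * x) + cscale t b) \<le> K"
  shows "spectral_radius ((x * b - b * x) * b) = 0"
proof -
  define c where "c = x * b - b * x"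
  have le: "spectral_radius (c * (1 - cscale w b)) \<le> spectral_radius c" for w
  proof (rule ccontr)
    define c' where "c' = c * (1 - cscale w b)"
    define x' where "x' = x * (1 - cscale w b)"
    have c': "c' = x' * b - b * x'"
      by (simp add: c'_def x'_def c_def algebra_simps cscale_mult_left cscale_mult_right cscale_diff_right)
    assume "\<not> spectral_radius (c * (1 - cscale w b)) \<le> spectral_radius c"
    then have lt: "spectral_radius c < spectral_radius c'" by (simp add: c'_def)
    obtain z where z: "z \<in> cspectrum c'" "cmod z = spectral_radius c'" using spectral_radius_attained .
    obtain K where K: "\<And>t. spectral_radius (c' + cscale t b) \<le> K" using bdd[of x'] c' by auto
    \<comment> \<open>The coefficient \<open>z * w\<close> is the one for which
      \<open>c' + z w b - z\<close> factors as \<open>(c - z) (1 - w b)\<close>; both factors are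
      invertible because \<open>z\<close> lies outside the spectral disc of \<open>c\<close> and
      \<open>b\<close> is quasinilpotent.\<close>
    have "z \<in> cspectrum (c' + cscale (z * w) b)" by (rule peripheral_spectrum_constant[OF K z])
    moreover have "inv_el ((c - cscale z 1) * (1 - cscale w b))"
      using lt z by (intro inv_el_mult inv_el_beyond inv_el_one_sub_qn rb) auto
    moreover have "(c - cscale z 1) * (1 - cscale w b) = (c' + cscale (z * w) b) - cscale z 1"
      by (simp add: c'_def algebra_simps cscale_mult_left cscale_mult_right cscale_cscale cscale_diff_right)
    ultimately show False by (simp add: cspectrum_iff)
  qed
  have e: "c + cscale t (c * b) = c * (1 - cscale (- t) b)" for t
    by (simp add: algebra_simps cscale_mult_right)
  then have e: "c + cscale t (c * b) = c * (1 - cscale (- t) b)" for t .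
  have "spectral_radius (c * b) = 0"
    by (rule spectral_Liouville(2)[of c _ "spectral_radius c"]) (unfold e, rule le)
  then show ?thesis by (simp add: c_def)
qed

text \<open>If \<open>b * b \<notin> L\<close>, density at the vector \<open>b + L\<close> gives an
  \<open>x\<close> that kills \<open>b + L\<close> and sends \<open>b * b + L\<close> to
  \<open>b + L\<close>. With \<open>y * b\<close> equal to \<open>1\<close> modulo \<open>L\<close>,
  the product of the commutator of \<open>y * x\<close> and \<open>b\<close> with \<open>b\<close>
  is then \<open>1\<close> modulo \<open>L\<close>, against its zero spectral radius.\<close>

lemma square_zero_of_commutators:
  fixes b :: "'a::cbanach_algebra"
  assumes ss: "semisimple TYPE('a)" and rb: "spectral_radius b = 0"
    and q: "\<And>x. spectral_radius ((x * b - b * x) * b) = 0"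
  shows "b * b = 0"
proof (rule semisimpleD[OF ss], rule ccontr)
  fix L assume L: "maximal_left_ideal L" "b * b \<notin> L"
  note Ld = left_idealD[OF maximal_left_idealD(1)[OF L(1)]]
  have "b \<notin> L" using L Ld by blast
  then have L1: "maximal_left_ideal {x. x * b \<in> L}" by (rule maximal_left_ideal_transporter[OF L(1)])
  have b1: "b \<notin> {x. x * b \<in> L}" using L by simp
  obtain x where "x \<in> {x. x * b \<in> L}" "x * b - 1 \<in> {x. x * b \<in> L}"
    using maximal_left_ideal_qn_density[OF L1 rb b1] .
  then have x: "x * b \<in> L" "(x * b - 1) * b \<in> L" by auto
  obtain y where y: "y * b - 1 \<in> L" using maximal_left_ideal_solve[OF L(1) \<open>b \<notin> L\<close>] .
  define e where "e = (y * x * b - b * (y * x)) * b"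
  have "e - 1 = y * ((x * b - 1) * b) + (y * b - 1) - (b * y) * (x * b)"
    by (simp add: e_def algebra_simps)
  then have "e - 1 \<in> L" using Ld(6)[OF Ld(2)[OF Ld(4)[OF x(2)] y] Ld(4)[OF x(1)]] by (simp only:)
  then show False using spectral_radius_ge_one[OF L(1)] q[of "y * x"] by (force simp: e_def)
qed

section \<open>Closed graph and bounded lifting for spectrally bounded surjections\<close>

lemma c_linearD:
  assumes "c_linear T"
  shows "T (x + y) = T x + T y" "T (cscale c x) = cscale c (T x)" "T 0 = 0" "T (- x) = - T x" "T (x - y) = T x - T y"
    "T (r *\<^sub>R x) = r *\<^sub>R T x"
proof -
  show 1: "T (x + y) = T x + T y" "T (cscale c x) = cscale c (T x)" for x y c using assms by (auto simp: c_linear_def)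
  show "T 0 = 0" using 1(2)[of 0 0] by simp
  show 2: "T (- x) = - T x" for x using 1(2)[of "-1" x] by simp
  show "T (x - y) = T x - T y" using 1(1)[of x "-y"] 2 by simp
  show "T (r *\<^sub>R x) = r *\<^sub>R T x" by (simp add: scaleR_eq_cscale 1)
qed

locale spectrally_bounded_onto =
  fixes T :: "'a::cbanach_algebra \<Rightarrow> 'b::cbanach_algebra" and M :: real
  assumes semisimple: "semisimple TYPE('b)" and lin: "c_linear T" and surj: "surj T" and M: "M \<ge> 0"
    and bounded: "spectral_radius (T x) \<le> M * spectral_radius x"
begin

text \<open>The line \<open>u + cscale \<mu> v\<close> with \<open>u = T (z + w - X n)\<close> and
  \<open>v = T (X n)\<close> passes through \<open>T z + s\<close> at \<open>\<mu> = 1\<close>. On a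
  small circle it is close to \<open>T z\<close> in norm; on a large circle spectral boundedness
  applies to an argument kept bounded by the smallness of \<open>X n\<close>. The three circles
  estimate compares the two.\<close>

lemma separating_bound:
  assumes X: "X \<longlonglongrightarrow> 0" and s: "(\<lambda>n. T (X n)) \<longlonglongrightarrow> s"
  shows "spectral_radius (T z + s) \<le> norm (T z)"
proof (rule dense_ge)
  fix K0 assume "norm (T z) < K0"
  define \<delta> where "\<delta> = K0 - norm (T z)"
  have \<delta>: "\<delta> > 0" using \<open>norm (T z) < K0\<close> by (simp add: \<delta>_def)
  have K0: "K0 > 0" using \<open>norm (T z) < K0\<close> norm_ge_zero[of "T z"] by linarith
  obtain w where w: "T w = s" using surj by (metis surjD)
  define K1 where "K1 = M * (norm z + norm w + 1) + 1"
  have K1: "K1 > 0" using M by (simp add: K1_def add_nonneg_pos)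
  define \<epsilon> where "\<epsilon> = min (1/2) (\<delta> / (2 * (norm s + 1)))"
  have \<epsilon>: "0 < \<epsilon>" "\<epsilon> < 1" using \<delta> by (auto simp: \<epsilon>_def add_nonneg_pos)
  have "\<epsilon> * (norm s + 1) \<le> \<delta> / (2 * (norm s + 1)) * (norm s + 1)"
    by (intro mult_right_mono) (auto simp: \<epsilon>_def)
  also have "\<dots> = \<delta> / 2"
  proof -
    have H: "d / (2 * p) * p = d / 2" if "p > 0" for d p :: real using that by simp
    show ?thesis by (rule H) (use norm_ge_zero[of s] in linarith)
  qed
  finally have \<epsilon>s: "\<epsilon> * (norm s + 1) \<le> \<delta> / 2" .
  show "spectral_radius (T z + s) \<le> K0"
  proof (rule three_circles_limit[OF \<epsilon>(1) K0 K1])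
    fix R :: real assume R: "R > 1"
    \<comment> \<open>The index \<open>n\<close> is chosen after \<open>R\<close>, so that on the
      circle of radius \<open>R\<close> the argument of \<open>T\<close> stays within distance one
      of \<open>z + w\<close>.\<close>
    have "(\<lambda>n. norm (X n)) \<longlonglongrightarrow> 0" using X by (rule tendsto_norm_zero)
    then have "\<forall>\<^sub>F n in sequentially. norm (X n) < 1 / (1 + R)" using R by (intro order_tendstoD) auto
    moreover have "(\<lambda>n. norm (s - T (X n))) \<longlonglongrightarrow> norm (s - s)" by (intro tendsto_intros s)
    then have "\<forall>\<^sub>F n in sequentially. norm (s - T (X n)) < min (\<delta>/2) 1" using \<delta> by (intro order_tendstoD) auto
    ultimately have "\<forall>\<^sub>F n in sequentially. norm (X n) < 1 / (1 + R) \<and> norm (s - T (X n)) < min (\<delta>/2) 1"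
      by eventually_elim auto
    then obtain n where n: "norm (X n) < 1 / (1 + R)" "norm (s - T (X n)) < \<delta>/2" "norm (s - T (X n)) < 1"
      by (auto simp: eventually_sequentially)
    define u v where "u = T (z + w - X n)" and "v = T (X n)"
    have uv: "u + v = T z + s" by (simp add: u_def v_def c_linearD[OF lin] w)
    have nv: "norm v < norm s + 1"
      using n norm_triangle_ineq4[of s "s - v"] by (simp add: v_def)
    have "spectral_radius (u + v) \<le> K0 powr (1 - ln (1 / \<epsilon>) / ln (R / \<epsilon>)) * K1 powr (ln (1 / \<epsilon>) / ln (R / \<epsilon>))"
    proof (rule spectral_three_circles[OF \<epsilon> R])
      fix \<mu> :: complex assume \<mu>: "cmod \<mu> = \<epsilon>"
      have "u + cscale \<mu> v = T z + ((s - T (X n)) + cscale \<mu> v)" by (simp add: u_def c_linearD[OF lin] w)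
      then have "spectral_radius (u + cscale \<mu> v) \<le> norm (T z + ((s - T (X n)) + cscale \<mu> v))"
        by (simp only: spectral_radius_le_norm)
      also have "\<dots> \<le> norm (T z) + (norm (s - T (X n)) + norm (cscale \<mu> v))"
        using norm_triangle_ineq[of "T z" "(s - T (X n)) + cscale \<mu> v"] norm_triangle_ineq[of "s - T (X n)" "cscale \<mu> v"]
        by linarith
      also have "\<dots> \<le> norm (T z) + (norm (s - T (X n)) + \<epsilon> * (norm s + 1))"
        using nv \<epsilon> by (auto simp: norm_cscale \<mu> intro!: mult_left_mono)
      also have "\<dots> < norm (T z) + (\<delta> / 2 + \<delta> / 2)" by (intro add_strict_left_mono add_less_le_mono n \<epsilon>s)
      also have "\<dots> = K0" by (simp add: \<delta>_def)
      finally show "spectral_radius (u + cscale \<mu> v) < K0" .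
    next
      fix \<mu> :: complex assume \<mu>: "cmod \<mu> = R"
      have "u + cscale \<mu> v = T (z + w + (cscale \<mu> (X n) - X n))" by (simp add: u_def v_def c_linearD[OF lin])
      then have "spectral_radius (u + cscale \<mu> v) \<le> M * spectral_radius (z + w + (cscale \<mu> (X n) - X n))"
        by (simp only: bounded)
      also have "\<dots> \<le> M * (norm z + norm w + 1)"
      proof (intro mult_left_mono M)
        have "norm (cscale \<mu> (X n) - X n) \<le> R * norm (X n) + norm (X n)"
          using norm_triangle_ineq4[of "cscale \<mu> (X n)" "X n"] by (simp add: norm_cscale \<mu>)
        also have "\<dots> \<le> 1" using n(1) R by (simp add: field_simps)
        finally have "norm (cscale \<mu> (X n) - X n) \<le> 1" .
        moreover have "norm (z + w + (cscale \<mu> (X n) - X n)) \<le> norm z + norm w + norm (cscale \<mu> (X n) - X n)"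
          using norm_triangle_ineq[of "z + w" "cscale \<mu> (X n) - X n"] norm_triangle_ineq[of z w] by linarith
        ultimately show "spectral_radius (z + w + (cscale \<mu> (X n) - X n)) \<le> norm z + norm w + 1"
          using spectral_radius_le_norm[of "z + w + (cscale \<mu> (X n) - X n)"] by linarith
      qed
      also have "\<dots> < K1" by (simp add: K1_def)
      finally show "spectral_radius (u + cscale \<mu> v) < K1" .
    qed simp
    then show "spectral_radius (T z + s) \<le> K0 powr (1 - ln (1 / \<epsilon>) / ln (R / \<epsilon>)) * K1 powr (ln (1 / \<epsilon>) / ln (R / \<epsilon>))"
      by (simp add: uv)
  qed
qed

text \<open>The defect of a limit point of the graph is a limit of \<open>T (X n)\<close> along a
  null sequence \<open>X\<close>; rescaling \<open>X\<close> by \<open>t\<close> gives the bound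
  along the whole line that \<open>radical_criterion\<close> asks for.\<close>

lemma closed_graph: "closed {(x, T x) | x. True}"
proof (unfold closed_sequential_limits, intro allI impI, elim conjE)
  fix f :: "nat \<Rightarrow> 'a \<times> 'b" and l
  assume f: "\<forall>n. f n \<in> {(x, T x) | x. True}" and fl: "f \<longlonglongrightarrow> l"
  define X where "X n = fst (f n) - fst l" for n
  have f': "snd (f n) = T (fst (f n))" for n
  proof -
    have "f n \<in> {(x, T x) | x. True}" using f by blast
    then show ?thesis by auto
  qed
  have X: "X \<longlonglongrightarrow> 0" unfolding X_def using tendsto_fst[OF fl] by (simp add: LIM_zero)
  have "(\<lambda>n. snd (f n) - T (fst l)) \<longlonglongrightarrow> snd l - T (fst l)" by (intro tendsto_intros tendsto_snd fl)
  moreover have "snd (f n) - T (fst l) = T (X n)" for n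
    by (simp add: X_def c_linearD[OF lin] f')
  ultimately have s: "(\<lambda>n. T (X n)) \<longlonglongrightarrow> snd l - T (fst l)" by simp
  have "snd l - T (fst l) = 0"
  proof (rule radical_criterion[OF semisimple])
    fix y t
    obtain z where z: "T z = y" using surj by (metis surjD)
    have "(\<lambda>n. cscale t (X n)) \<longlonglongrightarrow> cscale t 0" by (intro tendsto_intros X)
    moreover have "(\<lambda>n. T (cscale t (X n))) \<longlonglongrightarrow> cscale t (snd l - T (fst l))"
      unfolding c_linearD(2)[OF lin] by (intro tendsto_cscale tendsto_const s)
    ultimately show "spectral_radius (y + cscale t (snd l - T (fst l))) \<le> norm y"
      using separating_bound[of "\<lambda>n. cscale t (X n)" _ z] z by simp
  qed
  then have "l = (fst l, T (fst l))" by (simp add: prod_eq_iff)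
  then show "l \<in> {(x, T x) | x. True}" by blast
qed

lemma bounded_lift: obtains K where "K > 0" "\<And>y. \<exists>x. T x = y \<and> norm x \<le> K * norm y"
proof -
  define G where "G = {(x, T x) | x. True}"
  have G: "(x, y) \<in> G \<longleftrightarrow> y = T x" for x y by (auto simp: G_def)
  have "subspace G"
    unfolding subspace_def by (auto simp: G zero_prod_def c_linearD[OF lin])
  moreover have "closed G" unfolding G_def by (rule closed_graph)
  moreover have "\<exists>x. (x, y) \<in> G" for y using surj by (auto simp: G surj_def)
  ultimately obtain K where K: "K > 0" "\<And>y. \<exists>x. (x, y) \<in> G \<and> norm x \<le> K * norm y"
    using open_mapping_closed_relation by blast
  have "\<exists>x. T x = y \<and> norm x \<le> K * norm y" for y using K(2)[of y] by (auto simp: G)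
  with K(1) show ?thesis by (rule that)
qed

theorem square_zero:
  assumes a: "a * a = 0" shows "T a * T a = 0"
proof -
  define b where "b = T a"
  have "spectral_radius a \<le> 0" using spectral_radius_le_sqrt[of a] a by simp
  then have ra: "spectral_radius a = 0" by (simp add: antisym)
  have rb: "spectral_radius b = 0"
    using bounded[of a] spectral_radius_nonneg[of b] by (simp add: ra b_def del: spectral_radius_nonneg)
  obtain K where K: "K > 0" "\<And>y. \<exists>x. T x = y \<and> norm x \<le> K * norm y"
    using bounded_lift by blast
  have bdd: "\<exists>C. \<forall>t. spectral_radius ((x * b - b * x) + cscale t b) \<le> C" for x
  proof -
    define c where "c = x * b - b * x"
    \<comment> \<open>Beyond \<open>t0\<close> the element \<open>u = 1 + x/t\<close> has an inverse
      of norm at most \<open>2\<close>. Then \<open>Y\<close> bounds a preimage of the correction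
      term \<open>y\<close>, and \<open>C\<close> bounds the spectral radius through the square of
      \<open>t a + z/t\<close>.\<close>
    define t0 where "t0 = 2 * norm x + 1"
    define Y where "Y = K * (2 * norm c * norm x)"
    define C where "C = M * sqrt (2 * norm a * Y + Y * Y)"
    have Y0: "Y \<ge> 0" using K by (simp add: Y_def)
    have "spectral_radius (c + cscale t b) \<le> max (norm c + t0 * norm b) C" for t
    proof (cases "cmod t \<le> t0")
      case True
      have "spectral_radius (c + cscale t b) \<le> norm c + norm (cscale t b)"
        using spectral_radius_le_norm[of "c + cscale t b"] norm_triangle_ineq[of c "cscale t b"] by linarith
      also have "\<dots> \<le> norm c + t0 * norm b" using True by (auto simp: norm_cscale intro: mult_right_mono)
      finally show ?thesis by simp
    next
      case False
      then have t: "cmod t > 2 * norm x + 1" by (simp add: t0_def)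
      have "cmod t \<ge> 1" using t norm_ge_zero[of x] by linarith
      then have t1: "cmod t \<ge> 1" "t \<noteq> 0" by auto
      define s where "s = inverse t"
      have s: "cmod s \<le> 1" using t1 by (simp add: s_def norm_inverse inverse_le_1_iff)
      have "norm (- cscale s x) \<le> 1/2" using t t1 by (simp add: norm_cscale s_def norm_inverse norm_divide field_simps)
      define u where "u = 1 - (- cscale s x)"
      have iu: "inv_el u" unfolding u_def using \<open>norm (- cscale s x) \<le> 1/2\<close> by (intro neumann(1)) linarith
      have "norm (alg_inv u) \<le> 1 / (1 - norm (- cscale s x))"
        unfolding u_def using \<open>norm (- cscale s x) \<le> 1/2\<close> by (intro neumann(2)) linarith
      also have "\<dots> \<le> 1 / (1/2)" using \<open>norm (- cscale s x) \<le> 1/2\<close> by (intro divide_left_mono) auto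
      finally have nu: "norm (alg_inv u) \<le> 2" by simp
      define y where "y = alg_inv u * c * x"
      obtain z where z: "T z = y" "norm z \<le> K * norm y" using K by blast
      have "norm y \<le> norm (alg_inv u * c) * norm x" unfolding y_def by (rule norm_mult_ineq)
      also have "\<dots> \<le> norm (alg_inv u) * norm c * norm x" by (intro mult_right_mono norm_mult_ineq) auto
      also have "\<dots> \<le> 2 * norm c * norm x" using nu by (intro mult_right_mono) auto
      finally have "K * norm y \<le> Y" unfolding Y_def using K by (intro mult_left_mono) auto
      then have "norm z \<le> Y" using z by linarith
      have ut: "u * cscale t b = cscale t b * u + c"
        using t1 by (simp add: u_def c_def s_def algebra_simps cscale_mult_left cscale_mult_right cscale_cscale cscale_add_right cscale_diff_right)
      \<comment> \<open>Conjugation by \<open>u\<close> moves the commutator into a term of order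
        \<open>1/t\<close>, which \<open>bounded_lift\<close> pulls back to the domain with a bound
        independent of \<open>t\<close>.\<close>
      have "(c + cscale t b) * u = u * (cscale t b + cscale s y)"
      proof -
        have "u * (cscale t b + cscale s y) = u * cscale t b + cscale s (u * (alg_inv u * (c * x)))"
          by (simp add: y_def distrib_left cscale_mult_right mult.assoc)
        also have "\<dots> = cscale t b * u + c + cscale s (c * x)"
          by (simp only: ut alg_inv_cancel(1)[OF iu])
        also have "\<dots> = (c + cscale t b) * u"
          by (simp add: u_def algebra_simps cscale_mult_left cscale_mult_right cscale_cscale cscale_add_right)
        finally show ?thesis by simp
      qed
      then have "c + cscale t b = u * (cscale t b + cscale s y) * alg_inv u"
        using alg_inv_cancel(3)[OF iu] by metis
      then have "spectral_radius (c + cscale t b) = spectral_radius (cscale t b + cscale s y)"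
        by (simp add: spectral_radius_conj[OF iu])
      also have "cscale t b + cscale s y = T (cscale t a + cscale s z)"
        by (simp add: c_linearD[OF lin] b_def z)
      also have "spectral_radius \<dots> \<le> M * spectral_radius (cscale t a + cscale s z)" by (rule bounded)
      also have "\<dots> \<le> C" unfolding C_def
      proof (intro mult_left_mono M order_trans[OF spectral_radius_le_sqrt] real_sqrt_le_mono)
        have "(cscale t a + cscale s z) * (cscale t a + cscale s z) = a * z + z * a + cscale (s * s) (z * z)"
          using t1 a by (simp add: s_def algebra_simps cscale_mult_left cscale_mult_right cscale_cscale cscale_add_right)
        also have "norm \<dots> \<le> norm (a * z) + norm (z * a) + norm (cscale (s * s) (z * z))"
          using norm_triangle_ineq[of "a * z + z * a" "cscale (s * s) (z * z)"] norm_triangle_ineq[of "a * z" "z * a"]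
          by linarith
        also have "\<dots> \<le> norm a * Y + Y * norm a + 1 * (Y * Y)"
        proof (intro add_mono)
          show "norm (a * z) \<le> norm a * Y" "norm (z * a) \<le> Y * norm a"
            using \<open>norm z \<le> Y\<close> by (auto intro!: order_trans[OF norm_mult_ineq] mult_left_mono mult_right_mono)
          have "norm (z * z) \<le> Y * Y"
            using \<open>norm z \<le> Y\<close> Y0 by (intro order_trans[OF norm_mult_ineq] mult_mono) auto
          moreover have "cmod (s * s) \<le> 1" using s by (simp add: norm_mult mult_le_one)
          ultimately show "norm (cscale (s * s) (z * z)) \<le> 1 * (Y * Y)"
            unfolding norm_cscale by (intro mult_mono) auto
        qed
        finally show "norm ((cscale t a + cscale s z) * (cscale t a + cscale s z)) \<le> 2 * norm a * Y + Y * Y"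
          by (simp add: mult_ac)
      qed
      finally show ?thesis by simp
    qed
    then show ?thesis by (auto simp: c_def)
  qed
  have "b * b = 0"
    by (rule square_zero_of_commutators[OF semisimple rb commutator_mult_qn[OF rb bdd]])
  then show ?thesis by (simp add: b_def)
qed

end

subsection \<open>Off-diagonal elements\<close>

text \<open>\<open>p\<close> may be any idempotent, not only a self-adjoint one: this makes the
  notion invariant under similarity, as the skew idempotents \<open>e + v\<close> below
  require.\<close>

definition off_diagonal :: "'a::cbanach_algebra \<Rightarrow> bool" where
  "off_diagonal n \<longleftrightarrow> (\<exists>p. p * p = p \<and> p * n = n \<and> n * p = 0)"

definition corner_off_diagonal :: "'a::cbanach_algebra \<Rightarrow> 'a \<Rightarrow> bool" where
  "corner_off_diagonal e n \<longleftrightarrow> e * n = n \<and> n * e = n \<and> off_diagonal n"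

definition corner_spanned :: "'a::cbanach_algebra \<Rightarrow> bool" where
  "corner_spanned e \<longleftrightarrow> (\<forall>x. e * x = x \<and> x * e = x \<longrightarrow> x \<in> span {n. corner_off_diagonal e n})"

lemma off_diagonal_square: "off_diagonal n \<Longrightarrow> n * n = 0"
  unfolding off_diagonal_def by (metis mult.assoc mult_zero_left)

lemma off_diagonal_conj:
  assumes u: "inv_el u" and n: "off_diagonal n" shows "off_diagonal (u * n * alg_inv u)"
proof -
  obtain p where p: "p * p = p" "p * n = n" "n * p = 0" using n by (auto simp: off_diagonal_def)
  have c: "(u * x * alg_inv u) * (u * y * alg_inv u) = u * (x * y) * alg_inv u" for x y
    using alg_inv_cancel(2)[OF u] by (simp add: mult.assoc)
  show ?thesis unfolding off_diagonal_def
    by (rule exI[of _ "u * p * alg_inv u"]) (simp add: c p)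
qed

lemma corner_spanned_conj:
  assumes u: "inv_el u" and e: "corner_spanned e" shows "corner_spanned (u * e * alg_inv u)"
  unfolding corner_spanned_def
proof (intro allI impI)
  have c: "(u * x * alg_inv u) * (u * y * alg_inv u) = u * (x * y) * alg_inv u" for x y
    using alg_inv_cancel(2)[OF u] by (simp add: mult.assoc)
  fix x assume x: "u * e * alg_inv u * x = x \<and> x * (u * e * alg_inv u) = x"
  define y where "y = alg_inv u * x * u"
  have xy: "x = u * y * alg_inv u"
    using alg_inv_cancel(1,3)[OF u] by (simp add: y_def mult.assoc)
  have "u * (e * y) * alg_inv u = u * y * alg_inv u" "u * (y * e) * alg_inv u = u * y * alg_inv u"
    using x unfolding xy c by auto
  then have "e * y = y" "y * e = y"
    by (metis (no_types, lifting) alg_inv_cancel(2,4)[OF u])+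
  then have "y \<in> span {n. corner_off_diagonal e n}" using e by (auto simp: corner_spanned_def)
  then show "x \<in> span {n. corner_off_diagonal (u * e * alg_inv u) n}" unfolding xy
  proof (induction rule: span_induct_alt)
    case (step r n y)
    have "corner_off_diagonal (u * e * alg_inv u) (u * n * alg_inv u)"
      using step(1) off_diagonal_conj[OF u] by (auto simp: corner_off_diagonal_def c)
    then have "r *\<^sub>R (u * n * alg_inv u) + u * y * alg_inv u \<in> span {n. corner_off_diagonal (u * e * alg_inv u) n}"
      using step(2) by (intro span_add span_scale) (auto intro: span_base)
    then show ?case by (simp add: distrib_left distrib_right)
  qed (simp add: span_zero)
qed

section \<open>The polarised identity and its Peirce blocks\<close>

locale square_zero_preserving =
  fixes T :: "'a::cbanach_algebra \<Rightarrow> 'b::cbanach_algebra"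
  assumes lin: "c_linear T" and square_zero: "a * a = 0 \<Longrightarrow> T a * T a = 0"
begin

definition \<phi> :: "'a \<Rightarrow> 'a \<Rightarrow> 'b" where "\<phi> x y = T x * T y + T y * T x"

text \<open>The defect of the identity to be proved: vanishing of \<open>\<Phi>\<close> is exactly
  the polarised relation between \<open>T x\<close>, \<open>T y\<close>, \<open>T 1\<close> and the
  Jordan product.\<close>

definition \<Phi> :: "'a \<Rightarrow> 'a \<Rightarrow> 'b" where "\<Phi> x y = \<phi> x y - (1/2) *\<^sub>R \<phi> (x * y + y * x) 1"

lemma phi_sym: "\<phi> x y = \<phi> y x" by (simp add: \<phi>_def add.commute)

lemma phi_linear:
  "\<phi> (x + x') y = \<phi> x y + \<phi> x' y" "\<phi> x (y + y') = \<phi> x y + \<phi> x y'"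
  "\<phi> (x - x') y = \<phi> x y - \<phi> x' y" "\<phi> x (y - y') = \<phi> x y - \<phi> x y'"
  "\<phi> (r *\<^sub>R x) y = r *\<^sub>R \<phi> x y" "\<phi> x (r *\<^sub>R y) = r *\<^sub>R \<phi> x y"
  "\<phi> 0 y = 0" "\<phi> x 0 = 0" "\<phi> (- x) y = - \<phi> x y" "\<phi> x (- y) = - \<phi> x y"
  by (simp_all add: \<phi>_def c_linearD[OF lin] algebra_simps)

lemma Phi_sym: "\<Phi> x y = \<Phi> y x" by (simp add: \<Phi>_def phi_sym add.commute)

lemma Phi_linear:
  "\<Phi> (x + x') y = \<Phi> x y + \<Phi> x' y" "\<Phi> x (y + y') = \<Phi> x y + \<Phi> x y'"
  "\<Phi> (x - x') y = \<Phi> x y - \<Phi> x' y" "\<Phi> x (y - y') = \<Phi> x y - \<Phi> x y'"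
  "\<Phi> (- x) y = - \<Phi> x y" "\<Phi> x (- y) = - \<Phi> x y"
  by (simp_all add: \<Phi>_def phi_linear algebra_simps)

lemma phi_eq_0:
  assumes "x * x = 0" "y * y = 0" "x * y + y * x = 0" shows "\<phi> x y = 0"
proof -
  have "(x + y) * (x + y) = 0" using assms by (simp add: algebra_simps)
  then have "(T x + T y) * (T x + T y) = 0" using square_zero[of "x + y"] by (simp add: c_linearD[OF lin])
  then show ?thesis using square_zero[OF assms(1)] square_zero[OF assms(2)] by (simp add: \<phi>_def algebra_simps)
qed

text \<open>Off-diagonal elements of orthogonal corners have zero products in both orders, so their
  sum has square zero; bilinearity carries the conclusion over to the spans.\<close>

lemma phi_orthogonal_corners:
  assumes ef: "e * f = 0" "f * e = 0" and S: "corner_spanned e" "corner_spanned f"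
    and x: "e * x = x" "x * e = x" and y: "f * y = y" "y * f = y"
  shows "\<phi> x y = 0"
proof -
  have 1: "\<phi> n m = 0" if "corner_off_diagonal e n" "corner_off_diagonal f m" for n m
  proof (rule phi_eq_0)
    show "n * n = 0" "m * m = 0" using that by (auto simp: corner_off_diagonal_def off_diagonal_square)
    have "n * m = (n * e) * (f * m)" "m * n = (m * f) * (e * n)" using that by (auto simp: corner_off_diagonal_def)
    moreover have "(n * e) * (f * m) = n * (e * f) * m" "(m * f) * (e * n) = m * (f * e) * n"
      by (simp_all only: mult.assoc)
    ultimately show "n * m + m * n = 0" by (simp add: ef)
  qed
  have 2: "\<phi> n y = 0" if "corner_off_diagonal e n" for n
  proof -
    have "y \<in> span {m. corner_off_diagonal f m}" using S y by (auto simp: corner_spanned_def)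
    then show ?thesis
      by (induction rule: span_induct_alt) (use 1 that in \<open>auto simp: phi_linear\<close>)
  qed
  have "x \<in> span {n. corner_off_diagonal e n}" using S x by (auto simp: corner_spanned_def)
  then show ?thesis
    by (induction rule: span_induct_alt) (use 2 in \<open>auto simp: phi_linear\<close>)
qed

end

text \<open>Below, membership in the Peirce corners of an idempotent \<open>e\<close> with complement \<open>f = 1 - e\<close> is expressed by
  \<open>e * x = x\<close> or \<open>e * x = 0\<close> (on the left), and \<open>x * e = x\<close> or \<open>x * e = 0\<close> (on the right).\<close>

lemma mult_prefix: "a * b = c \<Longrightarrow> a * (b * r) = c * (r::'a::semigroup_mult)"
  by (simp add: mult.assoc[symmetric])

lemma Peirce_zero:
  fixes e :: "'a::ring"
  shows "x * e = x \<Longrightarrow> e * y = 0 \<Longrightarrow> x * y = 0" "x * e = 0 \<Longrightarrow> e * y = y \<Longrightarrow> x * y = 0"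
  by (metis mult.assoc mult_zero_right, metis mult.assoc mult_zero_left)

lemma one_plus_square_zero:
  fixes v :: "'a::cbanach_algebra"
  assumes "v * v = 0" shows "inv_el (1 + v)" "alg_inv (1 + v) = 1 - v"
proof -
  have "(1 + v) * (1 - v) = 1" "(1 - v) * (1 + v) = 1" using assms by (simp_all add: algebra_simps)
  then show "inv_el (1 + v)" "alg_inv (1 + v) = 1 - v" by (auto intro: inv_elI alg_inv_eq)
qed

locale spanned_idempotent = square_zero_preserving T
  for T :: "'a::cbanach_algebra \<Rightarrow> 'b::cbanach_algebra" +
  fixes e :: 'a
  assumes idem: "e * e = e" and span_e: "corner_spanned e" and span_f: "corner_spanned (1 - e)"
begin

lemma complement: "spanned_idempotent T (1 - e)"
  by unfold_locales (use idem span_e span_f in \<open>simp_all add: algebra_simps\<close>)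

text \<open>Conjugating by \<open>1 + y\<close> with \<open>y * y = 0\<close> yields a second
  idempotent with the same properties; comparing the two produces relations between different Peirce
  blocks.\<close>

lemma conjugate: assumes u: "inv_el u" shows "spanned_idempotent T (u * e * alg_inv u)"
proof unfold_locales
  show "u * e * alg_inv u * (u * e * alg_inv u) = u * e * alg_inv u"
    using alg_inv_cancel(2)[OF u] idem by (simp add: mult.assoc) (simp add: mult.assoc[symmetric] idem)
  show "corner_spanned (u * e * alg_inv u)" by (rule corner_spanned_conj[OF u span_e])
  have "1 - u * e * alg_inv u = u * (1 - e) * alg_inv u" using alg_inv[OF u] by (simp add: algebra_simps)
  then show "corner_spanned (1 - u * e * alg_inv u)" using corner_spanned_conj[OF u span_f] by simp
qed

lemma phi_corners:
  assumes "e * x = x" "x * e = x" "e * y = 0" "y * e = 0" shows "\<phi> x y = 0"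
  by (rule phi_orthogonal_corners[OF _ _ span_e span_f]) (use idem assms in \<open>simp_all add: algebra_simps\<close>)

lemma Phi_corners:
  assumes "e * x = x" "x * e = x" "e * y = 0" "y * e = 0" shows "\<Phi> x y = 0"
  using phi_corners[OF assms] Peirce_zero[of x e y] Peirce_zero[of y e x] assms by (simp add: \<Phi>_def phi_linear)

lemma Phi_lower:
  assumes "e * x = 0" "x * e = x" "e * y = 0" "y * e = y" shows "\<Phi> x y = 0"
proof -
  have "x * y = 0" "y * x = 0" "x * x = 0" "y * y = 0" using assms Peirce_zero by blast+
  then show ?thesis by (simp add: \<Phi>_def phi_eq_0 phi_linear)
qed

text \<open>\<open>phi_corners\<close> for the idempotent \<open>e + y\<close> applies to the
  transported elements \<open>x + y * x\<close> and \<open>x' - x' * y\<close>. Replacing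
  \<open>y\<close> by \<open>- y\<close> isolates the terms that are linear in
  \<open>y\<close>.\<close>

lemma phi_exchange:
  assumes x: "e * x = x" "x * e = x" and x': "e * x' = 0" "x' * e = 0" and y: "e * y = 0" "y * e = y"
  shows "\<phi> (y * x) x' = \<phi> x (x' * y)"
proof -
  have *: "\<phi> (x + y * x) (x' - x' * y) = 0" if y: "e * y = 0" "y * e = y" for y
  proof -
    have yy: "y * y = 0" by (rule Peirce_zero(1)[OF y(2,1)])
    interpret c: spanned_idempotent T "(1 + y) * e * alg_inv (1 + y)"
      by (rule conjugate) (rule one_plus_square_zero(1)[OF yy])
    have z: "x * y = 0" "y * x' = 0" using Peirce_zero x y x' by blast+
    have "(1 + y) * e * alg_inv (1 + y) = e + y"
      using y yy by (simp add: one_plus_square_zero[OF yy] algebra_simps)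
    then show ?thesis
      using c.phi_corners[of "x + y * x" "x' - x' * y"] x y x' z yy
      by (simp add: algebra_simps) (simp add: mult.assoc[symmetric])
  qed
  define t where "t = \<phi> (y * x) x' - \<phi> x (x' * y)"
  have "\<phi> (x + y * x) (x' - x' * y) = 0" "\<phi> (x - y * x) (x' + x' * y) = 0"
    using *[of y] *[of "- y"] y by simp_all
  then have "\<phi> x x' + t - \<phi> (y * x) (x' * y) = 0" "\<phi> x x' - t - \<phi> (y * x) (x' * y) = 0"
    by (simp_all add: phi_linear t_def algebra_simps)
  moreover have "2 *\<^sub>R t = (a + t - b) - (a - t - b)" for a b by (simp add: scaleR_2)
  ultimately have "2 *\<^sub>R t = 0" by (metis diff_self)
  then show ?thesis by (simp add: t_def)
qed

lemma phi_lower_one: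
  assumes y: "e * y = 0" "y * e = y"
  shows "\<phi> y 1 = 2 *\<^sub>R \<phi> y (1 - e)" "\<phi> y 1 = 2 *\<^sub>R \<phi> e y"
proof -
  have "\<phi> (y * e) (1 - e) = \<phi> e ((1 - e) * y)" by (rule phi_exchange) (use idem y in \<open>simp_all add: algebra_simps\<close>)
  then have "\<phi> y (1 - e) = \<phi> e y" using y by (simp add: algebra_simps)
  then show "\<phi> y 1 = 2 *\<^sub>R \<phi> y (1 - e)" "\<phi> y 1 = 2 *\<^sub>R \<phi> e y"
    by (simp_all add: phi_linear phi_sym[of e] algebra_simps scaleR_2)
qed

lemma Phi_diag_lower:
  assumes x: "e * x = x" "x * e = x" and y: "e * y = 0" "y * e = y" shows "\<Phi> x y = 0"
proof -
  have xy: "x * y = 0" using Peirce_zero x y by blast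
  have yx: "e * (y * x) = 0" "y * x * e = y * x" using x y by (simp_all add: mult.assoc) (simp_all add: mult.assoc[symmetric])
  have "\<phi> (y * x) (1 - e) = \<phi> x ((1 - e) * y)" by (rule phi_exchange) (use idem x y in \<open>simp_all add: algebra_simps\<close>)
  then have "\<phi> x y = \<phi> (y * x) (1 - e)" using y by (simp add: algebra_simps)
  then show ?thesis using phi_lower_one(1)[OF yx] xy by (simp add: \<Phi>_def)
qed

lemma Phi_codiag_lower:
  assumes x: "e * x = 0" "x * e = 0" and y: "e * y = 0" "y * e = y" shows "\<Phi> x y = 0"
proof -
  have yx: "y * x = 0" using Peirce_zero x y by blast
  have xy: "e * (x * y) = 0" "x * y * e = x * y" using x y by (simp_all add: mult.assoc) (simp_all add: mult.assoc[symmetric])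
  have "\<phi> (y * e) x = \<phi> e (x * y)" by (rule phi_exchange) (use idem x y in \<open>simp_all add: algebra_simps\<close>)
  then have "\<phi> x y = \<phi> e (x * y)" using y by (simp add: phi_sym)
  then show ?thesis using phi_lower_one(2)[OF xy] yx by (simp add: \<Phi>_def)
qed

lemma Phi_diag_upper:
  assumes x: "e * x = x" "x * e = x" and y: "e * y = y" "y * e = 0" shows "\<Phi> x y = 0"
  by (rule spanned_idempotent.Phi_codiag_lower[OF complement]) (use assms in \<open>simp_all add: algebra_simps\<close>)

lemma Phi_codiag_upper:
  assumes x: "e * x = 0" "x * e = 0" and y: "e * y = y" "y * e = 0" shows "\<Phi> x y = 0"
  by (rule spanned_idempotent.Phi_diag_lower[OF complement]) (use assms in \<open>simp_all add: algebra_simps\<close>)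

lemma Phi_upper:
  assumes "e * x = x" "x * e = 0" "e * y = y" "y * e = 0" shows "\<Phi> x y = 0"
  by (rule spanned_idempotent.Phi_lower[OF complement]) (use assms in \<open>simp_all add: algebra_simps\<close>)

text \<open>The same skewing by \<open>1 + v\<close>, now applied to the established vanishing of
  \<open>\<Phi>\<close> on a diagonal and an upper element; all other blocks of the expansion are
  already known to vanish.\<close>

lemma Phi_exchange:
  assumes x: "e * x = x" "x * e = x" and g: "e * g = g" "g * e = 0" and v: "e * v = 0" "v * e = v"
  shows "\<Phi> x (g * v) = \<Phi> (v * x) g"
proof -
  have z: "x * v = 0" "g * g = 0" "g * x = 0" "v * v = 0" using Peirce_zero x g v by blast+
  note r = x[THEN mult_prefix] g[THEN mult_prefix] v[THEN mult_prefix] z[THEN mult_prefix]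
  interpret c: spanned_idempotent T "(1 + v) * e * alg_inv (1 + v)"
    by (rule conjugate) (rule one_plus_square_zero(1)[OF z(4)])
  have e': "(1 + v) * e * alg_inv (1 + v) = e + v"
    using v z by (simp add: one_plus_square_zero[OF z(4)] algebra_simps)
  have "\<Phi> (x + v * x) (g + v * g - g * v - v * (g * v)) = 0"
    by (rule c.Phi_diag_upper; unfold e') (simp_all add: algebra_simps r x g v z)
  moreover have "\<Phi> x g = 0" by (rule Phi_diag_upper) (use x g in auto)
  moreover have "\<Phi> x (v * g) = 0" by (rule Phi_corners) (simp_all add: mult.assoc r x g v)
  moreover have "\<Phi> x (v * (g * v)) = 0" by (rule Phi_diag_lower) (simp_all add: mult.assoc r x g v)
  moreover have "\<Phi> (v * g) (v * x) = 0" by (rule Phi_codiag_lower) (simp_all add: mult.assoc r x g v)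
  moreover have "\<Phi> (g * v) (v * x) = 0" by (rule Phi_diag_lower) (simp_all add: mult.assoc r x g v)
  moreover have "\<Phi> (v * x) (v * (g * v)) = 0" by (rule Phi_lower) (simp_all add: mult.assoc r x g v)
  ultimately show ?thesis
    by (simp add: Phi_linear Phi_sym[of "v * x" "v * g"] Phi_sym[of "v * x" "g * v"])
qed

text \<open>The exchange with \<open>x = e\<close> moves the pair into the block of
  \<open>e\<close>, where \<open>g * v\<close> and \<open>1 - e\<close> lie in orthogonal
  corners.\<close>

lemma Phi_upper_lower:
  assumes g: "e * g = g" "g * e = 0" and v: "e * v = 0" "v * e = v"
  shows "\<Phi> g v = 0"
proof -
  have "\<Phi> e (g * v) = \<Phi> (v * e) g" by (rule Phi_exchange) (use idem g v in auto)
  moreover have "\<Phi> e (g * v) = 0"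
  proof -
    have w: "e * (g * v) = g * v" "g * v * e = g * v"
      using g v by (simp_all add: mult.assoc mult_prefix[OF g(1)])
    have "\<phi> (g * v) (1 - e) = 0" by (rule phi_corners) (use w idem in \<open>simp_all add: algebra_simps\<close>)
    then show ?thesis using w by (simp add: \<Phi>_def phi_linear phi_sym[of e] scaleR_2[symmetric])
  qed
  ultimately show ?thesis using v by (simp add: Phi_sym)
qed

text \<open>The factorisation \<open>e = u * v\<close> through the complementary corner lets one
  write \<open>y = u * (v * y)\<close>, so that the exchange leads from the diagonal block to an
  upper and a lower element.\<close>

lemma Phi_diag:
  assumes uv: "e = u * v" "e * u = u" "u * e = 0" "e * v = 0" "v * e = v"
    and x: "e * x = x" "x * e = x" and y: "e * y = y" "y * e = y"
  shows "\<Phi> x y = 0"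
proof -
  have "\<Phi> x (u * (v * y)) = \<Phi> ((v * y) * x) u"
    by (rule Phi_exchange) (simp_all add: x y uv(2-5) mult.assoc mult_prefix[OF uv(4)])
  also have "\<dots> = \<Phi> u ((v * y) * x)" by (rule Phi_sym)
  also have "\<dots> = 0"
    by (rule Phi_upper_lower) (simp_all add: x y uv(2-5) mult.assoc mult_prefix[OF uv(4)])
  finally show ?thesis using y uv(1) by (simp add: mult.assoc[symmetric])
qed

lemma Phi_eq_0:
  assumes uv: "e = u * v" "e * u = u" "u * e = 0" "e * v = 0" "v * e = v"
    and uv': "1 - e = u' * v'" "e * u' = 0" "u' * e = u'" "e * v' = v'" "v' * e = 0"
  shows "\<Phi> x y = 0"
proof -
  define p11 where "p11 x = e * x * e" for x
  define p12 where "p12 x = e * x - e * x * e" for x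
  define p21 where "p21 x = x * e - e * x * e" for x
  define p22 where "p22 x = x - e * x - x * e + e * x * e" for x
  have dec: "x = p11 x + p12 x + p21 x + p22 x" for x
    by (simp add: p11_def p12_def p21_def p22_def)
  note i = mult_prefix[OF idem]
  have p11: "e * p11 x = p11 x" "p11 x * e = p11 x" for x by (simp_all add: p11_def mult.assoc i idem)
  have p12: "e * p12 x = p12 x" "p12 x * e = 0" for x by (simp_all add: p12_def algebra_simps i idem)
  have p21: "e * p21 x = 0" "p21 x * e = p21 x" for x by (simp_all add: p21_def algebra_simps i idem)
  have p22: "e * p22 x = 0" "p22 x * e = 0" for x by (simp_all add: p22_def algebra_simps i idem)
  have diag: "\<Phi> (p11 x) (p11 y) = 0" by (rule Phi_diag[OF uv p11 p11])
  have codiag: "\<Phi> (p22 x) (p22 y) = 0"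
    by (rule spanned_idempotent.Phi_diag[OF complement uv'(1)]) (use p22 uv' in \<open>simp_all add: algebra_simps\<close>)
  have *: "\<Phi> (p11 x) (p12 y) = 0" "\<Phi> (p11 x) (p21 y) = 0" "\<Phi> (p11 x) (p22 y) = 0"
    "\<Phi> (p12 x) (p12 y) = 0" "\<Phi> (p12 x) (p21 y) = 0" "\<Phi> (p22 x) (p12 y) = 0"
    "\<Phi> (p21 x) (p21 y) = 0" "\<Phi> (p22 x) (p21 y) = 0" for x y
    by (rule Phi_diag_upper[OF p11 p12], rule Phi_diag_lower[OF p11 p21], rule Phi_corners[OF p11 p22],
        rule Phi_upper[OF p12 p12], rule Phi_upper_lower[OF p12 p21], rule Phi_codiag_upper[OF p22 p12],
        rule Phi_lower[OF p21 p21], rule Phi_codiag_lower[OF p22 p21])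
  have **: "\<Phi> (p12 x) (p11 y) = 0" "\<Phi> (p21 x) (p11 y) = 0" "\<Phi> (p22 x) (p11 y) = 0"
    "\<Phi> (p21 x) (p12 y) = 0" "\<Phi> (p12 x) (p22 y) = 0" "\<Phi> (p21 x) (p22 y) = 0"
    using *[of y x] by (simp_all add: Phi_sym[of _ "p11 y"] Phi_sym[of _ "p12 y"] Phi_sym[of _ "p22 y"])
  have "\<Phi> (p11 x + p12 x + p21 x + p22 x) (p11 y + p12 y + p21 y + p22 y) = 0"
    by (simp only: Phi_linear diag codiag * **) simp
  then show ?thesis using dec[of x] dec[of y] by simp
qed

end

text \<open>For \<open>n\<close> off-diagonal with respect to \<open>p\<close>, the symmetry
  \<open>h = 2 p - 1\<close> anticommutes with \<open>n\<close>, hence \<open>T h\<close>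
  anticommutes with \<open>T n\<close>, while the square of \<open>T h\<close> is
  \<open>z * z\<close>; so \<open>z * z\<close> commutes with \<open>T n\<close>, and off-diagonal
  elements span. With \<open>T w = 1\<close> every \<open>y\<close> is a multiple of some
  \<open>t * z + z * t\<close>, which commutes with \<open>z\<close> once \<open>z * z\<close> is
  central. The identity at \<open>w\<close> then exhibits \<open>T (w * w)\<close> as the inverse of
  \<open>z\<close>.\<close>

theorem weighted_jordan:
  fixes T :: "'a::cbanach_algebra \<Rightarrow> 'b::cbanach_algebra" and e u v u' v' :: 'a
  assumes lin: "c_linear T" and surj: "surj T" and sq: "\<And>a. a * a = 0 \<Longrightarrow> T a * T a = 0"
    and e: "e * e = e" "corner_spanned e" "corner_spanned (1 - e)"
    and uv: "e = u * v" "e * u = u" "u * e = 0" "e * v = 0" "v * e = v"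
    and uv': "1 - e = u' * v'" "e * u' = 0" "u' * e = u'" "e * v' = v'" "v' * e = 0"
  shows "(\<exists>!J. jordan_epi J \<and> (\<forall>x. T x = T 1 * J x)) \<and> central (T 1) \<and> inv_el (T 1)"
proof -
  interpret spanned_idempotent T e by unfold_locales (use lin sq e in auto)
  define z where "z = T 1"
  have J: "T x * T y + T y * T x = (1/2) *\<^sub>R (T (x * y + y * x) * z + z * T (x * y + y * x))" for x y
    using Phi_eq_0[OF uv uv', of x y] by (simp add: \<Phi>_def \<phi>_def z_def)
  have J2: "T x * T x = (1/2) *\<^sub>R (T (x * x) * z + z * T (x * x))" for x
  proof -
    have "2 *\<^sub>R (T x * T x) = T (x * x) * z + z * T (x * x)"
    proof -
      have "T (x * x + x * x) * z + z * T (x * x + x * x) = 2 *\<^sub>R (T (x * x) * z + z * T (x * x))"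
        by (simp add: c_linearD[OF lin] scaleR_2 algebra_simps)
      then show ?thesis using J[of x x] by (simp add: scaleR_2)
    qed
    then have "(1/2) *\<^sub>R 2 *\<^sub>R (T x * T x) = (1/2) *\<^sub>R (T (x * x) * z + z * T (x * x))" by (simp only:)
    then show ?thesis by simp
  qed
  have com_off: "z * z * T n = T n * (z * z)" if n: "off_diagonal n" for n
  proof -
    obtain p where p: "p * p = p" "p * n = n" "n * p = 0" using n by (auto simp: off_diagonal_def)
    define h where "h = 2 *\<^sub>R p - 1"
    have h: "h * h = 1" "h * n + n * h = 0" using p by (simp_all add: h_def algebra_simps scaleR_2)
    have hh: "T h * T h = z * z" using J2[of h] by (simp add: h z_def scaleR_2[symmetric])
    have an: "T h * T n = - (T n * T h)" using J[of h n] by (simp add: h c_linearD[OF lin] eq_neg_iff_add_eq_0)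
    have "T h * T h * T n = T n * (T h * T h)"
    proof -
      have "T h * T h * T n = T h * (T h * T n)" by (simp only: mult.assoc)
      also have "\<dots> = T h * - (T n * T h)" by (simp only: an)
      also have "\<dots> = - (T h * T n * T h)" by (simp add: mult.assoc)
      also have "\<dots> = - (- (T n * T h) * T h)" by (simp only: an)
      also have "\<dots> = T n * (T h * T h)" by (simp add: mult.assoc)
      finally show ?thesis .
    qed
    then show ?thesis by (simp add: hh)
  qed
  have com_span: "z * z * T x = T x * (z * z)" if "x \<in> span {n. off_diagonal n}" for x
    using that by (induction rule: span_induct_alt) (use com_off in \<open>auto simp: c_linearD[OF lin] algebra_simps\<close>)
  have "x \<in> span {n. off_diagonal n}" for x :: 'a
  proof -
    note i = mult_prefix[OF e(1)]
    define a where "a = e * x * e"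
    define b where "b = e * x - e * x * e"
    define c where "c = x * e - e * x * e"
    define d where "d = x - e * x - x * e + e * x * e"
    have "a \<in> span {n. corner_off_diagonal e n}"
      using e(2) by (auto simp: corner_spanned_def a_def mult.assoc i e(1))
    moreover have "d \<in> span {n. corner_off_diagonal (1 - e) n}"
      using e(3) by (auto simp: corner_spanned_def d_def algebra_simps i e(1))
    moreover have "{n. corner_off_diagonal f n} \<subseteq> {n. off_diagonal n}" for f :: 'a
      by (auto simp: corner_off_diagonal_def)
    ultimately have "a \<in> span {n. off_diagonal n}" "d \<in> span {n. off_diagonal n}"
      using span_mono by blast+
    moreover have "off_diagonal b"
      unfolding off_diagonal_def by (rule exI[of _ e]) (simp add: b_def algebra_simps i e(1))
    moreover have "off_diagonal c"
      unfolding off_diagonal_def by (rule exI[of _ "1 - e"]) (simp add: c_def algebra_simps i e(1))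
    ultimately have "a + b + c + d \<in> span {n. off_diagonal n}"
      by (auto intro!: span_add intro: span_base)
    then show ?thesis by (simp add: a_def b_def c_def d_def)
  qed
  then have zz: "z * z * y = y * (z * z)" for y using com_span surj by (metis surjD)
  obtain w where w: "T w = 1" using surj by (metis surjD)
  have cen: "z * y = y * z" for y
  proof -
    obtain x where x: "T x = y" using surj by (metis surjD)
    define t where "t = T (x * w + w * x)"
    have y: "2 *\<^sub>R y = (1/2) *\<^sub>R (t * z + z * t)" using J[of x w] by (simp add: w x t_def scaleR_2)
    have "z * (t * z + z * t) = (t * z + z * t) * z"
      using zz[of t] by (simp add: algebra_simps)
    then have "z * (2 *\<^sub>R y) = (2 *\<^sub>R y) * z" unfolding y by simp
    then show ?thesis by simp
  qed
  have Jz: "T x * T x = z * T (x * x)" for x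
    using J2[of x] cen[of "T (x * x)"] by (simp add: scaleR_2[symmetric])
  have zw: "z * T (w * w) = 1" "T (w * w) * z = 1" using Jz[of w] cen w by auto
  then have iz: "inv_el z" by (rule inv_elI)
  define k where "k = T (w * w)"
  have k: "z * k = 1" "k * z = 1" using zw by (auto simp: k_def)
  have kc: "k * y = y * k" for y
  proof -
    have "k * y = k * (y * z) * k" using k by (simp add: mult.assoc)
    also have "\<dots> = k * z * y * k" using cen by (simp add: mult.assoc)
    finally show ?thesis using k by simp
  qed
  have Jzxy: "T x * T y + T y * T x = z * T (x * y + y * x)" for x y
    using J[of x y] cen[of "T (x * y + y * x)"] by (simp add: scaleR_2[symmetric])
  have "jordan_epi (\<lambda>x. k * T x)"
    unfolding jordan_epi_def
  proof (intro conjI allI)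
    show "c_linear (\<lambda>x. k * T x)"
      by (simp add: c_linear_def c_linearD[OF lin] distrib_left cscale_mult_right)
    have "\<exists>x. y = k * T x" for y
    proof -
      obtain x where "T x = z * y" using surj by (metis surjD)
      then have "y = k * T x" using k by (simp add: mult.assoc[symmetric])
      then show ?thesis by blast
    qed
    then show "surj (\<lambda>x. k * T x)" by (auto simp: surj_def)
    fix x y
    have "k * T x * (k * T y) = k * k * (T x * T y)" for x y
      using kc by (metis mult.assoc)
    then have "k * T x * (k * T y) + k * T y * (k * T x) = k * k * (T x * T y + T y * T x)"
      by (simp add: distrib_left)
    also have "\<dots> = k * (k * z) * T (x * y + y * x)" by (simp add: Jzxy mult.assoc)
    finally show "k * T (jprod x y) = jprod (k * T x) (k * T y)"
      using k by (simp add: jprod_def c_linearD[OF lin])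
  qed
  moreover have "T x = z * (k * T x)" for x using k by (simp add: mult.assoc[symmetric])
  moreover have "J = (\<lambda>x. k * T x)" if "\<forall>x. T x = z * J x" for J
    using that k by (auto simp: mult.assoc[symmetric] intro!: ext)
  ultimately have "\<exists>!J. jordan_epi J \<and> (\<forall>x. T x = z * J x)" by (intro ex1I[of _ "\<lambda>x. k * T x"]) auto
  then show ?thesis using cen iz by (auto simp: central_def z_def)
qed

subsection \<open>Polynomial spectral mapping\<close>

definition peval :: "complex poly \<Rightarrow> 'a::cbanach_algebra \<Rightarrow> 'a" where
  "peval p x = fold_coeffs (\<lambda>a y. cscale a 1 + x * y) p 0"

lemma peval_0 [simp]: "peval 0 x = 0" by (simp add: peval_def)

lemma peval_pCons [simp]: "peval (pCons a p) x = cscale a 1 + x * peval p x"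
  unfolding peval_def by (cases "p = 0"; cases "a = 0") simp_all

lemma peval_add: "peval (p + q) x = peval p x + peval q x"
  by (induction p q rule: poly_induct2) (simp_all add: cscale_add_left algebra_simps)

lemma peval_smult: "peval (smult c p) x = cscale c (peval p x)"
  by (induction p) (simp_all add: cscale_cscale cscale_add_right cscale_mult_right)

lemma peval_mult: "peval (p * q) x = peval p x * peval q x"
  by (induction p) (simp_all add: peval_add peval_smult cscale_mult_left distrib_right mult.assoc)

lemma peval_diff: "peval (p - q) x = peval p x - peval q x"
proof -
  have "peval (- q) x = - peval q x" using peval_smult[of "-1" q x] by simp
  then show ?thesis using peval_add[of p "- q" x] by simp
qed

lemma peval_power: "peval (p ^ n) x = peval p x ^ n"
  by (induction n) (simp_all add: peval_mult one_pCons)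

lemma peval_commute: "peval p x * peval q x = peval q x * peval p x"
  by (metis peval_mult mult.commute)

lemma root_of_not_inv:
  assumes "\<not> inv_el (peval q (x::'a::cbanach_algebra))" shows "\<exists>t\<in>cspectrum x. poly q t = 0"
  using assms
proof (induction "degree q" arbitrary: q rule: less_induct)
  case less
  show ?case
  proof (cases "degree q = 0")
    case True
    then obtain c where c: "q = [:c:]" by (metis degree_eq_zeroE)
    have "c = 0"
    proof (rule ccontr)
      assume "c \<noteq> 0"
      then have "inv_el (peval q x)" using inv_el_cscale_iff[of c "1::'a"] by (simp add: c)
      then show False using less.prems by simp
    qed
    then show ?thesis using cspectrum_nonempty[of x] c by auto
  next
    case False
    then have "\<not> constant (poly q)" by (simp add: constant_degree)
    then obtain r where r: "poly q r = 0" using fundamental_theorem_of_algebra by blast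
    show ?thesis
    proof (cases "r \<in> cspectrum x")
      case False
      obtain q' where q': "q = [:- r, 1:] * q'" using r by (auto simp: poly_eq_0_iff_dvd dvd_def)
      have "inv_el (x - cscale r 1)" using False by (simp add: cspectrum_iff)
      moreover have "peval q x = (x - cscale r 1) * peval q' x" unfolding q' peval_mult by (simp add: algebra_simps)
      ultimately have "\<not> inv_el (peval q' x)" using less.prems inv_el_mult by metis
      moreover have "q' \<noteq> 0" using q' \<open>degree q \<noteq> 0\<close> by auto
      then have "degree q = Suc (degree q')" unfolding q' by (subst degree_mult_eq) auto
      ultimately obtain t where "t \<in> cspectrum x" "poly q' t = 0" using less.hyps[of q'] by auto
      then show ?thesis by (auto simp: q')
    qed (use r in auto)
  qed
qed

lemma cspectrum_peval: "cspectrum (peval p (x::'a::cbanach_algebra)) = poly p ` cspectrum x"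
proof (intro equalityI subsetI)
  fix z assume "z \<in> cspectrum (peval p x)"
  then have "\<not> inv_el (peval (p - [:z:]) x)" by (simp add: cspectrum_iff peval_diff)
  then show "z \<in> poly p ` cspectrum x" using root_of_not_inv by fastforce
next
  fix z assume "z \<in> poly p ` cspectrum x"
  then obtain t where t: "t \<in> cspectrum x" "z = poly p t" by auto
  have "poly (p - [:z:]) t = 0" using t by simp
  then have "[:- t, 1:] dvd p - [:z:]" by (simp only: poly_eq_0_iff_dvd)
  then obtain q where q: "p - [:z:] = [:- t, 1:] * q" by (rule dvdE)
  have e: "peval p x - cscale z 1 = (x - cscale t 1) * peval q x"
    using arg_cong[OF q, of "\<lambda>p. peval p x"] unfolding peval_mult by (simp add: peval_diff algebra_simps)
  have c: "(x - cscale t 1) * peval q x = peval q x * (x - cscale t 1)"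
    using peval_commute[of "[:-t, 1:]" x q] by (simp add: algebra_simps)
  show "z \<in> cspectrum (peval p x)"
  proof (rule ccontr)
    assume "z \<notin> cspectrum (peval p x)"
    then have "inv_el (x - cscale t 1)" using inv_el_factor[OF _ c] e by (simp add: cspectrum_iff)
    then show False using t by (simp add: cspectrum_iff)
  qed
qed

text \<open>An inverse \<open>w\<close> of \<open>y * x - z\<close> yields the inverse
  \<open>(x * w * y - 1) / z\<close> of \<open>x * y - z\<close>; the division is why
  \<open>z = 0\<close> is excluded.\<close>

lemma cspectrum_mult_commute:
  assumes "z \<noteq> 0" "z \<in> cspectrum (x * y)" shows "z \<in> cspectrum (y * (x::'a::cbanach_algebra))"
proof (rule ccontr)
  assume "z \<notin> cspectrum (y * x)"
  then have i: "inv_el (y * x - cscale z 1)" by (simp add: cspectrum_iff)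
  define w where "w = alg_inv (y * x - cscale z 1)"
  have w: "y * (x * w) = 1 + cscale z w" "w * (y * x) = 1 + cscale z w"
    using alg_inv[OF i] by (simp_all add: w_def algebra_simps cscale_mult_left cscale_mult_right)
  define v where "v = cscale (inverse z) (x * w * y - 1)"
  have "(x * y - cscale z 1) * v = 1"
    using assms(1) w(1)[THEN mult_prefix, of y]
    by (simp add: v_def algebra_simps cscale_mult_left cscale_mult_right cscale_cscale cscale_diff_right cscale_add_right)
  moreover have "v * (x * y - cscale z 1) = 1"
  proof -
    have "x * w * y * (x * y) = x * (w * (y * x)) * y" by (simp add: mult.assoc)
    also have "\<dots> = x * y + cscale z (x * w * y)" by (simp add: w algebra_simps cscale_mult_left cscale_mult_right)
    finally show ?thesis using assms(1)
      by (simp add: v_def algebra_simps cscale_mult_left cscale_mult_right cscale_cscale cscale_diff_right cscale_add_right)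
  qed
  ultimately show False using assms(2) by (auto simp: cspectrum_iff intro: inv_elI)
qed

subsection \<open>Self-adjoint and positive elements\<close>

lemma cstar_0 [simp]: "cstar 0 = (0::'a::cstar_algebra)"
  using cstar_add[of "0::'a" 0] by simp

lemma cstar_minus [simp]: "cstar (- x) = - cstar (x::'a::cstar_algebra)"
  using cstar_cscale[of "-1" x] by simp

lemma cstar_diff: "cstar (x - y) = cstar x - cstar (y::'a::cstar_algebra)"
  using cstar_add[of x "-y"] by simp

lemma cstar_one [simp]: "cstar 1 = (1::'a::cstar_algebra)"
  by (metis cstar_cstar cstar_mult mult.left_neutral mult.right_neutral)

lemma cstar_scaleR: "cstar (r *\<^sub>R x) = r *\<^sub>R cstar (x::'a::cstar_algebra)"
  by (simp add: scaleR_eq_cscale cstar_cscale)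

lemma cstar_of_real [simp]: "cstar (of_real r) = (of_real r::'a::cstar_algebra)"
  by (simp add: of_real_def cstar_scaleR)

lemma cstar_power: "cstar (x ^ n) = cstar (x::'a::cstar_algebra) ^ n"
  by (induction n) (simp_all add: cstar_mult power_commutes)

lemma norm_cstar [simp]: "norm (cstar x) = norm (x::'a::cstar_algebra)"
proof -
  have le: "norm x \<le> norm (cstar x)" for x :: 'a
  proof (cases "x = 0")
    case False
    have "norm x * norm x \<le> norm (cstar x) * norm x"
      using norm_mult_ineq[of "cstar x" x] by (simp add: cstar_identity power2_eq_square)
    then show ?thesis using False by simp
  qed simp
  from le[of x] le[of "cstar x"] show ?thesis by (simp add: cstar_cstar)
qed

lemma bounded_linear_cstar: "bounded_linear (cstar :: 'a::cstar_algebra \<Rightarrow> 'a)"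
  by (rule bounded_linear_intro[of _ 1]) (simp_all add: cstar_add cstar_scaleR)

lemma cstar_eq_0_iff [simp]: "cstar x = 0 \<longleftrightarrow> (x::'a::cstar_algebra) = 0"
  by (metis norm_cstar norm_eq_zero)

lemma cstar_mult_self_eq_0: "cstar x * x = 0 \<longleftrightarrow> (x::'a::cstar_algebra) = 0"
  using cstar_identity[of x] by (metis mult_zero_right norm_eq_zero power_eq_0_iff)

lemma alg_inv_cstar:
  assumes "inv_el (u::'a::cstar_algebra)" shows "inv_el (cstar u)" "alg_inv (cstar u) = cstar (alg_inv u)"
proof -
  have "cstar u * cstar (alg_inv u) = 1" "cstar (alg_inv u) * cstar u = 1"
    using alg_inv[OF assms] by (simp_all flip: cstar_mult)
  then show "inv_el (cstar u)" "alg_inv (cstar u) = cstar (alg_inv u)" by (auto intro: inv_elI alg_inv_eq)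
qed

lemma of_real_eq_cscale: "(of_real r :: 'a::cbanach_algebra) = cscale (of_real r) 1"
  by (simp add: of_real_def scaleR_eq_cscale)

lemma selfadjoint_norm_power:
  assumes "cstar h = (h::'a::cstar_algebra)" shows "norm (h ^ (2 ^ k)) = norm h ^ (2 ^ k)"
proof (induction k)
  case (Suc k)
  have "h ^ (2 ^ Suc k) = cstar (h ^ (2 ^ k)) * h ^ (2 ^ k)"
    using assms by (simp add: cstar_power power_add[symmetric] mult_2)
  then have "norm (h ^ (2 ^ Suc k)) = (norm (h ^ (2 ^ k)))\<^sup>2" by (simp only: cstar_identity)
  then show ?case using Suc by (simp add: power_mult[symmetric] mult.commute)
qed simp

lemma selfadjoint_spectral_radius:
  assumes h: "cstar h = (h::'a::cstar_algebra)" shows "spectral_radius h = norm h"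
proof (rule antisym[OF spectral_radius_le_norm], rule ccontr)
  assume "\<not> norm h \<le> spectral_radius h"
  then have "\<forall>\<^sub>F N in sequentially. norm (h ^ N) < norm h ^ N" by (intro spectral_radius_lt_imp) simp
  then obtain N where N: "\<And>n. n \<ge> N \<Longrightarrow> norm (h ^ n) < norm h ^ n" by (auto simp: eventually_sequentially)
  have "N \<le> 2 ^ N" by (simp add: less_imp_le)
  then show False using N[of "2 ^ N"] selfadjoint_norm_power[OF h, of N] by simp
qed

text \<open>Arens's trick: shifting by \<open>\<i> * t\<close> adds only \<open>t\<^sup>2\<close> to
  the squared norm, whereas the squared modulus of a shifted nonreal spectral point also gains a
  term linear in \<open>t\<close>.\<close>

lemma selfadjoint_spectrum_real:
  assumes h: "cstar h = (h::'a::cstar_algebra)" and z: "z \<in> cspectrum h" shows "Im z = 0"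
proof (rule ccontr)
  assume nz: "Im z \<noteq> 0"
  have key: "2 * Im z * t \<le> (norm h)\<^sup>2" for t
  proof -
    define y where "y = h + cscale (\<i> * of_real t) 1"
    have "z + \<i> * of_real t \<in> cspectrum y" using z by (simp add: y_def cspectrum_shift)
    then have "cmod (z + \<i> * of_real t) \<le> norm y" by (rule norm_cspectrum_le)
    then have "(cmod (z + \<i> * of_real t))\<^sup>2 \<le> (norm y)\<^sup>2" by (rule power_mono) simp
    also have "(norm y)\<^sup>2 = norm (cstar y * y)" by (simp add: cstar_identity)
    also have "cstar y * y = h * h + of_real (t\<^sup>2)"
    proof -
      have c: "(of_real (t\<^sup>2) :: 'a) = cscale (of_real t * of_real t) 1"
        unfolding of_real_eq_cscale[of "t\<^sup>2"] by (simp add: power2_eq_square)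
      show ?thesis unfolding c
        by (simp add: y_def cstar_add cstar_cscale h algebra_simps cscale_mult_left cscale_mult_right cscale_cscale
            cscale_add_right cscale_diff_right)
    qed
    also have "norm \<dots> \<le> norm (h * h) + norm (of_real (t\<^sup>2) :: 'a)" by (rule norm_triangle_ineq)
    also have "\<dots> \<le> (norm h)\<^sup>2 + t\<^sup>2" using norm_mult_ineq[of h h] unfolding norm_of_real by (simp add: power2_eq_square)
    finally have "(cmod (z + \<i> * of_real t))\<^sup>2 \<le> (norm h)\<^sup>2 + t\<^sup>2" .
    moreover have "(cmod (z + \<i> * of_real t))\<^sup>2 = (Re z)\<^sup>2 + (Im z + t)\<^sup>2" by (simp add: cmod_power2)
    moreover have "(Im z + t)\<^sup>2 = (Im z)\<^sup>2 + 2 * Im z * t + t\<^sup>2" by (simp add: power2_eq_square algebra_simps)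
    ultimately show ?thesis using zero_le_power2[of "Re z"] zero_le_power2[of "Im z"] by linarith
  qed
  show False using key[of "((norm h)\<^sup>2 + 1) / (2 * Im z)"] nz by simp
qed

lemma is_positiveD:
  assumes "is_positive (h::'a::cstar_algebra)"
  shows "cstar h = h" "z \<in> cspectrum h \<Longrightarrow> 0 \<le> Re z" "z \<in> cspectrum h \<Longrightarrow> Im z = 0"
  using assms by (auto simp: is_positive_def complex_is_Real_iff)

lemma is_positiveI:
  "cstar h = h \<Longrightarrow> (\<And>z. z \<in> cspectrum h \<Longrightarrow> 0 \<le> Re z) \<Longrightarrow> is_positive (h::'a::cstar_algebra)"
  using selfadjoint_spectrum_real by (auto simp: is_positive_def complex_is_Real_iff)

lemma cspectrum_of_real_diff: "z \<in> cspectrum (of_real r - (h::'a::cbanach_algebra)) \<longleftrightarrow> of_real r - z \<in> cspectrum h"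
proof -
  have "of_real r - h - cscale z 1 = - (h - cscale (of_real r - z) 1)"
    by (simp add: of_real_eq_cscale cscale_diff_left)
  then show ?thesis by (simp only: cspectrum_iff inv_el_minus_iff)
qed

text \<open>Expressing positivity by a norm bound makes the cone stable under addition and later
  allows order relations to be written as memberships in closed balls.\<close>

lemma is_positiveI_norm:
  assumes h: "cstar h = (h::'a::cstar_algebra)" and n: "norm (of_real r - h) \<le> r" shows "is_positive h"
proof (rule is_positiveI[OF h])
  fix z assume z: "z \<in> cspectrum h"
  then have "of_real r - z \<in> cspectrum (of_real r - h)" by (simp add: cspectrum_of_real_diff)
  then have "cmod (of_real r - z) \<le> r" using norm_cspectrum_le n order_trans by blast
  then have "Re (of_real r - z) \<le> r" using complex_Re_le_cmod order_trans by blast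
  then show "0 \<le> Re z" by simp
qed

lemma is_positive_norm:
  assumes h: "is_positive (h::'a::cstar_algebra)" and n: "norm h \<le> r" shows "norm (of_real r - h) \<le> r"
proof -
  have "cstar (of_real r - h) = of_real r - h" using is_positiveD(1)[OF h] by (simp add: cstar_diff)
  then have "norm (of_real r - h) = spectral_radius (of_real r - h)" by (simp add: selfadjoint_spectral_radius)
  also have "\<dots> \<le> r"
  proof (rule spectral_radius_leI)
    fix z assume "z \<in> cspectrum (of_real r - h)"
    then have z: "of_real r - z \<in> cspectrum h" by (simp add: cspectrum_of_real_diff)
    have "Im z = 0" using is_positiveD(3)[OF h z] by simp
    moreover have "Re z \<le> r" using is_positiveD(2)[OF h z] by simp
    moreover have "r - Re z \<le> norm h"
      using norm_cspectrum_le[OF z] complex_Re_le_cmod[of "of_real r - z"] by simp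
    ultimately show "cmod z \<le> r" using n by (simp add: cmod_eq_Re)
  qed
  finally show ?thesis .
qed

lemma is_positive_add:
  assumes "is_positive a" "is_positive b" shows "is_positive (a + b :: 'a::cstar_algebra)"
proof (rule is_positiveI_norm[of _ "norm a + norm b"])
  show "cstar (a + b) = a + b" using assms by (simp add: cstar_add is_positiveD)
  have "of_real (norm a + norm b) - (a + b) = (of_real (norm a) - a) + (of_real (norm b) - b)" by simp
  also have "norm \<dots> \<le> norm (of_real (norm a) - a) + norm (of_real (norm b) - b)" by (rule norm_triangle_ineq)
  also have "\<dots> \<le> norm a + norm b" by (intro add_mono is_positive_norm assms) auto
  finally show "norm (of_real (norm a + norm b) - (a + b)) \<le> norm a + norm b" .
qed

lemma is_positive_scaleR:
  assumes "is_positive a" "r \<ge> 0" shows "is_positive (r *\<^sub>R a :: 'a::cstar_algebra)"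
proof (rule is_positiveI_norm[of _ "r * norm a"])
  show "cstar (r *\<^sub>R a) = r *\<^sub>R a" using assms by (simp add: cstar_scaleR is_positiveD)
  have "of_real (r * norm a) - r *\<^sub>R a = r *\<^sub>R (of_real (norm a) - a)"
    by (simp add: of_real_def scaleR_diff_right)
  then have "norm (of_real (r * norm a) - r *\<^sub>R a) = r * norm (of_real (norm a) - a)" using assms by simp
  also have "\<dots> \<le> r * norm a" by (intro mult_left_mono is_positive_norm assms) auto
  finally show "norm (of_real (r * norm a) - r *\<^sub>R a) \<le> r * norm a" .
qed

lemma is_positive_of_real: "r \<ge> 0 \<Longrightarrow> is_positive (of_real r :: 'a::cstar_algebra)"
  by (rule is_positiveI_norm[of _ r]) auto

lemma is_positive_0 [simp]: "is_positive (0 :: 'a::cstar_algebra)" and is_positive_1 [simp]: "is_positive (1 :: 'a::cstar_algebra)"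
  using is_positive_of_real[of 0, where ?'a = 'a] is_positive_of_real[of 1, where ?'a = 'a] by auto

lemma is_positive_antisym:
  assumes "is_positive a" "is_positive (- a)" shows "(a :: 'a::cstar_algebra) = 0"
proof -
  have "spectral_radius a \<le> 0"
  proof (rule spectral_radius_leI)
    fix z assume z: "z \<in> cspectrum a"
    then have "- z \<in> cspectrum (- a)" using cspectrum_of_real_diff[of "-z" 0 a] by simp
    then have "Re z = 0" "Im z = 0" using is_positiveD[OF assms(1)] is_positiveD[OF assms(2)] z by force+
    then show "cmod z \<le> 0" by (simp add: complex_eq_iff)
  qed
  then show ?thesis using selfadjoint_spectral_radius[OF is_positiveD(1)[OF assms(1)]] by simp
qed

lemma is_positive_norm_diff: "is_positive a \<Longrightarrow> norm a \<le> r \<Longrightarrow> is_positive (of_real r - a :: 'a::cstar_algebra)"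
proof (rule is_positiveI)
  assume a: "is_positive a" and r: "norm a \<le> r"
  show "cstar (of_real r - a) = of_real r - a" using is_positiveD(1)[OF a] by (simp add: cstar_diff)
  fix z assume "z \<in> cspectrum (of_real r - a)"
  then have z: "of_real r - z \<in> cspectrum a" by (simp add: cspectrum_of_real_diff)
  have "r - Re z \<le> norm a"
    using norm_cspectrum_le[OF z] complex_Re_le_cmod[of "of_real r - z"] by simp
  then show "0 \<le> Re z" using r by simp
qed

lemma norm_le_of_positive_diff:
  assumes a: "is_positive a" and ra: "is_positive (of_real r - a :: 'a::cstar_algebra)" shows "norm a \<le> r"
proof -
  have "spectral_radius a \<le> r"
  proof (rule spectral_radius_leI)
    fix z assume z: "z \<in> cspectrum a"
    then have "of_real r - z \<in> cspectrum (of_real r - a)" by (simp add: cspectrum_of_real_diff)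
    then have "Re z \<le> r" using is_positiveD(2)[OF ra] by force
    then show "cmod z \<le> r" using is_positiveD(2,3)[OF a z] by (simp add: cmod_eq_Re)
  qed
  then show ?thesis using selfadjoint_spectral_radius[OF is_positiveD(1)[OF a]] by simp
qed

lemma norm_mono_positive:
  assumes a: "is_positive a" and ab: "is_positive (b - a :: 'a::cstar_algebra)" shows "norm a \<le> norm b"
proof (rule norm_le_of_positive_diff[OF a])
  have b: "is_positive b" using is_positive_add[OF a ab] by simp
  have "is_positive ((of_real (norm b) - b) + (b - a))"
    by (intro is_positive_add ab is_positive_norm_diff b) simp
  then show "is_positive (of_real (norm b) - a)" by simp
qed

lemma is_positive_square:
  assumes h: "cstar h = (h :: 'a::cstar_algebra)" shows "is_positive (h * h)"
proof (rule is_positiveI)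
  show "cstar (h * h) = h * h" using h by (simp add: cstar_mult)
  fix z assume "z \<in> cspectrum (h * h)"
  then have "z \<in> poly [:0, 0, 1:] ` cspectrum h" using cspectrum_peval[of "[:0, 0, 1:]" h] by simp
  then obtain t where "t \<in> cspectrum h" "z = t * t" by auto
  then show "0 \<le> Re z" using selfadjoint_spectrum_real[OF h] by simp
qed

text \<open>If \<open>- l\<close> with \<open>l > 0\<close> were in the spectrum of \<open>h = x\<^sup>* x\<close>, then for \<open>y = x (K - h)\<^sup>n\<close> the negative part of
  \<open>y\<^sup>* y\<close> would eventually dominate its positive part; but \<open>y\<^sup>* y + y y\<^sup>* \<ge> 0\<close>, and \<open>y\<^sup>* y\<close>, \<open>y y\<^sup>*\<close> have
  the same nonzero spectrum.\<close>

lemma is_positive_cstar_mult: "is_positive (cstar x * x :: 'a::cstar_algebra)"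
proof (rule is_positiveI)
  define h where "h = cstar x * x"
  show sa0: "cstar (cstar x * x) = cstar x * x" by (simp add: cstar_mult cstar_cstar)
  then have sa: "cstar h = h" by (simp add: h_def)
  fix z assume "z \<in> cspectrum (cstar x * x)"
  then have z: "z \<in> cspectrum h" by (simp add: h_def)
  then have zr: "Im z = 0" using selfadjoint_spectrum_real[OF sa] by blast
  show "0 \<le> Re z"
  proof (rule ccontr)
    assume "\<not> 0 \<le> Re z"
    define l where "l = - Re z"
    have l: "l > 0" using \<open>\<not> 0 \<le> Re z\<close> by (simp add: l_def)
    have zl: "z = of_real (- l)" using zr by (simp add: complex_eq_iff l_def)
    define K where "K = norm h + 1"
    have K: "K > 0" by (simp add: K_def add_nonneg_pos)
    have bound: "l * (K + l) ^ (2 * n) \<le> K * K ^ (2 * n)" for n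
    proof -
      define k where "k = of_real K - h"
      have k: "cstar k = k" by (simp add: k_def cstar_diff sa)
      have kh: "k * h = h * k" by (simp add: k_def algebra_simps of_real_def)
      then have khn: "k ^ n * h = h * k ^ n" by (metis power_commuting_commutes)
      define y where "y = x * k ^ n"
      \<comment> \<open>The even exponent keeps the sign of \<open>t\<close>, and
        \<open>K - t\<close> exceeds \<open>K\<close> exactly for negative \<open>t\<close>: the
        value at \<open>- l\<close> grows like \<open>(K + l) ^ (2 * n)\<close>, positive values at
        most like \<open>K ^ (2 * n)\<close>.\<close>
      define p :: "complex poly" where "p = [:0, 1:] * [:of_real K, -1:] ^ (2 * n)"
      have "cstar y * y = k ^ n * h * k ^ n"
        by (simp add: y_def cstar_mult cstar_power k h_def mult.assoc)
      also have "\<dots> = h * k ^ (2 * n)" by (simp add: khn mult.assoc power_add[symmetric] mult_2)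
      also have "\<dots> = peval p h"
        unfolding p_def peval_mult peval_power by (simp add: k_def of_real_eq_cscale)
      finally have yy: "cstar y * y = peval p h" .
      have ub: "Re w \<le> K * K ^ (2 * n)" if w: "w \<in> cspectrum (cstar y * y)" for w
      proof -
        obtain t where t: "t \<in> cspectrum h" "w = poly p t" using w unfolding yy cspectrum_peval by auto
        have tr: "t = of_real (Re t)" using selfadjoint_spectrum_real[OF sa t(1)] by (simp add: complex_eq_iff)
        have "w = of_real (Re t * (K - Re t) ^ (2 * n))"
          unfolding t(2) p_def by (subst (1 2) tr) (simp add: poly_power)
        then have rw: "Re w = Re t * (K - Re t) ^ (2 * n)" by (simp only: Re_complex_of_real)
        have at: "\<bar>Re t\<bar> \<le> K" using norm_cspectrum_le[OF t(1)] abs_Re_le_cmod[of t] by (simp add: K_def)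
        have p0: "0 \<le> (K - Re t) ^ (2 * n)" by (simp add: power_mult)
        show ?thesis
        proof (cases "Re t \<ge> 0")
          case True
          then show ?thesis unfolding rw using at by (intro mult_mono power_mono) auto
        next
          case False
          then have "Re t * (K - Re t) ^ (2 * n) \<le> 0" using p0 by (simp add: mult_nonpos_nonneg)
          also have "0 \<le> K * K ^ (2 * n)" using K by simp
          finally show ?thesis by (simp add: rw)
        qed
      qed
      define S where "S = K * K ^ (2 * n)"
      have S: "S \<ge> 0" using K by (simp add: S_def)
      have "is_positive (of_real S - y * cstar y)"
      proof (rule is_positiveI)
        show "cstar (of_real S - y * cstar y) = of_real S - y * cstar y" by (simp add: cstar_diff cstar_mult cstar_cstar)
        fix w assume "w \<in> cspectrum (of_real S - y * cstar y)"
        then have w: "of_real S - w \<in> cspectrum (y * cstar y)" by (simp add: cspectrum_of_real_diff)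
        show "0 \<le> Re w"
        proof (cases "of_real S - w = 0")
          case True then show ?thesis using S by (metis eq_iff_diff_eq_0 Re_complex_of_real)
        next
          case False
          then have "of_real S - w \<in> cspectrum (cstar y * y)" using cspectrum_mult_commute w by blast
          then show ?thesis using ub[of "of_real S - w"] by (simp add: S_def)
        qed
      qed
      moreover
      \<comment> \<open>Up to sign, twice the real and imaginary parts of \<open>y\<close>; their
        squares add up to a positive multiple of the sum of the two products of \<open>y\<close>
        with its adjoint.\<close>
      define a b where "a = y + cstar y" and "b = cscale \<i> (y - cstar y)"
      have ab: "cstar a = a" "cstar b = b"
        by (simp_all add: a_def b_def cstar_add cstar_diff cstar_cstar cstar_cscale cscale_diff_right)
      have sum: "a * a + b * b = 2 *\<^sub>R (cstar y * y + y * cstar y)"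
        by (simp add: a_def b_def algebra_simps cscale_mult_left cscale_mult_right cscale_cscale scaleR_2 cscale_diff_right)
      have "is_positive ((1/2) *\<^sub>R (a * a + b * b))" by (intro is_positive_scaleR is_positive_add is_positive_square ab) simp
      then have "is_positive (cstar y * y + y * cstar y)" by (simp add: sum)
      ultimately have "is_positive ((of_real S - y * cstar y) + (cstar y * y + y * cstar y))" by (rule is_positive_add)
      then have ps: "is_positive (cstar y * y + cscale (of_real S) 1)" by (simp add: of_real_eq_cscale add.commute)
      have "poly p z \<in> cspectrum (cstar y * y)" unfolding yy cspectrum_peval using z by auto
      then have "poly p z + of_real S \<in> cspectrum (cstar y * y + cscale (of_real S) 1)" by (simp add: cspectrum_shift)
      then have "0 \<le> Re (poly p z + of_real S)" by (rule is_positiveD(2)[OF ps])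
      moreover have "poly p z = of_real (- l * (K + l) ^ (2 * n))" by (simp add: p_def poly_power zl)
      ultimately have "0 \<le> Re (of_real (- l * (K + l) ^ (2 * n)) + of_real S)" by simp
      then have "0 \<le> - l * (K + l) ^ (2 * n) + S" by (metis Re_complex_of_real of_real_add)
      then show ?thesis by (simp add: S_def)
    qed
    have "1 < ((K + l) / K)\<^sup>2" using K l by (simp add: one_less_power)
    then obtain n where n: "K / l < (((K + l) / K)\<^sup>2) ^ n" using real_arch_pow by blast
    have "l * (K + l) ^ (2 * n) > K * K ^ (2 * n)"
      using n K l by (simp add: power_mult[symmetric] power_divide field_simps)
    then show False using bound[of n] by simp
  qed
qed

subsection \<open>Square roots\<close>

text \<open>Taylor coefficients of \<open>sqrt (1 - t)\<close>. All but the constant one are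
  nonpositive, which is what gives absolute summability up to and including
  \<open>t = 1\<close>.\<close>

definition sqrt_coeff :: "nat \<Rightarrow> real" where "sqrt_coeff n = ((1/2) gchoose n) * (-1) ^ n"

lemma sqrt_coeff_0 [simp]: "sqrt_coeff 0 = 1" by (simp add: sqrt_coeff_def)

lemma sqrt_coeff_Suc: "sqrt_coeff (Suc n) = (real n - 1/2) / real (Suc n) * sqrt_coeff n"
proof -
  have g: "(1/2 gchoose Suc n) = (1/2 - real n) / real (Suc n) * ((1/2::real) gchoose n)"
    using gbinomial_mult_1[of "1/2::real" n] by (simp add: field_simps)
  have m: "(1/2 - real n) / real (Suc n) = - ((real n - 1/2) / real (Suc n))" by (simp add: minus_divide_left)
  have "(- q * G) * (-1 * P) = q * (G * P)" for q G P :: real by simp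
  then show ?thesis unfolding sqrt_coeff_def g m power_Suc .
qed

lemma sqrt_coeff_nonpos: "sqrt_coeff (Suc n) \<le> 0"
proof (induction n)
  case (Suc n)
  then show ?case unfolding sqrt_coeff_Suc[of "Suc n"]
    by (intro mult_nonneg_nonpos divide_nonneg_nonneg) auto
qed (simp add: sqrt_coeff_Suc)

lemma sqrt_coeff_sums: "0 \<le> t \<Longrightarrow> t < 1 \<Longrightarrow> (\<lambda>n. sqrt_coeff n * t ^ n) sums sqrt (1 - t)"
  using sqrt_series[of "- t"] by (simp add: sqrt_coeff_def power_minus[of t] mult_ac)

text \<open>For \<open>t < 1\<close> the signs turn the partial sums into lower bounds of
  \<open>1 - sqrt (1 - t)\<close>; a finite sum survives the limit \<open>t\<close> to
  \<open>1\<close>.\<close>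

lemma sqrt_coeff_partial_sum: "(\<Sum>n<N. \<bar>sqrt_coeff (Suc n)\<bar>) \<le> 1"
proof -
  have "(\<Sum>n<N. \<bar>sqrt_coeff (Suc n)\<bar> * t ^ Suc n) \<le> 1" if t: "0 \<le> t" "t < 1" for t
  proof -
    have "(\<lambda>n. sqrt_coeff (Suc n) * t ^ Suc n) sums (sqrt (1 - t) - 1)"
      using sqrt_coeff_sums[OF t] by (subst sums_Suc_iff) simp
    then have s: "(\<lambda>n. - (sqrt_coeff (Suc n) * t ^ Suc n)) sums - (sqrt (1 - t) - 1)" by (rule sums_minus)
    have e: "\<bar>sqrt_coeff (Suc n)\<bar> * t ^ Suc n = - (sqrt_coeff (Suc n) * t ^ Suc n)" for n
      using sqrt_coeff_nonpos[of n] by simp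
    have "(\<Sum>n<N. - (sqrt_coeff (Suc n) * t ^ Suc n)) \<le> (\<Sum>n. - (sqrt_coeff (Suc n) * t ^ Suc n))"
      by (rule sum_le_suminf[OF sums_summable[OF s]])
        (use sqrt_coeff_nonpos t in \<open>auto simp: mult_nonpos_nonneg\<close>)
    also have "\<dots> = 1 - sqrt (1 - t)" using sums_unique[OF s] by simp
    also have "\<dots> \<le> 1" using t by simp
    finally show ?thesis by (simp only: e)
  qed
  then have ev: "\<forall>\<^sub>F t in at_left 1. (\<Sum>n<N. \<bar>sqrt_coeff (Suc n)\<bar> * t ^ Suc n) \<le> 1"
    unfolding eventually_at_left_field by (intro exI[of _ 0]) auto
  have "((\<lambda>t. \<Sum>n<N. \<bar>sqrt_coeff (Suc n)\<bar> * t ^ Suc n) \<longlongrightarrow> (\<Sum>n<N. \<bar>sqrt_coeff (Suc n)\<bar> * 1 ^ Suc n)) (at_left 1)"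
    by (intro tendsto_intros)
  then have "(\<Sum>n<N. \<bar>sqrt_coeff (Suc n)\<bar> * 1 ^ Suc n) \<le> 1"
    by (rule tendsto_upperbound[OF _ ev]) simp
  then show ?thesis by simp
qed

lemma summable_sqrt_coeff: "summable (\<lambda>n. \<bar>sqrt_coeff n\<bar>)" "(\<Sum>n. \<bar>sqrt_coeff (Suc n)\<bar>) \<le> 1"
proof -
  have s: "summable (\<lambda>n. \<bar>sqrt_coeff (Suc n)\<bar>)"
    by (rule bounded_imp_summable[of _ 1]) (use sqrt_coeff_partial_sum[of "Suc _"] in \<open>auto simp: lessThan_Suc_atMost\<close>)
  then show "summable (\<lambda>n. \<bar>sqrt_coeff n\<bar>)" by (subst (asm) summable_Suc_iff)
  show "(\<Sum>n. \<bar>sqrt_coeff (Suc n)\<bar>) \<le> 1" by (rule suminf_le_const[OF s]) (rule sqrt_coeff_partial_sum)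
qed

text \<open>The square of the series must be \<open>1 - t\<close>: Vandermonde's identity turns the
  convolution into binomial coefficients of exponent \<open>1\<close>.\<close>

lemma sqrt_coeff_convolution:
  "(\<Sum>i\<le>k. sqrt_coeff i * sqrt_coeff (k - i)) = (if k = 0 then 1 else if k = 1 then -1 else 0)"
proof -
  have "(\<Sum>i\<le>k. sqrt_coeff i * sqrt_coeff (k - i)) = (\<Sum>i\<le>k. ((1/2) gchoose i) * ((1/2) gchoose (k - i))) * (-1) ^ k"
    unfolding sum_distrib_right
    by (rule sum.cong) (auto simp: sqrt_coeff_def mult_ac power_add[symmetric])
  also have "(\<Sum>i\<le>k. ((1/2) gchoose i) * ((1/2) gchoose (k - i))) = ((1::real) gchoose k)"
    using gbinomial_Vandermonde[of "1/2::real" "1/2" k] by (simp add: atLeast0AtMost)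
  also have "(1::real) gchoose k = of_nat (1 choose k)" using binomial_gbinomial[of 1 k, where ?'a = real] by simp
  finally show ?thesis
    by (cases k rule: nat.exhaust; cases "k - 1") auto
qed

definition sqrt_one_minus :: "'a::cbanach_algebra \<Rightarrow> 'a" where
  "sqrt_one_minus y = (\<Sum>n. sqrt_coeff n *\<^sub>R y ^ n)"

context
  fixes y :: "'a::cbanach_algebra" assumes y: "norm y \<le> 1"
begin

lemma norm_sqrt_term: "norm (sqrt_coeff n *\<^sub>R y ^ n) \<le> \<bar>sqrt_coeff n\<bar>"
proof -
  have "norm (y ^ n) \<le> 1" using norm_power_ineq[of y n] power_le_one[OF norm_ge_zero y] order_trans by blast
  then show ?thesis by (simp add: mult_left_le)
qed

lemma summable_sqrt_terms: "summable (\<lambda>n. norm (sqrt_coeff n *\<^sub>R y ^ n))" "summable (\<lambda>n. sqrt_coeff n *\<^sub>R y ^ n)"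
proof -
  show "summable (\<lambda>n. norm (sqrt_coeff n *\<^sub>R y ^ n))"
    by (rule summable_comparison_test'[OF summable_sqrt_coeff(1)]) (use norm_sqrt_term in auto)
  then show "summable (\<lambda>n. sqrt_coeff n *\<^sub>R y ^ n)" by (rule summable_norm_cancel)
qed

lemma sqrt_one_minus_square: "sqrt_one_minus y * sqrt_one_minus y = 1 - y"
proof -
  have "(\<lambda>k. \<Sum>i\<le>k. (sqrt_coeff i *\<^sub>R y ^ i) * (sqrt_coeff (k - i) *\<^sub>R y ^ (k - i))) sums (sqrt_one_minus y * sqrt_one_minus y)"
    unfolding sqrt_one_minus_def by (rule Cauchy_product_sums) (rule summable_sqrt_terms)+
  moreover have "(\<Sum>i\<le>k. (sqrt_coeff i *\<^sub>R y ^ i) * (sqrt_coeff (k - i) *\<^sub>R y ^ (k - i)))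
      = (if k = 0 then 1 else if k = 1 then - y else 0)" for k
  proof -
    have "(\<Sum>i\<le>k. (sqrt_coeff i *\<^sub>R y ^ i) * (sqrt_coeff (k - i) *\<^sub>R y ^ (k - i)))
        = (\<Sum>i\<le>k. sqrt_coeff i * sqrt_coeff (k - i)) *\<^sub>R y ^ k"
      unfolding scaleR_sum_left by (rule sum.cong) (auto simp: power_add[symmetric])
    then show ?thesis unfolding sqrt_coeff_convolution by simp
  qed
  ultimately have "(\<lambda>k. if k = 0 then 1 else if k = 1 then - y else 0) sums (sqrt_one_minus y * sqrt_one_minus y)" by simp
  moreover have "(\<lambda>k. if k = 0 then 1 else if k = 1 then - y else 0) sums (\<Sum>k\<in>{0, 1::nat}. if k = 0 then 1 else if k = 1 then - y else 0)"
    by (rule sums_finite) auto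
  ultimately show ?thesis using sums_unique2 by fastforce
qed

lemma sqrt_one_minus_commute: assumes "x * y = y * x" shows "x * sqrt_one_minus y = sqrt_one_minus y * x"
proof -
  have c: "x * y ^ n = y ^ n * x" for n using power_commuting_commutes[of y x n] assms by simp
  have "x * sqrt_one_minus y = (\<Sum>n. x * (sqrt_coeff n *\<^sub>R y ^ n))"
    unfolding sqrt_one_minus_def by (rule suminf_mult[symmetric]) (rule summable_sqrt_terms)
  also have "\<dots> = (\<Sum>n. (sqrt_coeff n *\<^sub>R y ^ n) * x)" by (simp add: c)
  also have "\<dots> = sqrt_one_minus y * x"
    unfolding sqrt_one_minus_def by (rule suminf_mult2[symmetric]) (rule summable_sqrt_terms)
  finally show ?thesis .
qed

lemma norm_one_sub_sqrt_one_minus: "norm (1 - sqrt_one_minus y) \<le> 1"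
proof -
  have s: "summable (\<lambda>n. norm (sqrt_coeff (Suc n) *\<^sub>R y ^ Suc n))" using summable_sqrt_terms(1) by (subst summable_Suc_iff)
  have sc: "summable (\<lambda>n. \<bar>sqrt_coeff (Suc n)\<bar>)" using summable_sqrt_coeff(1) by (subst summable_Suc_iff)
  have "sqrt_one_minus y - 1 = (\<Sum>n. sqrt_coeff (Suc n) *\<^sub>R y ^ Suc n)"
    using suminf_split_head[OF summable_sqrt_terms(2)] by (simp add: sqrt_one_minus_def)
  then have "norm (sqrt_one_minus y - 1) \<le> (\<Sum>n. norm (sqrt_coeff (Suc n) *\<^sub>R y ^ Suc n))" using summable_norm[OF s] by simp
  also have "\<dots> \<le> (\<Sum>n. \<bar>sqrt_coeff (Suc n)\<bar>)" by (rule suminf_le[OF norm_sqrt_term s sc])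
  also have "\<dots> \<le> 1" by (rule summable_sqrt_coeff)
  finally show ?thesis by (simp add: norm_minus_commute)
qed

end

lemma continuous_on_sqrt_one_minus: "continuous_on (cball 0 1) (sqrt_one_minus :: 'a::cbanach_algebra \<Rightarrow> 'a)"
proof -
  have "uniform_limit (cball 0 1) (\<lambda>n (y::'a). \<Sum>i<n. sqrt_coeff i *\<^sub>R y ^ i) (\<lambda>y. \<Sum>i. sqrt_coeff i *\<^sub>R y ^ i) sequentially"
    by (rule Weierstrass_m_test[OF norm_sqrt_term summable_sqrt_coeff(1)]) auto
  then have "continuous_on (cball 0 1) (\<lambda>y::'a. \<Sum>i. sqrt_coeff i *\<^sub>R y ^ i)"
    by (rule uniform_limit_theorem[rotated]) (auto intro!: continuous_intros always_eventually)
  then show ?thesis by (simp add: sqrt_one_minus_def)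
qed

lemma is_positive_sqrt_one_minus:
  assumes "cstar y = (y::'a::cstar_algebra)" "norm y \<le> 1" shows "is_positive (sqrt_one_minus y)"
proof (rule is_positiveI_norm[of _ 1])
  have "cstar (sqrt_one_minus y) = (\<Sum>n. cstar (sqrt_coeff n *\<^sub>R y ^ n))"
    unfolding sqrt_one_minus_def by (rule bounded_linear.suminf[OF bounded_linear_cstar summable_sqrt_terms(2)[OF assms(2)]])
  then show "cstar (sqrt_one_minus y) = sqrt_one_minus y"
    by (simp add: cstar_scaleR cstar_power assms(1) sqrt_one_minus_def)
qed (use norm_one_sub_sqrt_one_minus[OF assms(2)] in simp)

text \<open>The scale \<open>K\<close> is a parameter instead of the norm of \<open>h\<close>, so
  that for fixed \<open>K\<close> a single power series serves a whole family of \<open>h\<close>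
  and depends continuously on it.\<close>

definition pos_sqrt :: "real \<Rightarrow> 'a::cbanach_algebra \<Rightarrow> 'a" where
  "pos_sqrt K h = sqrt K *\<^sub>R sqrt_one_minus (1 - (1/K) *\<^sub>R h)"

lemma pos_sqrt:
  assumes h: "is_positive (h::'a::cstar_algebra)" and K: "K > 0" "norm h \<le> K"
  shows "is_positive (pos_sqrt K h)" "pos_sqrt K h * pos_sqrt K h = h" "x * h = h * x \<Longrightarrow> x * pos_sqrt K h = pos_sqrt K h * x"
    "norm (1 - (1/K) *\<^sub>R h) \<le> 1"
proof -
  define y where "y = 1 - (1/K) *\<^sub>R h"
  have "norm (of_real 1 - (1/K) *\<^sub>R h) \<le> 1"
    by (rule is_positive_norm) (use K h in \<open>auto intro: is_positive_scaleR\<close>)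
  then show "norm (1 - (1/K) *\<^sub>R h) \<le> 1" by simp
  then have ny: "norm y \<le> 1" by (simp add: y_def)
  have sy: "cstar y = y" using is_positiveD(1)[OF h] by (simp add: y_def cstar_diff cstar_scaleR)
  have e: "pos_sqrt K h = sqrt K *\<^sub>R sqrt_one_minus y" by (simp add: pos_sqrt_def y_def)
  show "is_positive (pos_sqrt K h)" unfolding e using K by (intro is_positive_scaleR is_positive_sqrt_one_minus sy ny) auto
  show "pos_sqrt K h * pos_sqrt K h = h"
    unfolding e using K by (simp add: sqrt_one_minus_square[OF ny]) (simp add: y_def)
  show "x * pos_sqrt K h = pos_sqrt K h * x" if "x * h = h * x"
  proof -
    have "x * y = y * x" using that by (simp add: y_def algebra_simps)
    then show ?thesis unfolding e using sqrt_one_minus_commute[OF ny] by simp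
  qed
qed

lemma positive_sqrt:
  assumes h: "is_positive (h::'a::cstar_algebra)"
  obtains s where "is_positive s" "cstar s = s" "s * s = h" "\<And>x. x * h = h * x \<Longrightarrow> x * s = s * x"
proof -
  have K: "norm h + 1 > 0" "norm h \<le> norm h + 1" by (auto simp: add_nonneg_pos)
  from pos_sqrt[OF h K] show ?thesis using that is_positiveD(1) by metis
qed

lemma is_positive_conj:
  assumes h: "is_positive (h::'a::cstar_algebra)" shows "is_positive (cstar x * h * x)"
proof -
  obtain s where s: "cstar s = s" "s * s = h" using positive_sqrt[OF h] by metis
  have "cstar x * h * x = cstar (s * x) * (s * x)" by (simp add: cstar_mult s(1) mult.assoc) (simp add: s(2)[symmetric] mult.assoc)
  then show ?thesis by (simp only: is_positive_cstar_mult)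
qed

lemma positive_annihilates:
  assumes a: "is_positive (a::'a::cstar_algebra)" and x: "cstar x * a * x = 0" shows "a * x = 0"
proof -
  obtain s where s: "cstar s = s" "s * s = a" using positive_sqrt[OF a] by metis
  have "cstar (s * x) * (s * x) = cstar x * a * x" by (simp add: cstar_mult s(1) mult.assoc) (simp add: s(2)[symmetric] mult.assoc)
  then have "s * x = 0" using x cstar_mult_self_eq_0 by metis
  then show ?thesis by (simp add: s(2)[symmetric] mult.assoc)
qed

lemma positive_le_annihilates:
  assumes a: "is_positive (a::'a::cstar_algebra)" "is_positive (b - a)" and x: "cstar x * b * x = 0" shows "a * x = 0"
proof (rule positive_annihilates[OF a(1)])
  have "is_positive (cstar x * a * x)" by (rule is_positive_conj[OF a(1)])
  moreover have "is_positive (- (cstar x * a * x))"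
    using is_positive_conj[OF a(2), of x] x by (simp add: algebra_simps)
  ultimately show "cstar x * a * x = 0" by (rule is_positive_antisym)
qed

lemma strictly_positive_inv:
  assumes h: "is_positive (h - of_real d :: 'a::cstar_algebra)" and d: "d > 0"
  shows "inv_el h"
proof (rule ccontr)
  assume "\<not> inv_el h"
  then have "0 \<in> cspectrum h" by (simp add: cspectrum_iff)
  then have "- of_real d \<in> cspectrum (h - of_real d)"
    using cspectrum_shift[of "- of_real d" h "- of_real d"] by (simp add: of_real_eq_cscale)
  then show False using is_positiveD(2)[OF h] d by force
qed

lemma inverse_sqrt:
  assumes h: "is_positive (h - of_real d :: 'a::cstar_algebra)" and d: "d > 0"
  obtains k where "cstar k = k" "inv_el k" "k * h * k = 1" "\<And>x. x * h = h * x \<Longrightarrow> x * k = k * x"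
proof -
  have ih: "inv_el h" by (rule strictly_positive_inv[OF assms])
  have "is_positive ((h - of_real d) + of_real d)" using d by (intro is_positive_add h is_positive_of_real) simp
  then have ph: "is_positive h" by simp
  obtain s where s': "is_positive s" and s: "cstar s = s" "s * s = h" "\<And>x. x * h = h * x \<Longrightarrow> x * s = s * x"
    by (rule positive_sqrt[OF ph]) (rule that)
  have si: "inv_el s" using inv_el_factor[of s s] ih s(2) by simp
  show ?thesis
  proof (rule that[of "alg_inv s"])
    show "cstar (alg_inv s) = alg_inv s" using alg_inv_cstar(2)[OF si] s(1) by simp
    show "inv_el (alg_inv s)" by (rule inv_el_alg_inv[OF si])
    show "alg_inv s * h * alg_inv s = 1" using si by (simp add: s(2)[symmetric] alg_inv_cancel alg_inv mult.assoc[symmetric])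
    fix x assume "x * h = h * x"
    then have "x * s = s * x" by (rule s)
    then have "alg_inv s * (x * s) * alg_inv s = alg_inv s * (s * x) * alg_inv s" by simp
    then show "x * alg_inv s = alg_inv s * x"
      using alg_inv_cancel(2,3)[OF si] by (simp add: mult.assoc)
  qed
qed

definition cabs :: "real \<Rightarrow> 'a::cbanach_algebra \<Rightarrow> 'a" where "cabs K h = pos_sqrt (K\<^sup>2) (h * h)"

lemma cabs:
  assumes h: "cstar h = (h::'a::cstar_algebra)" and K: "K > 0" "norm h \<le> K"
  shows "is_positive (cabs K h)" "cabs K h * cabs K h = h * h" "x * h = h * x \<Longrightarrow> x * cabs K h = cabs K h * x"
    "is_positive (cabs K h + h)" "is_positive (cabs K h - h)" "(cabs K h + h) * (cabs K h - h) = 0"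
    "(cabs K h - h) * (cabs K h + h) = 0" "is_positive (h * h)" "norm (h * h) \<le> K\<^sup>2"
proof -
  have hh: "is_positive (h * h)" by (rule is_positive_square[OF h])
  show "is_positive (h * h)" by fact
  have "norm (h * h) \<le> K * K" using K by (intro order_trans[OF norm_mult_ineq] mult_mono) auto
  then have n: "norm (h * h) \<le> K\<^sup>2" by (simp add: power2_eq_square)
  show "norm (h * h) \<le> K\<^sup>2" by fact
  have K2: "K\<^sup>2 > 0" using K by simp
  define s where "s = cabs K h"
  have s: "is_positive s" "s * s = h * h" unfolding s_def cabs_def by (rule pos_sqrt[OF hh K2 n])+
  have c: "x * s = s * x" if "x * h = h * x" for x
  proof -
    have "x * (h * h) = (h * h) * x" using that by (metis mult.assoc)
    then show ?thesis unfolding s_def cabs_def using pos_sqrt(3)[OF hh K2 n] by blast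
  qed
  then have hs: "h * s = s * h" by simp
  show "is_positive (cabs K h)" "cabs K h * cabs K h = h * h" "x * h = h * x \<Longrightarrow> x * cabs K h = cabs K h * x"
    using s(1) s(2) c[of x] by (simp_all only: s_def)
  \<comment> \<open>For \<open>u = s + g\<close> the relation \<open>u * u = 2 s u\<close> makes the
    cube of \<open>u\<close> equal to \<open>2 u s u\<close>, which is positive; a real number with
    nonnegative cube is nonnegative.\<close>
  have pp: "is_positive (s + g)" if g: "cstar g = g" "g * s = s * g" "s * s = g * g" for g
  proof -
    define u where "u = s + g"
    have su: "cstar u = u" using g is_positiveD(1)[OF s(1)] by (simp add: u_def cstar_add)
    have "u * u = 2 *\<^sub>R (s * u)" using g by (simp add: u_def algebra_simps scaleR_2)
    then have "u * (u * u) = 2 *\<^sub>R (cstar u * s * u)" by (simp add: su mult.assoc)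
    then have u3: "is_positive (u * (u * u))" using is_positive_scaleR[OF is_positive_conj[OF s(1)], of 2 u] by simp
    show ?thesis unfolding u_def[symmetric]
    proof (rule is_positiveI[OF su])
      fix z assume z: "z \<in> cspectrum u"
      have zr: "z = of_real (Re z)" using selfadjoint_spectrum_real[OF su z] by (simp add: complex_eq_iff)
      have "poly [:0, 0, 0, 1:] z \<in> cspectrum (peval [:0, 0, 0, 1:] u)" using z unfolding cspectrum_peval by blast
      then have "z * (z * z) \<in> cspectrum (u * (u * u))" by simp
      then have "0 \<le> Re (z * (z * z))" by (rule is_positiveD(2)[OF u3])
      then have "0 \<le> Re z * (Re z * Re z)" by (subst (asm) (1 2 3) zr) simp
      then show "0 \<le> Re z" by (auto simp: zero_le_mult_iff mult_le_0_iff)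
    qed
  qed
  show "is_positive (cabs K h + h)" using pp[of h] h hs s by (simp add: s_def)
  show "is_positive (cabs K h - h)" using pp[of "- h"] h hs s by (simp add: s_def)
  show "(cabs K h + h) * (cabs K h - h) = 0" "(cabs K h - h) * (cabs K h + h) = 0"
    using hs s(2) by (simp_all add: s_def[symmetric] algebra_simps)
qed

lemma is_projD: "is_proj p \<Longrightarrow> cstar p = p" "is_proj p \<Longrightarrow> p * p = p" "is_proj p \<Longrightarrow> is_positive p"
  "is_proj p \<Longrightarrow> is_proj (1 - p)" "is_proj p \<Longrightarrow> norm p \<le> 1"
proof -
  show 1: "is_proj p \<Longrightarrow> cstar p = p" "is_proj p \<Longrightarrow> p * p = p" for p :: 'a by (auto simp: is_proj_def)
  show "is_proj p \<Longrightarrow> is_positive p" using 1[of p] is_positive_cstar_mult[of p] by simp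
  show "is_proj p \<Longrightarrow> is_proj (1 - p)" by (simp add: is_proj_def cstar_diff algebra_simps)
  show "norm p \<le> 1" if "is_proj p"
  proof (cases "p = 0")
    case False
    then show ?thesis using cstar_identity[of p] 1[OF that] by (simp add: power2_eq_square)
  qed simp
qed

subsection \<open>Properly infinite projections\<close>

text \<open>Two partial isometries with source \<open>p\<close> and orthogonal ranges below
  \<open>p\<close>, indexed by \<open>bool\<close>. The zero projection qualifies, which is why
  nonvanishing is stated separately where it matters.\<close>

definition properly_infinite_proj :: "'a::cstar_algebra \<Rightarrow> bool" where
  "properly_infinite_proj p \<longleftrightarrow> is_proj p \<and> (\<exists>u. \<forall>a b::bool. p * u a = u a \<and> u a * p = u a \<and>
     cstar (u a) * u b = (if a = b then p else 0))"

lemma properly_infinite_projI: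
  assumes "is_proj p" "p * u = u" "u * p = u" "p * v = v" "v * p = v" "cstar u * u = p" "cstar v * v = p" "cstar u * v = 0"
  shows "properly_infinite_proj p"
proof -
  have "cstar v * u = 0" using arg_cong[OF assms(8), of cstar] by (simp add: cstar_mult cstar_cstar)
  then show ?thesis unfolding properly_infinite_proj_def using assms
    by (intro conjI exI[of _ "\<lambda>a. if a then u else v"]) auto
qed

lemma properly_infinite_projE:
  assumes "properly_infinite_proj p"
  obtains u v where "p * u = u" "u * p = u" "p * v = v" "v * p = v"
    "cstar u * u = p" "cstar v * v = p" "cstar u * v = 0" "cstar v * u = 0"
proof -
  obtain u where "\<And>a b::bool. p * u a = u a \<and> u a * p = u a \<and> cstar (u a) * u b = (if a = b then p else 0)"
    using assms by (auto simp: properly_infinite_proj_def)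
  from this[of True] this[of False] show ?thesis by (intro that[of "u True" "u False"]) (metis (full_types))+
qed

lemma norm_partial_isometry: "is_proj (cstar v * v) \<Longrightarrow> norm v \<le> 1"
  using is_projD(5)[of "cstar v * v"] by (simp add: cstar_identity power_le_one_iff)

lemma partial_isometry_absorb:
  assumes "is_proj (cstar v * v)" shows "v * (cstar v * v) = (v::'a::cstar_algebra)"
proof -
  define p where "p = cstar v * v"
  have p: "cstar p = p" "p * p = p" using assms by (simp_all add: p_def is_projD)
  have "cstar (v * p - v) * (v * p - v) = p * (cstar v * v) * p - p * (cstar v * v) - (cstar v * v) * p + cstar v * v"
    by (simp add: cstar_diff cstar_mult p(1) algebra_simps)
  also have "\<dots> = 0" by (simp add: p_def[symmetric] p(2))
  finally have "v * p - v = 0" by (simp only: cstar_mult_self_eq_0)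
  then show ?thesis by (simp add: p_def)
qed

text \<open>The map is a *-homomorphism on the corner of \<open>r\<close> and sees \<open>z\<close>
  only through \<open>r * z * r\<close>. It is contractive by the C*-identity, since it preserves
  order and sends \<open>r\<close> to a projection.\<close>

lemma norm_sum_orthogonal_conj:
  fixes v :: "'i \<Rightarrow> 'a::cstar_algebra"
  assumes I: "finite I" and r: "is_proj r"
    and v: "\<And>i j. i \<in> I \<Longrightarrow> j \<in> I \<Longrightarrow> cstar (v i) * v j = (if i = j then r else 0)"
  shows "norm (\<Sum>i\<in>I. v i * z * cstar (v i)) \<le> norm z"
proof -
  define W where "W z = (\<Sum>i\<in>I. v i * z * cstar (v i))" for z
  have vr: "v i * r = v i" if "i \<in> I" for i using partial_isometry_absorb[of "v i"] v[OF that that] r by simp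
  have mult: "W x * W y = W (x * (r * y))" for x y
  proof -
    have "W x * W y = (\<Sum>i\<in>I. \<Sum>j\<in>I. v i * x * (cstar (v i) * v j) * y * cstar (v j))"
      by (simp add: W_def sum_product mult.assoc)
    also have "\<dots> = (\<Sum>i\<in>I. \<Sum>j\<in>I. if j = i then v i * (x * (r * y)) * cstar (v i) else 0)"
      by (intro sum.cong refl) (auto simp: v mult.assoc)
    also have "\<dots> = W (x * (r * y))" using I by (simp add: W_def)
    finally show ?thesis .
  qed
  have star: "cstar (W x) = W (cstar x)" for x
    unfolding W_def by (simp add: linear_sum[OF bounded_linear.linear[OF bounded_linear_cstar]] cstar_mult cstar_cstar mult.assoc)
  have pos: "is_positive (W x)" if "is_positive x" for x
  proof -
    have "is_positive (\<Sum>i\<in>J. v i * x * cstar (v i))" if "J \<subseteq> I" for J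
      using finite_subset[OF that I] that
    proof (induction J rule: finite_induct)
      case (insert i J)
      then show ?case using is_positive_conj[OF \<open>is_positive x\<close>, of "cstar (v i)"] by (auto simp: cstar_cstar intro: is_positive_add)
    qed simp
    then show ?thesis by (simp add: W_def)
  qed
  have Wr: "W (r * x * r) = W x" for x
    unfolding W_def
  proof (rule sum.cong[OF refl])
    fix i assume i: "i \<in> I"
    have "r * cstar (v i) = cstar (v i)" using arg_cong[OF vr[OF i], of cstar] is_projD(1)[OF r] by (simp add: cstar_mult)
    then show "v i * (r * x * r) * cstar (v i) = v i * x * cstar (v i)" by (simp add: mult.assoc mult_prefix[OF vr[OF i]])
  qed
  have "is_proj (W r)"
    unfolding is_proj_def using is_projD[OF r] by (simp add: star mult)
  then have nWr: "norm (W r) \<le> 1" by (rule is_projD(5))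
  define y where "y = r * z * r"
  have ny: "norm y \<le> norm z"
  proof -
    have "norm y \<le> norm r * norm z * norm r"
      unfolding y_def by (intro order_trans[OF norm_mult_ineq] mult_right_mono norm_mult_ineq) auto
    also have "\<dots> \<le> 1 * norm z * 1" using is_projD(5)[OF r] by (intro mult_mono) auto
    finally show ?thesis by simp
  qed
  have "(norm (W y))\<^sup>2 = norm (W (cstar y * (r * y)))" by (metis cstar_identity star mult)
  also have "r * y = y" using is_projD(2)[OF r] by (simp add: y_def mult.assoc[symmetric])
  also have "norm (W (cstar y * y)) \<le> norm (W (of_real ((norm y)\<^sup>2)))"
  proof (rule norm_mono_positive)
    show "is_positive (W (cstar y * y))" by (intro pos is_positive_cstar_mult)
    have "is_positive (W (of_real ((norm y)\<^sup>2) - cstar y * y))"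
      by (intro pos is_positive_norm_diff is_positive_cstar_mult) (simp add: cstar_identity)
    moreover have "W (a - b) = W a - W b" for a b by (simp add: W_def algebra_simps sum_subtractf)
    ultimately show "is_positive (W (of_real ((norm y)\<^sup>2)) - W (cstar y * y))" by (simp only:)
  qed
  also have "W (of_real ((norm y)\<^sup>2)) = (norm y)\<^sup>2 *\<^sub>R W r"
    using Wr[of 1] is_projD(2)[OF r] by (simp add: W_def of_real_def scaleR_sum_right)
  also have "norm \<dots> \<le> (norm y)\<^sup>2" using nWr by (simp add: mult_left_le)
  finally have "norm (W y) \<le> norm y" by (rule power2_le_imp_le) simp
  also have "W y = W z" unfolding y_def by (rule Wr)
  finally show ?thesis using ny unfolding W_def by linarith
qed

text \<open>The element \<open>s\<close> is \<open>(p - v) * y * (p + v')\<close>, where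
  \<open>p - v\<close> is idempotent and \<open>(p + v') * (p - v) = 0\<close>, hence off-diagonal.
  Its blocks on the diagonal are \<open>y\<close> and \<open>- v * y * v'\<close>, and its remaining
  two blocks are off-diagonal themselves.\<close>

lemma corner_span_block:
  fixes e :: "'a::cbanach_algebra"
  assumes p: "p * p = p" and v: "v' * v = p" "v * p = v" "p * v' = v'" "p * v = 0" "v' * p = 0"
    and e: "e * p = p" "p * e = p" "e * v = v" "v * e = v" "e * v' = v'" "v' * e = v'"
    and y: "p * y = y" "y * p = y"
  shows "y - v * y * v' \<in> span {n. corner_off_diagonal e n}"
proof -
  have z: "v * v = 0" "v' * v' = 0" "y * v = 0" "v' * y = 0"
    by (rule Peirce_zero(1)[OF v(2,4)], rule Peirce_zero(2)[OF v(5,3)], rule Peirce_zero(1)[OF y(2) v(4)],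
        rule Peirce_zero(2)[OF v(5) y(1)])
  have ye: "e * y = y" "y * e = y"
    using mult_prefix[OF e(1), of y] mult.assoc[of y p e] e(2) y by simp_all
  note r = p[THEN mult_prefix] v[THEN mult_prefix] e[THEN mult_prefix] y[THEN mult_prefix] z[THEN mult_prefix]
    ye[THEN mult_prefix]
  define s where "s = y - v * y * v' + y * v' - v * y"
  have "corner_off_diagonal e s"
    unfolding corner_off_diagonal_def off_diagonal_def
    by (intro conjI exI[of _ "p - v"]) (simp_all add: s_def algebra_simps r p v e y z ye)
  moreover have "corner_off_diagonal e (y * v')"
    unfolding corner_off_diagonal_def off_diagonal_def
    by (intro conjI exI[of _ p]) (simp_all add: algebra_simps r p v e y z ye)
  moreover have "corner_off_diagonal e (v * y)"
    unfolding corner_off_diagonal_def off_diagonal_def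
    by (intro conjI exI[of _ "v * v'"]) (simp_all add: algebra_simps r p v e y z ye)
  ultimately have "s - y * v' + v * y \<in> span {n. corner_off_diagonal e n}"
    by (intro span_add span_diff) (auto intro: span_base)
  then show ?thesis by (simp add: s_def)
qed

text \<open>Averaging over isometries with orthogonal ranges produces a map \<open>E\<close> that is congruent to the identity modulo the
  span of the off-diagonal elements, and has norm at most \<open>1/2\<close>, so that \<open>1 - E\<close> is onto.\<close>

lemma properly_infinite_corner_spanned:
  fixes p :: "'a::cstar_algebra"
  assumes P: "properly_infinite_proj p" shows "corner_spanned p"
  unfolding corner_spanned_def
proof (intro allI impI)
  fix x assume x: "p * x = x \<and> x * p = x"
  have pp: "p * p = p" "cstar p = p" using P by (auto simp: properly_infinite_proj_def is_proj_def)
  obtain u where u: "\<And>a. p * u a = u a" "\<And>a. u a * p = u a" "\<And>a b::bool. cstar (u a) * u b = (if a = b then p else 0)"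
    using P by (auto simp: properly_infinite_proj_def)
  have us: "cstar (u a) * p = cstar (u a)" "p * cstar (u a) = cstar (u a)" for a
    using arg_cong[OF u(1)[of a], of cstar] arg_cong[OF u(2)[of a], of cstar] by (simp_all add: cstar_mult pp)
  define p1 where "p1 = u True * cstar (u True)"
  define r where "r = p - p1"
  note ur = u(1)[THEN mult_prefix] u(2)[THEN mult_prefix] u(3)[THEN mult_prefix] us[THEN mult_prefix]
  have p1s: "cstar p1 = p1" by (simp add: p1_def cstar_mult cstar_cstar)
  have p1: "p1 * p1 = p1" "p * p1 = p1" "p1 * p = p1" "p1 * u True = u True" "p1 * u False = 0"
    "cstar (u True) * p1 = cstar (u True)" "cstar (u False) * p1 = 0"
    by (simp_all add: p1_def mult.assoc u us ur cstar_mult cstar_cstar)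
  have rs: "cstar r = r" by (simp add: r_def cstar_diff pp p1s)
  have r: "r * r = r" "p * r = r" "r * p = r" "r * u True = 0" "r * p1 = 0" "p1 * r = 0"
    "cstar (u True) * r = 0" "r * u False = u False" "cstar (u False) * r = cstar (u False)"
    by (simp_all add: r_def algebra_simps p1 pp cstar_diff u us)
  note pr = p1[THEN mult_prefix] r[THEN mult_prefix] pp(1)[THEN mult_prefix]
  define t :: "bool \<times> bool \<Rightarrow> 'a" where "t i = u (fst i) * u (snd i)" for i
  have t: "cstar (t i) * t j = (if i = j then p else 0)" for i j
    by (simp add: t_def cstar_mult mult.assoc u ur us prod_eq_iff)
  have tp: "p * t i = t i" "t i * p = t i" for i by (simp_all add: t_def mult.assoc u ur)
  have tps: "cstar (t i) * p = cstar (t i)" "p * cstar (t i) = cstar (t i)" for i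
    using arg_cong[OF tp(1)[of i], of cstar] arg_cong[OF tp(2)[of i], of cstar] by (simp_all add: cstar_mult pp)
  note tr = t[THEN mult_prefix] tp[THEN mult_prefix] tps[THEN mult_prefix]
  \<comment> \<open>\<open>v i\<close> maps the range of \<open>r\<close> below \<open>p1\<close>,
    and \<open>w i\<close> maps the range of \<open>p1\<close> below \<open>r\<close>; this
    orthogonality of source and range is what \<open>corner_span_block\<close> needs.\<close>
  define v where "v i = u True * t i * r" for i
  define w where "w i = u False * t i * p1" for i
  have v: "cstar (v i) * v j = (if i = j then r else 0)" and w: "cstar (w i) * w j = (if i = j then p1 else 0)" for i j
    by (simp_all add: v_def w_def cstar_mult mult.assoc u ur t tr tp tps r p1 rs p1s pr pp)
  have projs: "is_proj r" "is_proj p1" using r p1 rs p1s by (auto simp: is_proj_def)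
  \<comment> \<open>The index set has four elements, yet each sum has norm at most
    \<open>norm z\<close> because the ranges are orthogonal; dividing by four leaves norm at most
    \<open>1/2\<close>.\<close>
  define E where "E z = (1/4) *\<^sub>R ((\<Sum>i\<in>UNIV. v i * z * cstar (v i)) + (\<Sum>i\<in>UNIV. w i * z * cstar (w i)))" for z
  have lin: "E (y + z) = E y + E z" "E (c *\<^sub>R y) = c *\<^sub>R E y" for y z c
    by (simp_all add: E_def distrib_left distrib_right sum.distrib scaleR_add_right scaleR_sum_right)
  have nE: "norm (E z) \<le> norm z * (1/2)" for z
  proof -
    have "norm (E z) = (1/4) * norm ((\<Sum>i\<in>UNIV. v i * z * cstar (v i)) + (\<Sum>i\<in>UNIV. w i * z * cstar (w i)))"
      by (simp add: E_def)
    also have "\<dots> \<le> (1/4) * (norm (\<Sum>i\<in>UNIV. v i * z * cstar (v i)) + norm (\<Sum>i\<in>UNIV. w i * z * cstar (w i)))"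
      by (intro mult_left_mono norm_triangle_ineq) simp
    also have "\<dots> \<le> (1/4) * (norm z + norm z)"
      by (intro mult_left_mono add_mono norm_sum_orthogonal_conj[OF _ projs(1) v] norm_sum_orthogonal_conj[OF _ projs(2) w]) auto
    finally show ?thesis by simp
  qed
  interpret E: bounded_linear E by (rule bounded_linear_intro[OF lin nE])
  have nEn: "norm ((E ^^ n) x) \<le> norm x * (1/2) ^ n" for n
  proof (induction n)
    case (Suc n)
    have "norm ((E ^^ Suc n) x) \<le> norm ((E ^^ n) x) * (1/2)" using nE by simp
    also have "\<dots> \<le> norm x * (1/2) ^ n * (1/2)" using Suc by (intro mult_right_mono) auto
    finally show ?case by simp
  qed simp
  have "summable (\<lambda>n. norm x * (1/2) ^ n)" by (rule summable_mult) (simp add: summable_geometric)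
  then have sm: "summable (\<lambda>n. (E ^^ n) x)" by (rule summable_comparison_test') (use nEn in blast)
  \<comment> \<open>The Neumann series for the inverse of \<open>1 - E\<close>, so that
    \<open>x = y - E y\<close> is a combination of differences lying in the span.\<close>
  define y where "y = (\<Sum>n. (E ^^ n) x)"
  have "E y = (\<Sum>n. (E ^^ Suc n) x)" unfolding y_def by (simp add: E.suminf[OF sm])
  also have "\<dots> = y - x" using suminf_split_head[OF sm] by (simp add: y_def)
  finally have Ey: "x = y - E y" by simp
  have vp: "p * v i = v i" "v i * p = v i" "p * w i = w i" "w i * p = w i"
     "p * cstar (v i) = cstar (v i)" "cstar (v i) * p = cstar (v i)" "p * cstar (w i) = cstar (w i)" "cstar (w i) * p = cstar (w i)"
     for i by (simp_all add: v_def w_def cstar_mult mult.assoc u ur us r p1 rs p1s pr pp tr)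
  have "p * E y = E y" "E y * p = E y"
    by (simp_all add: E_def distrib_left distrib_right sum_distrib_left sum_distrib_right mult.assoc vp vp[THEN mult_prefix])
  then have yp: "p * y = y" "y * p = y" using x Ey by (metis (no_types, lifting) diff_add_cancel distrib_left distrib_right)+
  define Z where "Z = span {n. corner_off_diagonal p n}"
  have ry: "r * y * r - v i * y * cstar (v i) \<in> Z" for i
  proof -
    have "r * y * r - v i * (r * y * r) * cstar (v i) \<in> Z" unfolding Z_def
      by (rule corner_span_block[where p = r])
        (simp_all add: v vp r, simp_all add: v_def cstar_mult mult.assoc r rs p1s pr p1 tps tr u us ur)
    moreover have "v i * (r * y * r) * cstar (v i) = v i * y * cstar (v i)"
      by (simp add: v_def cstar_mult mult.assoc r rs p1s pr)
    ultimately show ?thesis by simp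
  qed
  have p1y: "p1 * y * p1 - w i * y * cstar (w i) \<in> Z" for i
  proof -
    have "p1 * y * p1 - w i * (p1 * y * p1) * cstar (w i) \<in> Z" unfolding Z_def
      by (rule corner_span_block[where p = p1])
        (simp_all add: w vp p1, simp_all add: w_def cstar_mult mult.assoc r rs p1s pr p1 tps tr u us ur)
    moreover have "w i * (p1 * y * p1) * cstar (w i) = w i * y * cstar (w i)"
      by (simp add: w_def cstar_mult mult.assoc p1 p1s pr)
    ultimately show ?thesis by simp
  qed
  have "corner_off_diagonal p (p1 * y * r)"
    unfolding corner_off_diagonal_def off_diagonal_def
    by (intro conjI exI[of _ p1]) (simp_all add: mult.assoc r p1 pr)
  moreover have "corner_off_diagonal p (r * y * p1)"
    unfolding corner_off_diagonal_def off_diagonal_def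
    by (intro conjI exI[of _ r]) (simp_all add: mult.assoc r p1 pr)
  moreover have "(1/4) *\<^sub>R (\<Sum>i\<in>UNIV. (r * y * r - v i * y * cstar (v i)) + (p1 * y * p1 - w i * y * cstar (w i))) \<in> Z"
    unfolding Z_def by (intro span_scale span_sum span_add) (use ry p1y in \<open>auto simp: Z_def\<close>)
  moreover have "(1/4) *\<^sub>R (\<Sum>i\<in>UNIV. (r * y * r - v i * y * cstar (v i)) + (p1 * y * p1 - w i * y * cstar (w i)))
      = r * y * r + p1 * y * p1 - E y"
  proof -
    have "(\<Sum>i\<in>(UNIV::(bool \<times> bool) set). (r * y * r - v i * y * cstar (v i)) + (p1 * y * p1 - w i * y * cstar (w i)))
      = 4 *\<^sub>R (r * y * r + p1 * y * p1) - ((\<Sum>i\<in>UNIV. v i * y * cstar (v i)) + (\<Sum>i\<in>UNIV. w i * y * cstar (w i)))"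
    proof -
      have "card (UNIV :: (bool \<times> bool) set) = 4" by (simp add: card_cartesian_product flip: UNIV_Times_UNIV)
      then have c: "(\<Sum>i\<in>(UNIV :: (bool \<times> bool) set). a) = 4 *\<^sub>R a" for a :: 'a
        by (subst sum_constant_scaleR) simp
      show ?thesis by (simp only: sum.distrib sum_subtractf c) (simp add: scaleR_add_right)
    qed
    then show ?thesis by (simp add: E_def scaleR_diff_right)
  qed
  moreover have "x = (r * y * r + p1 * y * p1 - E y) + p1 * y * r + r * y * p1"
  proof -
    have "y = p * y * p" using yp by simp
    also have "\<dots> = r * y * r + p1 * y * p1 + p1 * y * r + r * y * p1" by (simp add: r_def algebra_simps)
    finally show ?thesis using Ey by simp
  qed
  ultimately show "x \<in> span {n. corner_off_diagonal p n}"
    unfolding Z_def by (metis (no_types, lifting) mem_Collect_eq span_add span_base)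
qed

text \<open>Two isometries \<open>u\<close>, \<open>v\<close> with orthogonal ranges provide
  everything: \<open>e\<close> is the range projection of \<open>u\<close>, both corners contain
  copies of the two isometries, \<open>e\<close> is equivalent to the range projection of
  \<open>v\<close> below \<open>f = 1 - e\<close>, and \<open>f\<close> is equivalent to its image
  under \<open>u\<close> below \<open>e\<close>.\<close>

theorem weighted_jordan_properly_infinite:
  fixes T :: "'a::cstar_algebra \<Rightarrow> 'b::cbanach_algebra"
  assumes ss: "semisimple TYPE('b)" and lin: "c_linear T" and surj: "surj T" and sb: "spectrally_bounded T"
    and P: "properly_infinite_proj (1::'a)"
  shows "(\<exists>!J. jordan_epi J \<and> (\<forall>x. T x = T 1 * J x)) \<and> central (T 1) \<and> inv_el (T 1)"
proof -
  obtain M where "M \<ge> 0" "\<And>x. spectral_radius (T x) \<le> M * spectral_radius x"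
    using sb by (auto simp: spectrally_bounded_def)
  then interpret spectrally_bounded_onto T M by unfold_locales (use ss lin surj in auto)
  obtain u v :: 'a where u: "cstar u * u = 1" "cstar v * v = 1" "cstar u * v = 0" "cstar v * u = 0"
    using properly_infinite_projE[OF P] by metis
  note r = u[THEN mult_prefix]
  define e where "e = u * cstar u"
  define f where "f = 1 - e"
  have e: "is_proj e" by (simp add: is_proj_def e_def cstar_mult cstar_cstar mult.assoc r)
  have f: "is_proj f" unfolding f_def by (rule is_projD(4)[OF e])
  have "properly_infinite_proj e"
    by (rule properly_infinite_projI[OF e, of "u * u * cstar u" "u * v * cstar u"])
      (simp_all add: e_def cstar_mult cstar_cstar mult.assoc r u)
  then have Se: "corner_spanned e" by (rule properly_infinite_corner_spanned)
  have ev: "e * v = 0" "cstar v * e = 0" "e * u = u" "cstar u * e = cstar u"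
    by (simp_all add: e_def mult.assoc u r)
  have ff: "f * f = f" "cstar f = f" using is_projD[OF f] by auto
  have fv: "f * v = v" "cstar v * f = cstar v" by (simp_all add: f_def algebra_simps ev)
  note r2 = r fv[THEN mult_prefix] ff(1)[THEN mult_prefix]
  have "properly_infinite_proj f"
    by (rule properly_infinite_projI[OF f, of "v * u * f" "v * v * f"])
      (simp_all add: cstar_mult cstar_cstar mult.assoc r2 u ff)
  then have Sf: "corner_spanned (1 - e)" using properly_infinite_corner_spanned f_def by blast
  show ?thesis
  proof (rule weighted_jordan[OF lin surj square_zero, of e "u * cstar v" "v * cstar u" "f * cstar u" "u * f"])
    show "corner_spanned e" "corner_spanned (1 - e)" by (fact Se Sf)+
    have fe: "f * e = 0" "e * f = 0" using is_projD(2)[OF e] by (simp_all add: f_def algebra_simps)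
    show "e * e = e" by (rule is_projD(2)[OF e])
    show "e = u * cstar v * (v * cstar u)" by (simp add: e_def mult.assoc r)
    show "e * (u * cstar v) = u * cstar v" "u * cstar v * e = 0" "e * (v * cstar u) = 0" "v * cstar u * e = v * cstar u"
      by (simp_all add: mult.assoc ev ev[THEN mult_prefix])
    show "1 - e = f * cstar u * (u * f)" by (simp add: mult.assoc r ff) (simp add: f_def)
    show "e * (f * cstar u) = 0" "f * cstar u * e = f * cstar u" "e * (u * f) = u * f" "u * f * e = 0"
      by (simp_all add: mult.assoc ev ev[THEN mult_prefix] fe fe[THEN mult_prefix])
  qed
qed

subsection \<open>Von Neumann algebras\<close>

lemma c_functionalD:
  assumes "c_functional f"
  shows "f (x + y) = f x + f y" "f (cscale c x) = c * f x" "f (x - y) = f x - f y" "cmod (f x) \<le> fnorm f * norm x" "fnorm f \<ge> 0"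
proof -
  show 1: "f (x + y) = f x + f y" "f (cscale c x) = c * f x" for x y c using assms by (auto simp: c_functional_def)
  show "f (x - y) = f x - f y" using 1(1)[of x "-y"] 1(2)[of "-1" y] by simp
  obtain K where K: "\<And>x. cmod (f x) \<le> K * norm x" using assms by (auto simp: c_functional_def)
  have bdd: "bdd_above {cmod (f x) | x. norm x \<le> 1}"
  proof (rule bdd_aboveI[of _ "\<bar>K\<bar>"])
    fix r assume "r \<in> {cmod (f x) | x. norm x \<le> 1}"
    then obtain x where x: "r = cmod (f x)" "norm x \<le> 1" by auto
    have "cmod (f x) \<le> \<bar>K\<bar> * norm x" using K[of x] by (rule order_trans) (auto intro: mult_right_mono)
    also have "\<dots> \<le> \<bar>K\<bar> * 1" using x by (intro mult_left_mono) auto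
    finally show "r \<le> \<bar>K\<bar>" using x by simp
  qed
  have le: "cmod (f x) \<le> fnorm f" if "norm x \<le> 1" for x
    unfolding fnorm_def using that by (intro cSup_upper[OF _ bdd]) auto
  show "fnorm f \<ge> 0" using le[of 0] norm_ge_zero[of "f 0"] by (simp del: norm_ge_zero)
  show "cmod (f x) \<le> fnorm f * norm x"
  proof (cases "x = 0")
    case False
    then have "x = cscale (of_real (norm x)) ((1 / norm x) *\<^sub>R x)" by (simp add: scaleR_eq_cscale cscale_cscale)
    then have "f x = of_real (norm x) * f ((1 / norm x) *\<^sub>R x)" using 1(2) by metis
    then have "cmod (f x) = norm x * cmod (f ((1 / norm x) *\<^sub>R x))"
      by (simp only: norm_mult norm_of_real abs_norm_cancel)
    also have "\<dots> \<le> norm x * fnorm f" using False by (intro mult_left_mono le) auto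
    finally show ?thesis by (simp add: mult.commute)
  qed (use 1(2)[of 0 0] in simp)
qed

text \<open>The only consequence of the existence of a predual that is needed: closed balls have the compactness property
  of their weak* topology.\<close>

lemma von_neumann_ball_intersection:
  fixes B :: "('a::cstar_algebra \<times> real) set"
  assumes vN: "von_neumann_algebra TYPE('a)"
    and fip: "\<And>F. finite F \<Longrightarrow> F \<subseteq> B \<Longrightarrow> \<exists>x. \<forall>(c, r)\<in>F. norm (x - c) \<le> r"
  shows "\<exists>x. \<forall>(c, r)\<in>B. norm (x - c) \<le> r"
proof (cases "B = {}")
  case False
  then obtain c0 r0 where b0: "(c0, r0) \<in> B" by auto
  obtain P :: "('a \<Rightarrow> complex) set" where P0: "P \<subseteq> {f. c_functional f} \<and> (\<lambda>_. 0) \<in> P \<and>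
     (\<forall>f\<in>P. \<forall>g\<in>P. (\<lambda>x. f x + g x) \<in> P) \<and> (\<forall>c. \<forall>f\<in>P. (\<lambda>x. c * f x) \<in> P) \<and>
     (\<forall>x::'a. norm x = Sup {cmod (f x) | f. f \<in> P \<and> fnorm f \<le> 1}) \<and>
     (\<forall>\<psi> :: ('a \<Rightarrow> complex) \<Rightarrow> complex.
        (\<forall>f\<in>P. \<forall>g\<in>P. \<psi> (\<lambda>x. f x + g x) = \<psi> f + \<psi> g) \<and>
        (\<forall>c. \<forall>f\<in>P. \<psi> (\<lambda>x. c * f x) = c * \<psi> f) \<and>
        (\<exists>K. \<forall>f\<in>P. cmod (\<psi> f) \<le> K * fnorm f)
        \<longrightarrow> (\<exists>a::'a. \<forall>f\<in>P. \<psi> f = f a))"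
    using vN unfolding von_neumann_algebra_def by (rule exE)
  note P1 = P0[THEN conjunct1] and Q1 = P0[THEN conjunct2]
  note P2 = Q1[THEN conjunct1] and Q2 = Q1[THEN conjunct2]
  note P3 = Q2[THEN conjunct1] and Q3 = Q2[THEN conjunct2]
  note P4 = Q3[THEN conjunct1] and Q4 = Q3[THEN conjunct2]
  note P5 = Q4[THEN conjunct1, rule_format] and dual = Q4[THEN conjunct2, THEN spec, THEN mp]
  have P: "P \<subseteq> {f. c_functional f}" "(\<lambda>_. 0) \<in> P"
    "\<And>f g. f \<in> P \<Longrightarrow> g \<in> P \<Longrightarrow> (\<lambda>x. f x + g x) \<in> P" "\<And>c f. f \<in> P \<Longrightarrow> (\<lambda>x. c * f x) \<in> P"
    by (fact P1, fact P2, rule P3[rule_format], assumption, assumption, rule P4[rule_format], assumption)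
  have cf: "c_functional f" if "f \<in> P" for f using P(1) that by blast
  note fD = c_functionalD[OF cf]
  define R where "R = norm c0 + r0"
  \<comment> \<open>A product of discs as in Banach-Alaoglu, indexed by all functions; coordinates
    outside \<open>P\<close> are pinned to zero to keep the product compact.\<close>
  define S where "S = PiE UNIV (\<lambda>f. if f \<in> P then cball 0 (R * fnorm f) else {0::complex})"
  have "compactin (product_topology (\<lambda>_. euclidean) UNIV) S"
    unfolding S_def by (subst compactin_PiE) auto
  then have S: "compact S" by (simp add: euclidean_product_topology)
  define C where "C b = {\<psi> :: ('a \<Rightarrow> complex) \<Rightarrow> complex. \<forall>f\<in>P. cmod (\<psi> f - f (fst b)) \<le> snd b * fnorm f}" for b :: "'a \<times> real"
  define L where "L = {\<psi> :: ('a \<Rightarrow> complex) \<Rightarrow> complex. (\<forall>f\<in>P. \<forall>g\<in>P. \<psi> (\<lambda>x. f x + g x) = \<psi> f + \<psi> g) \<and> (\<forall>c. \<forall>f\<in>P. \<psi> (\<lambda>x. c * f x) = c * \<psi> f)}"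
  have ev: "continuous_on UNIV (\<lambda>\<psi> :: ('a \<Rightarrow> complex) \<Rightarrow> complex. \<psi> f)" for f by (rule continuous_on_product_coordinates)
  have "closed (C b)" for b
  proof -
    have "C b = (\<Inter>f\<in>P. {\<psi>. cmod (\<psi> f - f (fst b)) \<le> snd b * fnorm f})" by (auto simp: C_def)
    moreover have "closed {\<psi> :: ('a \<Rightarrow> complex) \<Rightarrow> complex. cmod (\<psi> f - f (fst b)) \<le> snd b * fnorm f}" for f
      by (intro closed_Collect_le continuous_intros ev)
    ultimately show ?thesis by auto
  qed
  moreover have "closed L"
  proof -
    have "L = (\<Inter>f\<in>P. \<Inter>g\<in>P. {\<psi>. \<psi> (\<lambda>x. f x + g x) = \<psi> f + \<psi> g}) \<inter> (\<Inter>c. \<Inter>f\<in>P. {\<psi>. \<psi> (\<lambda>x. c * f x) = c * \<psi> f})"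
      by (auto simp: L_def)
    moreover have "closed {\<psi> :: ('a \<Rightarrow> complex) \<Rightarrow> complex. \<psi> h = \<psi> f + \<psi> g}" "closed {\<psi> :: ('a \<Rightarrow> complex) \<Rightarrow> complex. \<psi> h = c * \<psi> f}" for f g h c
      by (intro closed_Collect_eq continuous_intros ev)+
    ultimately show ?thesis by (auto intro!: closed_Int closed_INT)
  qed
  ultimately have closed: "closed T" if "T \<in> insert L (C ` B)" for T using that by auto
  have "S \<inter> \<Inter>(insert L (C ` B)) \<noteq> {}"
  proof (rule compact_imp_fip[OF S closed])
    fix F' assume F': "finite F'" "F' \<subseteq> insert L (C ` B)"
    then have "finite (F' - {L})" "F' - {L} \<subseteq> C ` B" by auto
    then obtain F where F: "finite F" "F \<subseteq> B" "F' - {L} = C ` F" by (meson finite_subset_image)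
    \<comment> \<open>The fixed ball \<open>(c0, r0)\<close> is added to every finite subfamily, so
      that \<open>norm x\<close> is at most \<open>R\<close> and the evaluation at \<open>x\<close>
      falls into \<open>S\<close>.\<close>
    obtain x where x: "\<forall>(c, r)\<in>insert (c0, r0) F. norm (x - c) \<le> r" using fip[of "insert (c0, r0) F"] F b0 by auto
    define \<psi> where "\<psi> f = (if f \<in> P then f x else 0)" for f
    have "norm x \<le> R" using x norm_triangle_ineq[of "x - c0" c0] by (auto simp: R_def)
    then have "cmod (f x) \<le> R * fnorm f" if "f \<in> P" for f
      using fD(4)[OF that, of x] fD(5)[OF that] by (metis mult.commute mult_left_mono order_trans)
    then have "\<psi> \<in> S" by (auto simp: S_def \<psi>_def)
    moreover have "\<psi> \<in> L" using P by (auto simp: L_def \<psi>_def)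
    moreover have "\<psi> \<in> C b" if "b \<in> F" for b
      unfolding C_def
    proof (intro CollectI ballI)
      fix f assume f: "f \<in> P"
      have "cmod (\<psi> f - f (fst b)) = cmod (f (x - fst b))" using f by (simp add: \<psi>_def fD)
      also have "\<dots> \<le> fnorm f * norm (x - fst b)" by (rule fD(4)[OF f])
      also have "\<dots> \<le> fnorm f * snd b" using x that by (intro mult_left_mono fD(5)[OF f]) auto
      finally show "cmod (\<psi> f - f (fst b)) \<le> snd b * fnorm f" by (simp add: mult.commute)
    qed
    ultimately have "\<psi> \<in> S \<inter> \<Inter>F'" using F(3) by blast
    then show "S \<inter> \<Inter>F' \<noteq> {}" by blast
  qed
  then obtain \<psi> where "\<psi> \<in> S \<inter> \<Inter>(insert L (C ` B))" by blast
  then have \<psi>: "\<psi> \<in> S" "\<psi> \<in> L" "\<And>b. b \<in> B \<Longrightarrow> \<psi> \<in> C b" by blast+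
  have "\<exists>a. \<forall>f\<in>P. \<psi> f = f a"
  proof (rule dual, intro conjI exI[of _ R])
    show "\<forall>f\<in>P. cmod (\<psi> f) \<le> R * fnorm f"
    proof
      fix f assume "f \<in> P"
      then show "cmod (\<psi> f) \<le> R * fnorm f" using PiE_mem[OF \<psi>(1)[unfolded S_def], of f] by simp
    qed
  qed (use \<psi>(2) in \<open>auto simp: L_def\<close>)
  then obtain a where a: "\<And>f. f \<in> P \<Longrightarrow> \<psi> f = f a" by blast
  have "norm (a - c) \<le> r" if b: "(c, r) \<in> B" for c r
  proof -
    obtain x where "norm (x - c) \<le> r" using fip[of "{(c, r)}"] b by auto
    then have r: "r \<ge> 0" using norm_ge_zero order_trans by blast
    have z: "fnorm (\<lambda>_::'a. 0 :: complex) = 0"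
    proof -
      have "{cmod 0 | x :: 'a. norm x \<le> 1} = {0}" by (auto intro: exI[of _ 0])
      then show ?thesis unfolding fnorm_def by (simp only: cSup_singleton norm_zero)
    qed
    have "Sup {cmod (f (a - c)) | f. f \<in> P \<and> fnorm f \<le> 1} \<le> r"
    proof (rule cSup_least)
      show "{cmod (f (a - c)) | f. f \<in> P \<and> fnorm f \<le> 1} \<noteq> {}" using P(2) z by force
      fix s assume "s \<in> {cmod (f (a - c)) | f. f \<in> P \<and> fnorm f \<le> 1}"
      then obtain f where f: "s = cmod (f (a - c))" "f \<in> P" "fnorm f \<le> 1" by auto
      have "s = cmod (\<psi> f - f c)" using f a by (simp add: fD)
      also have "\<dots> \<le> r * fnorm f" using \<psi>(3)[OF b] f by (auto simp: C_def)
      also have "\<dots> \<le> r" using f r by (simp add: mult_left_le)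
      finally show "s \<le> r" .
    qed
    then show ?thesis using P5[of "a - c"] by simp
  qed
  then show ?thesis by blast
qed simp

section \<open>Cut-off powers and norm criteria for self-adjointness\<close>

lemma positive_mult_commute:
  assumes a: "is_positive a" and b: "is_positive b" and ab: "a * b = b * (a::'a::cstar_algebra)"
  shows "is_positive (a * b)"
proof -
  obtain s where "is_positive s" and s: "cstar s = s" "s * s = b" and c: "\<And>x. x * b = b * x \<Longrightarrow> x * s = s * x"
    by (rule positive_sqrt[OF b]) (rule that)
  have "a * b = cstar s * a * s" using c[OF ab] by (simp add: s(1) s(2)[symmetric] mult.assoc[symmetric])
  then show ?thesis using is_positive_conj[OF a] by simp
qed

lemma positive_power: "is_positive a \<Longrightarrow> is_positive (a ^ n :: 'a::cstar_algebra)"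
  by (induction n) (auto intro!: positive_mult_commute simp: power_commutes)

lemma norm_le_one_iff: "is_positive a \<Longrightarrow> norm a \<le> 1 \<longleftrightarrow> is_positive (1 - a :: 'a::cstar_algebra)"
  using is_positive_norm_diff[of a 1] norm_le_of_positive_diff[of a 1] by auto

text \<open>On the spectrum, Bernoulli gives
  \<open>(1 - t) ^ n * (1 + n * t) \<le> (1 - t * t) ^ n \<le> 1\<close>, hence
  \<open>t * (1 - t) ^ n \<le> 1 / n\<close>.\<close>

lemma cutoff_norm:
  assumes g: "is_positive g" "norm g \<le> 1" and n: "n > 0"
  shows "norm (g * (1 - g) ^ n * g :: 'a::cstar_algebra) \<le> 1 / real n"
proof -
  define p :: "complex poly" where "p = [:0, 1:] * [:1, -1:] ^ n * [:0, 1:]"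
  have e: "g * (1 - g) ^ n * g = peval p g" unfolding p_def peval_mult peval_power by simp
  have sg: "cstar g = g" by (rule is_positiveD(1)[OF g(1)])
  have "cstar (g * (1 - g) ^ n * g) = g * (1 - g) ^ n * g"
    by (simp add: cstar_mult cstar_power cstar_diff sg mult.assoc)
  then have "norm (g * (1 - g) ^ n * g) = spectral_radius (peval p g)" using selfadjoint_spectral_radius e by metis
  also have "\<dots> \<le> 1 / real n"
  proof (rule spectral_radius_leI)
    fix z assume "z \<in> cspectrum (peval p g)"
    then obtain w where w: "w \<in> cspectrum g" "z = poly p w" unfolding cspectrum_peval by auto
    define t where "t = Re w"
    have wt: "w = of_real t" using is_positiveD(3)[OF g(1) w(1)] by (simp add: t_def complex_eq_iff)
    have t: "0 \<le> t" "t \<le> 1" using is_positiveD(2)[OF g(1) w(1)] norm_cspectrum_le[OF w(1)] g(2) complex_Re_le_cmod[of w]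
      by (auto simp: t_def)
    have "z = of_real (t * (1 - t) ^ n * t)" unfolding w(2) p_def wt by (simp add: poly_power)
    then have "cmod z = t * (1 - t) ^ n * t" using t by (simp only: norm_of_real) simp
    also have "\<dots> \<le> t * (1 - t) ^ n * 1" using t by (intro mult_left_mono) auto
    also have "\<dots> \<le> 1 / real n"
    proof -
      have "(1 - t) ^ n * (1 + real n * t) \<le> (1 - t) ^ n * (1 + t) ^ n"
        using t Bernoulli_inequality[of t n] by (intro mult_left_mono) auto
      also have "\<dots> = (1 - t * t) ^ n" by (simp add: power_mult_distrib[symmetric] algebra_simps)
      also have "\<dots> \<le> 1" using t by (intro power_le_one) (auto simp: mult_le_one)
      finally have "(1 - t) ^ n + (1 - t) ^ n * (real n * t) \<le> 1" by (simp add: algebra_simps)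
      moreover have "0 \<le> (1 - t) ^ n" using t by simp
      ultimately have "real n * (t * (1 - t) ^ n) \<le> 1" by (simp add: mult_ac)
      then show ?thesis using n by (simp add: field_simps)
    qed
    finally show "cmod z \<le> 1 / real n" .
  qed
  finally show ?thesis .
qed

text \<open>The powers \<open>(1 - g) ^ n\<close> decrease towards the kernel projection of
  \<open>g\<close>, so a positive element below all of them lives on the kernel.\<close>

lemma cutoff_annihilates:
  assumes g: "is_positive g" "norm g \<le> 1" and a: "is_positive a" and le: "\<And>n. is_positive ((1 - g) ^ n - a)"
  shows "a * g = (0::'a::cstar_algebra)"
proof -
  have sg: "cstar g = g" by (rule is_positiveD(1)[OF g(1)])
  have "norm (g * a * g) \<le> 1 / real (Suc n)" for n
  proof -
    have "is_positive (cstar g * ((1 - g) ^ Suc n - a) * g)" by (rule is_positive_conj[OF le])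
    then have "is_positive (g * (1 - g) ^ Suc n * g - g * a * g)" by (simp add: sg algebra_simps)
    moreover have "is_positive (g * a * g)" using is_positive_conj[OF a, of g] sg by simp
    ultimately have "norm (g * a * g) \<le> norm (g * (1 - g) ^ Suc n * g)" by (intro norm_mono_positive)
    also have "\<dots> \<le> 1 / real (Suc n)" by (rule cutoff_norm[OF g]) simp
    finally show ?thesis .
  qed
  then have "norm (g * a * g) \<le> 0"
    by (intro LIMSEQ_le_const[OF LIMSEQ_Suc[OF lim_1_over_n]]) (auto simp: of_nat_Suc)
  then have "cstar g * a * g = 0" by (simp add: sg)
  then show ?thesis by (rule positive_annihilates[OF a])
qed

text \<open>Together with the next lemma: the self-adjoint part of the unit ball is an intersection
  of balls centred on the imaginary axis.\<close>

lemma selfadjoint_imaginary_shift: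
  assumes h: "cstar h = (h::'a::cstar_algebra)" "norm h \<le> 1"
  shows "norm (h - cscale (\<i> * of_real t) 1) \<le> sqrt (1 + t\<^sup>2)"
proof -
  define y where "y = h - cscale (\<i> * of_real t) 1"
  have c: "(of_real (t\<^sup>2) :: 'a) = cscale (of_real t * of_real t) 1"
    unfolding of_real_eq_cscale[of "t\<^sup>2"] by (simp add: power2_eq_square)
  have "cstar y * y = h * h + of_real (t\<^sup>2)" unfolding c
    by (simp add: y_def cstar_diff cstar_cscale h algebra_simps cscale_mult_left cscale_mult_right cscale_cscale
            cscale_add_right cscale_diff_right)
  then have "(norm y)\<^sup>2 = norm (h * h + of_real (t\<^sup>2))" by (metis cstar_identity)
  also have "\<dots> \<le> norm (h * h) + norm (of_real (t\<^sup>2) :: 'a)" by (rule norm_triangle_ineq)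
  also have "\<dots> \<le> 1 + t\<^sup>2"
    using norm_mult_ineq[of h h] h(2) mult_le_one[OF h(2) norm_ge_zero h(2)] unfolding norm_of_real by simp
  finally show ?thesis unfolding y_def by (rule real_le_rsqrt)
qed

lemma selfadjointI_imaginary_shift:
  fixes a :: "'a::cstar_algebra"
  assumes n: "\<And>t. norm (a - cscale (\<i> * of_real t) 1) \<le> sqrt (1 + t\<^sup>2)"
  shows "cstar a = a"
proof -
  define q where "q = cscale (- \<i> / 2) (a - cstar a)"
  have sq: "cstar q = q" by (simp add: q_def cstar_cscale cstar_diff cstar_cstar cscale_diff_right)
  have nq: "norm (of_real t - q) \<le> sqrt (1 + t\<^sup>2)" for t
  proof -
    define y where "y = a - cscale (\<i> * of_real t) 1"
    have "y - cstar y = (a - cstar a) - cscale (2 * \<i> * of_real t) 1"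
      by (simp add: y_def cstar_diff cstar_cscale cscale_add_left[symmetric] algebra_simps)
    then have "cscale (\<i> / 2) (y - cstar y) = of_real t - q"
      by (simp add: q_def cscale_diff_right cscale_cscale of_real_eq_cscale)
    then have "norm (of_real t - q) = norm (y - cstar y) / 2" by (metis norm_cscale norm_divide norm_ii norm_numeral times_divide_eq_left mult_1)
    also have "\<dots> \<le> norm y" using norm_triangle_ineq4[of y "cstar y"] by simp
    also have "\<dots> \<le> sqrt (1 + t\<^sup>2)" unfolding y_def by (rule n)
    finally show ?thesis .
  qed
  have "spectral_radius q \<le> 0"
  proof (rule spectral_radius_leI)
    fix z assume z: "z \<in> cspectrum q"
    define s where "s = Re z"
    have zs: "z = of_real s" using selfadjoint_spectrum_real[OF sq z] by (simp add: s_def complex_eq_iff)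
    have "s = 0"
    proof (rule ccontr)
      assume s: "s \<noteq> 0"
      \<comment> \<open>With this choice the cross term of \<open>(t - s)\<^sup>2\<close> is
        \<open>2\<close>, which exceeds the \<open>1\<close> allowed by the bound.\<close>
      define t where "t = - 1 / s"
      have "of_real t - z \<in> cspectrum (of_real t - q)" using z by (simp add: cspectrum_of_real_diff)
      then have "cmod (of_real t - z) \<le> sqrt (1 + t\<^sup>2)" using norm_cspectrum_le nq order_trans by blast
      moreover have "cmod (of_real t - z) = \<bar>t - s\<bar>" unfolding zs by (metis norm_of_real of_real_diff)
      ultimately have "\<bar>t - s\<bar>\<^sup>2 \<le> 1 + t\<^sup>2" by (metis abs_ge_zero real_sqrt_ge_abs1 real_sqrt_le_iff real_sqrt_abs real_sqrt_pow2_iff power2_abs sqrt_le_D)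
      then have "(t - s)\<^sup>2 \<le> 1 + t\<^sup>2" by simp
      moreover have "(t - s)\<^sup>2 = t\<^sup>2 + 2 + s\<^sup>2" using s by (simp add: t_def power2_eq_square algebra_simps)
      ultimately show False using zero_le_power2[of s] by linarith
    qed
    then show "cmod z \<le> 0" by (simp add: zs)
  qed
  then have "q = 0" using selfadjoint_spectral_radius[OF sq] by simp
  then show ?thesis by (simp add: q_def)
qed

section \<open>Suprema, range projections and sums of partial isometries from ball
  compactness\<close>

locale ball_compact =
  fixes ty :: "'a::cstar_algebra itself"
  assumes ball_intersection: "\<And>B :: ('a \<times> real) set. (\<And>F. finite F \<Longrightarrow> F \<subseteq> B \<Longrightarrow> \<exists>x. \<forall>(c, r)\<in>F. norm (x - c) \<le> r) \<Longrightarrow>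
     \<exists>x. \<forall>(c, r)\<in>B. norm (x - c) \<le> r"
begin

text \<open>\<open>B1\<close> encodes self-adjointness, \<open>B2\<close> the lower bounds
  \<open>h\<close>, \<open>B3\<close> the upper bounds \<open>u\<close>. Any finite subfamily is met
  by an element of \<open>D\<close> dominating the finitely many \<open>h\<close> involved, so a
  common point exists, and it is the least upper bound.\<close>

lemma directed_sup:
  fixes D :: "'a set"
  assumes ne: "D \<noteq> {}" and D: "\<And>h. h \<in> D \<Longrightarrow> is_positive h \<and> is_positive (1 - h)"
    and dir: "\<And>h k. h \<in> D \<Longrightarrow> k \<in> D \<Longrightarrow> \<exists>l\<in>D. is_positive (l - h) \<and> is_positive (l - k)"
  shows "\<exists>a. is_positive a \<and> is_positive (1 - a) \<and> (\<forall>h\<in>D. is_positive (a - h)) \<and>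
    (\<forall>u. (\<forall>h\<in>D. is_positive (u - h)) \<longrightarrow> is_positive (u - a))"
proof -
  have le_trans: "is_positive (c - a)" if "is_positive (b - a)" "is_positive (c - b)" for a b c :: 'a
    using is_positive_add[OF that] by simp
  have up: "\<exists>k\<in>D. \<forall>h\<in>H. is_positive (k - h)" if "finite H" "H \<subseteq> D" for H
    using that
  proof (induction H rule: finite_induct)
    case empty then show ?case using ne by auto
  next
    case (insert h H)
    then obtain k where k: "k \<in> D" "\<forall>h\<in>H. is_positive (k - h)" by auto
    then obtain l where "l \<in> D" "is_positive (l - h)" "is_positive (l - k)" using dir insert by blast
    then show ?case using k le_trans by blast
  qed
  define B1 where "B1 = (\<lambda>t::real. (cscale (\<i> * of_real t) (1::'a), sqrt (1 + t\<^sup>2))) ` UNIV"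
  define B2 where "B2 = (\<lambda>h. (1 + h, 1::real)) ` D"
  define B3 where "B3 = (\<lambda>u. (u - of_real (norm u + 1), norm u + 1)) ` {u. \<forall>h\<in>D. is_positive (u - h)}"
  have "\<exists>x. \<forall>(c, r)\<in>B1 \<union> B2 \<union> B3. norm (x - c) \<le> r"
  proof (rule ball_intersection)
    fix F assume F: "finite F" "F \<subseteq> B1 \<union> B2 \<union> B3"
    define H where "H = (\<lambda>h. (1 + h, 1::real)) -` F \<inter> D"
    have "finite H" unfolding H_def using F(1) by (intro finite_Int disjI1 finite_vimageI) (auto simp: inj_on_def)
    then obtain k where k: "k \<in> D" "\<And>h. h \<in> H \<Longrightarrow> is_positive (k - h)" using up[of H] by (auto simp: H_def)
    have nk: "norm k \<le> 1" using D[OF k(1)] norm_le_one_iff by blast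
    have "norm (k - c) \<le> r" if cr: "(c, r) \<in> F" for c r
    proof -
      consider "(c, r) \<in> B1" | "(c, r) \<in> B2" | "(c, r) \<in> B3" using F cr by auto
      then show ?thesis
      proof cases
        case 1
        then obtain t where "c = cscale (\<i> * of_real t) 1" "r = sqrt (1 + t\<^sup>2)" by (auto simp: B1_def)
        then show ?thesis using selfadjoint_imaginary_shift[of k t] nk D[OF k(1)] is_positiveD(1)[of k] by simp
      next
        case 2
        then obtain h where h: "h \<in> D" "c = 1 + h" "r = 1" by (auto simp: B2_def)
        then have kh: "is_positive (k - h)" using cr k(2)[of h] by (auto simp: H_def)
        have "norm (k - h) \<le> norm k" using D h(1) by (intro norm_mono_positive kh) auto
        then have "norm (of_real 1 - (k - h)) \<le> 1" using nk by (intro is_positive_norm kh) auto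
        then show ?thesis unfolding h by (metis of_real_1 norm_minus_commute diff_diff_eq diff_diff_eq2 add.commute)
      next
        case 3
        then obtain u where u: "\<And>h. h \<in> D \<Longrightarrow> is_positive (u - h)" "c = u - of_real (norm u + 1)" "r = norm u + 1" by (auto simp: B3_def)
        have uk: "is_positive (u - k)" using u k by blast
        have "norm (u - k) \<le> norm u" using D[OF k(1)] by (intro norm_mono_positive uk) auto
        then have "norm (of_real (norm u + 1) - (u - k)) \<le> norm u + 1" by (intro is_positive_norm uk) auto
        moreover have "of_real (norm u + 1) - (u - k) = k - c" by (simp add: u)
        ultimately show ?thesis by (simp only: u(3))
      qed
    qed
    then show "\<exists>x. \<forall>(c, r)\<in>F. norm (x - c) \<le> r" by blast
  qed
  then obtain a where a: "\<forall>(c, r)\<in>B1 \<union> B2 \<union> B3. norm (a - c) \<le> r" by blast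
  have aB: "norm (a - c) \<le> r" if "(c, r) \<in> B1 \<union> B2 \<union> B3" for c r using a that by blast
  have sa: "cstar a = a"
  proof (rule selfadjointI_imaginary_shift)
    fix t show "norm (a - cscale (\<i> * of_real t) 1) \<le> sqrt (1 + t\<^sup>2)" by (rule aB) (auto simp: B1_def)
  qed
  have ge: "is_positive (a - h)" if h: "h \<in> D" for h
  proof (rule is_positiveI_norm[of _ 1])
    show "cstar (a - h) = a - h" using sa D[OF h] by (simp add: cstar_diff is_positiveD)
    have "norm (a - (1 + h)) \<le> 1" by (rule aB) (use h in \<open>auto simp: B2_def\<close>)
    moreover have "of_real 1 - (a - h) = - (a - (1 + h))" by simp
    ultimately show "norm (of_real 1 - (a - h)) \<le> 1" by (metis norm_minus_cancel)
  qed
  have le: "is_positive (u - a)" if u: "\<And>h. h \<in> D \<Longrightarrow> is_positive (u - h)" for u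
  proof (rule is_positiveI_norm[of _ "norm u + 1"])
    obtain h where h: "h \<in> D" using ne by blast
    have "cstar (u - h + h) = u - h + h" using is_positiveD(1)[OF u[OF h]] is_positiveD(1)[of h] D[OF h] by (simp only: cstar_add)
    then show "cstar (u - a) = u - a" using sa by (simp add: cstar_diff)
    have "norm (a - (u - of_real (norm u + 1))) \<le> norm u + 1" by (rule aB) (use u in \<open>auto simp: B3_def\<close>)
    then show "norm (of_real (norm u + 1) - (u - a)) \<le> norm u + 1" by (simp add: algebra_simps)
  qed
  obtain h where h: "h \<in> D" using ne by blast
  have "is_positive a" using is_positive_add[OF ge[OF h], of h] D[OF h] by simp
  moreover have "is_positive (1 - a)" by (rule le) (use D in blast)
  ultimately show ?thesis using ge le by (intro exI[of _ a]) simp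
qed

text \<open>As \<open>a\<close> fixes every \<open>h\<close>, also \<open>a * a\<close> is an upper
  bound of \<open>D\<close>, so \<open>a \<le> a * a \<le> a\<close>. If all \<open>h\<close> kill
  \<open>x\<close>, then for a multiple \<open>k\<close> of \<open>x * cstar x\<close> every
  \<open>(1 - k) ^ n\<close> is an upper bound, and the cut-off lemma gives
  \<open>a * k = 0\<close>.\<close>

lemma projection_sup:
  fixes D :: "'a set"
  assumes ne: "D \<noteq> {}" and D: "\<And>h. h \<in> D \<Longrightarrow> is_positive h \<and> is_positive (1 - h)"
    and dir: "\<And>h k. h \<in> D \<Longrightarrow> k \<in> D \<Longrightarrow> \<exists>l\<in>D. is_positive (l - h) \<and> is_positive (l - k)"
    and fix_le: "\<And>h a. h \<in> D \<Longrightarrow> is_positive a \<Longrightarrow> is_positive (1 - a) \<Longrightarrow> \<forall>h\<in>D. is_positive (a - h) \<Longrightarrow> a * h = h"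
  shows "\<exists>a. is_proj a \<and> (\<forall>h\<in>D. a * h = h) \<and> (\<forall>x. (\<forall>h\<in>D. h * x = 0) \<longrightarrow> a * x = 0)"
proof -
  obtain a where a: "is_positive a" "is_positive (1 - a)" and ge: "\<forall>h\<in>D. is_positive (a - h)"
    and lub0: "\<forall>u. (\<forall>h\<in>D. is_positive (u - h)) \<longrightarrow> is_positive (u - a)"
    using directed_sup[OF ne D dir] by auto
  have lub: "is_positive (u - a)" if "\<And>h. h \<in> D \<Longrightarrow> is_positive (u - h)" for u using lub0 that by blast
  have sa: "cstar a = a" by (rule is_positiveD(1)[OF a(1)])
  have ah: "a * h = h" if "h \<in> D" for h by (rule fix_le[OF that a ge])
  have ha: "h * a = h" if "h \<in> D" for h
    using arg_cong[OF ah[OF that], of cstar] D[OF that] sa by (simp add: cstar_mult is_positiveD)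
  have "is_positive (a * (1 - a))" using a by (intro positive_mult_commute) (auto simp: algebra_simps)
  then have 1: "is_positive (a - a * a)" by (simp add: algebra_simps)
  have 2: "is_positive (a * a - a)"
  proof (rule lub)
    fix h assume h: "h \<in> D"
    have "is_positive (cstar a * (1 - h) * a)" using D[OF h] by (intro is_positive_conj) auto
    then show "is_positive (a * a - h)" using ah[OF h] ha[OF h] by (simp add: sa algebra_simps mult.assoc)
  qed
  have "a - a * a = 0" by (rule is_positive_antisym[OF 1]) (use 2 in simp)
  then have "is_proj a" using sa by (simp add: is_proj_def)
  moreover have "a * x = 0" if x: "\<And>h. h \<in> D \<Longrightarrow> h * x = 0" for x
  proof (cases "x = 0")
    case False
    define k where "k = (1 / (norm x)\<^sup>2) *\<^sub>R (x * cstar x)"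
    have k: "is_positive k" using is_positive_cstar_mult[of "cstar x"] by (auto simp: k_def cstar_cstar intro: is_positive_scaleR)
    have "norm (x * cstar x) = (norm x)\<^sup>2" using cstar_identity[of "cstar x"] by (simp add: cstar_cstar)
    then have nk: "norm k \<le> 1" using False by (simp add: k_def)
    have k1: "is_positive (1 - k)" using norm_le_one_iff[OF k] nk by blast
    have hk: "h * k = 0" "k * h = 0" if "h \<in> D" for h
    proof -
      show "h * k = 0" using x[OF that] by (simp add: k_def mult.assoc[symmetric])
      from arg_cong[OF this, of cstar] show "k * h = 0"
        using is_positiveD(1)[OF k] is_positiveD(1)[of h] D[OF that] by (simp add: cstar_mult)
    qed
    have "is_positive ((1 - k) ^ n - a)" for n
    proof (rule lub)
      fix h assume h: "h \<in> D"
      have h1: "h * (1 - k) = h" "(1 - k) * h = h" using hk[OF h] by (simp_all add: algebra_simps)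
      have "h * (1 - k) ^ m = h" for m by (induction m) (simp_all add: mult.assoc[symmetric] h1)
      moreover have "(1 - k) ^ m * h = h" for m by (induction m) (simp_all add: mult.assoc h1)
      ultimately have hn: "h * (1 - k) ^ n = h" "(1 - k) ^ n * h = h" by blast+
      have "is_positive ((1 - h) * (1 - k) ^ n)"
        using D[OF h] k1 hn by (intro positive_mult_commute positive_power) (auto simp: algebra_simps)
      then show "is_positive ((1 - k) ^ n - h)" using hn by (simp add: algebra_simps)
    qed
    then have "a * k = 0" by (rule cutoff_annihilates[OF k nk a(1)])
    then have "a * (x * cstar x) = 0" using False by (simp add: k_def)
    then have "cstar (cstar (a * x)) * cstar (a * x) = 0" by (simp add: cstar_cstar cstar_mult sa mult.assoc[symmetric])
    then show ?thesis by (simp only: cstar_mult_self_eq_0 cstar_eq_0_iff)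
  qed simp
  ultimately show ?thesis using ah by (intro exI[of _ a]) simp
qed

text \<open>The range projection is the supremum of the increasing sequence
  \<open>1 - (1 - k) ^ n\<close>, where \<open>k\<close> is \<open>g\<close> rescaled into the unit
  interval.\<close>

lemma range_projection:
  assumes g: "is_positive (g::'a)"
  shows "\<exists>e. is_proj e \<and> e * g = g \<and> (\<forall>x. g * x = 0 \<longrightarrow> e * x = 0)"
proof -
  define c where "c = 1 / (norm g + 1)"
  have c: "c > 0" by (simp add: c_def add_nonneg_pos)
  define k where "k = c *\<^sub>R g"
  have k: "is_positive k" using c g by (auto simp: k_def intro: is_positive_scaleR)
  have "norm g + 1 > 0" using norm_ge_zero[of g] by linarith
  then have nk: "norm k \<le> 1" by (simp add: k_def c_def divide_le_eq)
  have k1: "is_positive (1 - k)" using norm_le_one_iff[OF k] nk by blast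
  define d where "d n = 1 - (1 - k) ^ n" for n
  have dk: "d n = k * (\<Sum>i<n. (1 - k) ^ i)" for n using power_geometric(1)[of "1 - k" n] by (simp add: d_def)
  have inc: "is_positive (d (Suc n) - d n)" for n
  proof -
    have "is_positive ((1 - k) ^ n * k)"
      using k k1 by (intro positive_mult_commute positive_power) (auto simp: power_commuting_commutes algebra_simps)
    moreover have "d (Suc n) - d n = (1 - k) ^ n * k" by (simp add: d_def power_Suc2 algebra_simps del: power_Suc)
    ultimately show ?thesis by simp
  qed
  have mono: "is_positive (d (n + m) - d n)" for n m
  proof (induction m)
    case (Suc m)
    have "d (n + Suc m) - d n = (d (Suc (n + m)) - d (n + m)) + (d (n + m) - d n)" by simp
    then show ?case using is_positive_add[OF inc Suc] by (simp only:)
  qed simp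
  have "\<exists>e. is_proj e \<and> (\<forall>h\<in>range d. e * h = h) \<and> (\<forall>x. (\<forall>h\<in>range d. h * x = 0) \<longrightarrow> e * x = 0)"
  proof (rule projection_sup[of "range d"])
    show "is_positive h \<and> is_positive (1 - h)" if "h \<in> range d" for h
      using that mono[of 0] positive_power[OF k1] by (auto simp: d_def)
    show "\<exists>l\<in>range d. is_positive (l - h) \<and> is_positive (l - h')" if "h \<in> range d" "h' \<in> range d" for h h'
    proof -
      obtain n m where "h = d n" "h' = d m" using \<open>h \<in> range d\<close> \<open>h' \<in> range d\<close> by blast
      then show ?thesis using mono[of n m] mono[of m n] by (intro bexI[of _ "d (n + m)"]) (auto simp: add.commute)
    qed
    show "a * h = h" if h: "h \<in> range d" and a: "is_positive a" "is_positive (1 - a)" and ge: "\<forall>h\<in>range d. is_positive (a - h)" for h a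
    proof -
      have "is_positive ((1 - k) ^ n - (1 - a))" for n
      proof -
        have eq: "(1 - k) ^ n - (1 - a) = a - d n" by (simp add: d_def)
        have "is_positive (a - d n)" using ge by auto
        then show ?thesis by (simp only: eq)
      qed
      then have "(1 - a) * k = 0" by (rule cutoff_annihilates[OF k nk a(2)])
      then have "a * k = k" by (simp add: algebra_simps)
      then show ?thesis using h by (auto simp: dk mult.assoc[symmetric])
    qed
  qed auto
  then obtain e where e: "is_proj e" "\<forall>h\<in>range d. e * h = h" "\<forall>x. (\<forall>h\<in>range d. h * x = 0) \<longrightarrow> e * x = 0"
    by blast
  have "d 1 = k" by (simp add: d_def)
  moreover have "e * d 1 = d 1" using e(2) by blast
  ultimately have "e * g = g" using c by (simp add: k_def)
  moreover have "e * x = 0" if "g * x = 0" for x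
  proof -
    have "h * x = 0" if h: "h \<in> range d" for h
    proof -
      obtain n where "h = d n" using h by blast
      moreover have "k * (\<Sum>i<n. (1 - k) ^ i) = (\<Sum>i<n. (1 - k) ^ i) * k"
        using power_geometric[of "1 - k" n] by simp
      moreover have "k * x = 0" using \<open>g * x = 0\<close> by (simp add: k_def)
      ultimately show ?thesis by (simp only: dk mult.assoc mult_zero_right)
    qed
    then show ?thesis using e(3) by blast
  qed
  ultimately show ?thesis using e(1) by blast
qed

lemma projection_sum:
  fixes e :: "'i \<Rightarrow> 'a"
  assumes e: "\<And>i. i \<in> I \<Longrightarrow> is_proj (e i)" and orth: "\<And>i j. i \<in> I \<Longrightarrow> j \<in> I \<Longrightarrow> i \<noteq> j \<Longrightarrow> e i * e j = 0"
  shows "\<exists>E. is_proj E \<and> (\<forall>i\<in>I. E * e i = e i) \<and> (\<forall>x. (\<forall>i\<in>I. e i * x = 0) \<longrightarrow> E * x = 0)"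
proof -
  define s where "s F = (\<Sum>i\<in>F. e i)" for F
  define D where "D = s ` {F. finite F \<and> F \<subseteq> I}"
  have mult: "s F * s G = s (F \<inter> G)" if F: "finite F" "F \<subseteq> I" and G: "finite G" "G \<subseteq> I" for F G
  proof -
    have "s F * s G = (\<Sum>i\<in>F. \<Sum>j\<in>G. if i = j then e i else 0)"
      unfolding s_def sum_product using F G by (intro sum.cong refl) (auto simp: is_projD(2)[OF e] subset_iff intro!: orth)
    also have "\<dots> = (\<Sum>i\<in>F. if i \<in> G then e i else 0)" using G by simp
    also have "\<dots> = s (F \<inter> G)" unfolding s_def using F by (simp add: sum.inter_restrict)
    finally show ?thesis .
  qed
  have star: "cstar (s F) = s F" if "F \<subseteq> I" for F
    unfolding s_def using that is_projD(1)[OF e] by (simp add: linear_sum[OF bounded_linear.linear[OF bounded_linear_cstar]] subset_iff)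
  have proj: "is_proj (s F)" if "finite F" "F \<subseteq> I" for F unfolding is_proj_def using mult[OF that that] star that by simp
  have "\<exists>E. is_proj E \<and> (\<forall>h\<in>D. E * h = h) \<and> (\<forall>x. (\<forall>h\<in>D. h * x = 0) \<longrightarrow> E * x = 0)"
  proof (rule projection_sup[of D])
    show "D \<noteq> {}" unfolding D_def by blast
    show "is_positive h \<and> is_positive (1 - h)" if "h \<in> D" for h
      using that is_projD(3,4) proj unfolding D_def by blast
    show "\<exists>l\<in>D. is_positive (l - h) \<and> is_positive (l - k)" if hk: "h \<in> D" "k \<in> D" for h k
    proof -
      obtain F G where F: "finite F" "F \<subseteq> I" "h = s F" and G: "finite G" "G \<subseteq> I" "k = s G" using hk by (auto simp: D_def)
      have le: "is_positive (s (F \<union> G) - s F')" if "F' \<subseteq> F \<union> G" for F'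
      proof -
        have "s (F \<union> G) - s F' = s (F \<union> G - F')" unfolding s_def using F G that by (intro sum_diff[symmetric]) auto
        moreover have "is_proj (s (F \<union> G - F'))" using F G by (intro proj) auto
        ultimately show ?thesis by (simp only: is_projD(3))
      qed
      have "s (F \<union> G) \<in> D" using F G by (auto simp: D_def)
      then show ?thesis using le F G by blast
    qed
    show "a * h = h" if h: "h \<in> D" and a: "is_positive a" "is_positive (1 - a)" and ge: "\<forall>h\<in>D. is_positive (a - h)" for h a
    proof -
      have hp: "is_proj h" using h proj by (auto simp: D_def)
      have "(1 - a) * h = 0"
      proof (rule positive_le_annihilates[OF a(2), of "1 - h"])
        show "is_positive (1 - h - (1 - a))" using ge h by simp
        show "cstar h * (1 - h) * h = 0" using is_projD(1,2)[OF hp] by (simp add: algebra_simps)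
      qed
      then show ?thesis by (simp add: algebra_simps)
    qed
  qed
  then obtain E where E: "is_proj E" "\<forall>h\<in>D. E * h = h" "\<forall>x. (\<forall>h\<in>D. h * x = 0) \<longrightarrow> E * x = 0" by blast
  have "e i \<in> D" if "i \<in> I" for i unfolding D_def by (rule image_eqI[of _ _ "{i}"]) (use that in \<open>auto simp: s_def\<close>)
  then have "E * e i = e i" if "i \<in> I" for i using E(2) that by blast
  moreover have "E * x = 0" if x: "\<forall>i\<in>I. e i * x = 0" for x
  proof -
    have "\<forall>h\<in>D. h * x = 0" using x by (auto simp: D_def s_def sum_distrib_right subset_iff intro!: sum.neutral)
    then show ?thesis using E(3) by blast
  qed
  ultimately show ?thesis using E(1) by blast
qed

end

text \<open>An algebraic description of the supremum of projections. The last clause stands for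
  minimality and allows an equation involving \<open>E\<close> to be checked on the individual
  \<open>e i\<close>.\<close>

definition is_join :: "'a::cstar_algebra \<Rightarrow> ('i \<Rightarrow> 'a) \<Rightarrow> 'i set \<Rightarrow> bool" where
  "is_join E e I \<longleftrightarrow> is_proj E \<and> (\<forall>i\<in>I. E * e i = e i) \<and> (\<forall>x. (\<forall>i\<in>I. e i * x = 0) \<longrightarrow> E * x = 0)"

lemma is_joinD:
  assumes "is_join E e I"
  shows "is_proj E" "i \<in> I \<Longrightarrow> E * e i = e i" "(\<And>i. i \<in> I \<Longrightarrow> e i * x = 0) \<Longrightarrow> E * x = 0"
  using assms by (auto simp: is_join_def)

lemma is_join_right:
  assumes E: "is_join E e I" and e: "\<And>i. i \<in> I \<Longrightarrow> is_proj (e i)"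
  shows "i \<in> I \<Longrightarrow> e i * E = e i" "(\<And>i. i \<in> I \<Longrightarrow> x * e i = 0) \<Longrightarrow> x * E = 0"
proof -
  have sE: "cstar E = E" by (rule is_projD(1)[OF is_joinD(1)[OF E]])
  show "e i * E = e i" if "i \<in> I"
    using arg_cong[OF is_joinD(2)[OF E that], of cstar] is_projD(1)[OF e[OF that]] sE by (simp add: cstar_mult)
  assume x: "\<And>i. i \<in> I \<Longrightarrow> x * e i = 0"
  have "E * cstar x = 0"
  proof (rule is_joinD(3)[OF E])
    fix i assume i: "i \<in> I"
    show "e i * cstar x = 0" using arg_cong[OF x[OF i], of cstar] is_projD(1)[OF e[OF i]] by (simp add: cstar_mult)
  qed
  from arg_cong[OF this, of cstar] show "x * E = 0" by (simp add: cstar_mult cstar_cstar sE)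
qed

lemma join_absorb:
  assumes "is_join E e I" "\<And>i. i \<in> I \<Longrightarrow> is_proj (e i)" "\<And>i. i \<in> I \<Longrightarrow> p * e i = e i"
  shows "p * E = E"
  using is_join_right(2)[OF assms(1,2), of "1 - p"] assms(3) by (simp add: algebra_simps)

context ball_compact
begin

lemma join_exists:
  fixes e :: "'i \<Rightarrow> 'a"
  assumes "\<And>i. i \<in> I \<Longrightarrow> is_proj (e i)" "\<And>i j. i \<in> I \<Longrightarrow> j \<in> I \<Longrightarrow> i \<noteq> j \<Longrightarrow> e i * e j = 0"
  obtains E where "is_join E e I"
proof -
  have "\<exists>E. is_join E e I" unfolding is_join_def by (rule projection_sum[OF assms])
  then show ?thesis using that by blast
qed

text \<open>The condition \<open>V * e i = v i\<close> is not itself expressed by balls; the balls below force it because they bound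
  \<open>V - v i + \<lambda> (V - v i) e i\<close> uniformly well as \<open>\<lambda>\<close> grows.\<close>

lemma partial_isometry_sum:
  fixes v e :: "'i \<Rightarrow> 'a"
  assumes E: "is_join E e I" and e: "\<And>i. i \<in> I \<Longrightarrow> is_proj (e i)"
    and orth: "\<And>i j. i \<in> I \<Longrightarrow> j \<in> I \<Longrightarrow> i \<noteq> j \<Longrightarrow> e i * e j = 0"
    and v: "\<And>i. i \<in> I \<Longrightarrow> cstar (v i) * v i = e i"
    and vo: "\<And>i j. i \<in> I \<Longrightarrow> j \<in> I \<Longrightarrow> i \<noteq> j \<Longrightarrow> cstar (v i) * v j = 0"
  obtains V where "\<And>i. i \<in> I \<Longrightarrow> V * e i = v i" "V * E = V" "cstar V * V = E"
proof -
  have vv: "v i * e i = v i" if "i \<in> I" for i using partial_isometry_absorb[of "v i"] v[OF that] e[OF that] by simp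
  have star_sum: "cstar (\<Sum>i\<in>J. f i) = (\<Sum>i\<in>J. cstar (f i))" for f :: "'i \<Rightarrow> 'a" and J
    by (rule linear_sum[OF bounded_linear.linear[OF bounded_linear_cstar]])
  have nJ: "norm (\<Sum>i\<in>J. v i) \<le> 1" if J: "finite J" "J \<subseteq> I" for J
  proof (rule norm_partial_isometry)
    have "cstar (\<Sum>i\<in>J. v i) * (\<Sum>i\<in>J. v i) = (\<Sum>i\<in>J. \<Sum>j\<in>J. if i = j then e i else 0)"
      unfolding star_sum sum_product using J by (intro sum.cong refl) (auto simp: v subset_iff intro!: vo)
    also have "\<dots> = (\<Sum>i\<in>J. e i)" using J by simp
    finally have 1: "cstar (\<Sum>i\<in>J. v i) * (\<Sum>i\<in>J. v i) = (\<Sum>i\<in>J. e i)" .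
    have "(\<Sum>i\<in>J. e i) * (\<Sum>i\<in>J. e i) = (\<Sum>i\<in>J. \<Sum>j\<in>J. if i = j then e i else 0)"
      unfolding sum_product using J by (intro sum.cong refl) (auto simp: is_projD(2)[OF e] subset_iff intro!: orth)
    also have "\<dots> = (\<Sum>i\<in>J. e i)" using J by simp
    finally have 2: "(\<Sum>i\<in>J. e i) * (\<Sum>i\<in>J. e i) = (\<Sum>i\<in>J. e i)" .
    have 3: "cstar (\<Sum>i\<in>J. e i) = (\<Sum>i\<in>J. e i)"
      unfolding star_sum using J by (intro sum.cong refl) (auto intro: is_projD(1) e)
    show "is_proj (cstar (\<Sum>i\<in>J. v i) * (\<Sum>i\<in>J. v i))" unfolding 1 is_proj_def using 2 3 by blast
  qed
  define X where "X = {(i, b). i \<in> I \<and> b * e i = b}"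
  \<comment> \<open>The radius comes from orthogonality: if \<open>y\<close> is the sum of the other
    \<open>v j\<close>, then \<open>y * cstar b = 0\<close>, so the squared norm of
    \<open>y + b\<close> is at most \<open>1\<close> plus that of \<open>b\<close>.\<close>
  define f where "f = (\<lambda>(i, b). (v i - b, sqrt (1 + (norm b)\<^sup>2)))"
  have "\<exists>x. \<forall>(c, r)\<in>insert (0, 1) (f ` X). norm (x - c) \<le> r"
  proof (rule ball_intersection)
    fix F assume F: "finite F" "F \<subseteq> insert (0, 1) (f ` X)"
    have "finite (F - {(0, 1)})" "F - {(0, 1)} \<subseteq> f ` X" using F by auto
    then obtain X' where X': "X' \<subseteq> X" "finite X'" "F - {(0, 1)} = f ` X'" by (metis finite_subset_image)
    define J where "J = fst ` X'"
    have J: "finite J" "J \<subseteq> I" using X' by (auto simp: J_def X_def)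
    have "norm ((\<Sum>i\<in>J. v i) - c) \<le> r" if cr: "(c, r) \<in> F" for c r
    proof (cases "(c, r) = (0, 1)")
      case True
      then show ?thesis using nJ[OF J] by simp
    next
      case False
      then have "(c, r) \<in> f ` X'" using cr X' by blast
      then obtain i b where ib: "(i, b) \<in> X'" "c = v i - b" "r = sqrt (1 + (norm b)\<^sup>2)" by (auto simp: f_def)
      have i: "i \<in> J" "i \<in> I" and b: "b * e i = b" using ib X' by (auto simp: J_def X_def intro: rev_image_eqI)
      define y where "y = (\<Sum>j\<in>J - {i}. v j)"
      have ny: "norm y \<le> 1" unfolding y_def by (rule nJ) (use J in auto)
      have "v j * e i = 0" if "j \<in> J - {i}" for j
        using vv[of j] orth[of j i] that J i by (metis DiffD1 DiffD2 in_mono mult.assoc mult_zero_right singletonI)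
      then have ye: "y * e i = 0" by (simp add: y_def sum_distrib_right)
      have bs: "e i * cstar b = cstar b" using arg_cong[OF b, of cstar] is_projD(1)[OF e[OF i(2)]] by (simp add: cstar_mult)
      then have yb: "y * cstar b = 0" using ye mult.assoc[of y "e i" "cstar b"] by simp
      have by': "b * cstar y = 0" using arg_cong[OF yb, of cstar] by (simp add: cstar_mult cstar_cstar)
      have "(norm (y + b))\<^sup>2 = norm (cstar (cstar (y + b)) * cstar (y + b))" by (metis cstar_identity norm_cstar)
      also have "cstar (cstar (y + b)) * cstar (y + b) = y * cstar y + b * cstar b"
        by (simp add: cstar_cstar cstar_add algebra_simps yb by')
      also have "norm \<dots> \<le> norm y * norm y + norm b * norm b"
        by (intro order_trans[OF norm_triangle_ineq] add_mono order_trans[OF norm_mult_ineq]) (auto simp: norm_cstar)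
      also have "\<dots> \<le> 1 + (norm b)\<^sup>2" using mult_le_one[OF ny norm_ge_zero ny] by (simp add: power2_eq_square)
      finally have "norm (y + b) \<le> r" unfolding ib by (rule real_le_rsqrt)
      moreover have "(\<Sum>j\<in>J. v j) - c = y + b" unfolding ib y_def using J i by (simp add: sum.remove[of J i])
      ultimately show ?thesis by simp
    qed
    then show "\<exists>x. \<forall>(c, r)\<in>F. norm (x - c) \<le> r" by blast
  qed
  then obtain x where x: "\<forall>(c, r)\<in>insert (0, 1) (f ` X). norm (x - c) \<le> r" by blast
  have nx: "norm x \<le> 1" using x by simp
  have xe: "x * e i = v i" if i: "i \<in> I" for i
  proof -
    define d where "d = (x - v i) * e i"
    have ee: "e i * e i = e i" by (rule is_projD(2)[OF e[OF i]])
    have de: "d * e i = d" by (simp add: d_def mult.assoc ee)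
    have "(1 + 2 * l) * (norm d)\<^sup>2 \<le> 1" if l: "l \<ge> 0" for l :: real
    proof -
      have "(i, l *\<^sub>R d) \<in> X" using i de by (simp add: X_def)
      then have "f (i, l *\<^sub>R d) \<in> insert (0, 1) (f ` X)" by blast
      then have "(\<lambda>(c, r). norm (x - c) \<le> r) (f (i, l *\<^sub>R d))" using x by (rule bspec[rotated])
      then have n: "norm (x - v i + l *\<^sub>R d) \<le> sqrt (1 + (norm (l *\<^sub>R d))\<^sup>2)" by (simp add: f_def diff_diff_eq2 algebra_simps)
      have "(x - v i + l *\<^sub>R d) * e i = (1 + l) *\<^sub>R d" using de by (simp add: distrib_right d_def scaleR_add_left)
      then have "norm ((1 + l) *\<^sub>R d) = norm ((x - v i + l *\<^sub>R d) * e i)" by simp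
      also have "\<dots> \<le> norm (x - v i + l *\<^sub>R d) * 1"
        by (rule order_trans[OF norm_mult_ineq]) (intro mult_left_mono is_projD(5)[OF e[OF i]] norm_ge_zero)
      finally have "(1 + l) * norm d \<le> sqrt (1 + (l * norm d)\<^sup>2)" using n l by simp
      then have "((1 + l) * norm d)\<^sup>2 \<le> (sqrt (1 + (l * norm d)\<^sup>2))\<^sup>2" using l by (intro power_mono) auto
      then have "((1 + l) * norm d)\<^sup>2 \<le> 1 + (l * norm d)\<^sup>2" by simp
      then show ?thesis by (simp add: power2_eq_square algebra_simps)
    qed
    note bound = this
    have "d = 0"
    proof (rule ccontr)
      assume "d \<noteq> 0"
      then have p: "(norm d)\<^sup>2 > 0" by simp
      then have "(1 + 2 * (1 / (norm d)\<^sup>2)) * (norm d)\<^sup>2 \<le> 1" by (intro bound) simp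
      moreover have "(1 + 2 * (1 / (norm d)\<^sup>2)) * (norm d)\<^sup>2 = (norm d)\<^sup>2 + 2" using p by (simp add: distrib_right)
      ultimately show False using p by linarith
    qed
    then show ?thesis using vv[OF i] by (simp add: d_def algebra_simps)
  qed
  define V where "V = x * E"
  have EE: "E * E = E" "cstar E = E" using is_projD[OF is_joinD(1)[OF E]] by auto
  have VE: "V * E = V" by (simp add: V_def mult.assoc EE)
  have Ve: "V * e i = v i" if "i \<in> I" for i using is_joinD(2)[OF E that] xe[OF that] by (simp add: V_def mult.assoc)
  \<comment> \<open>The defect is positive because \<open>x\<close> is a contraction, and each
    \<open>e i\<close> compresses it to zero; a positive element with zero compression is
    annihilated.\<close>
  define a where "a = E - cstar V * V"
  have "norm (cstar x * x) \<le> 1" using nx by (simp add: cstar_identity power_le_one)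
  then have "is_positive (1 - cstar x * x)" using norm_le_one_iff[OF is_positive_cstar_mult] by blast
  from is_positive_conj[OF this, of E] have a: "is_positive a" by (simp add: a_def V_def cstar_mult EE algebra_simps)
  have "a * e i = 0" if i: "i \<in> I" for i
  proof (rule positive_annihilates[OF a])
    have "cstar (e i) = e i" "e i * e i = e i" using is_projD[OF e[OF i]] by auto
    moreover have "cstar (e i) * (cstar V * V) * e i = cstar (V * e i) * (V * e i)" by (simp add: cstar_mult mult.assoc)
    ultimately show "cstar (e i) * a * e i = 0"
      unfolding Ve[OF i] v[OF i] by (simp add: a_def algebra_simps is_joinD(2)[OF E i])
  qed
  then have "a * E = 0" by (intro is_join_right(2)[OF E e])
  moreover have "a * E = a" by (simp add: a_def left_diff_distrib EE mult.assoc VE)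
  ultimately have "cstar V * V = E" by (simp add: a_def)
  then show ?thesis using Ve VE that by blast
qed

text \<open>The partial isometries of the pieces are glued separately for each truth value.
  Orthogonality of the two glued ranges is tested by compressing \<open>w\<close> between
  pieces.\<close>

lemma properly_infinite_join:
  fixes e :: "'i \<Rightarrow> 'a" and u :: "bool \<Rightarrow> 'i \<Rightarrow> 'a"
  assumes E: "is_join E e I" and e: "\<And>i. i \<in> I \<Longrightarrow> is_proj (e i)"
    and orth: "\<And>i j. i \<in> I \<Longrightarrow> j \<in> I \<Longrightarrow> i \<noteq> j \<Longrightarrow> e i * e j = 0"
    and u: "\<And>a b i j. i \<in> I \<Longrightarrow> j \<in> I \<Longrightarrow> cstar (u a i) * u b j = (if a = b \<and> i = j then e i else 0)"
    and Eu: "\<And>a i. i \<in> I \<Longrightarrow> E * u a i = u a i"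
  shows "properly_infinite_proj E"
proof -
  have "\<exists>V. (\<forall>i\<in>I. V * e i = u a i) \<and> V * E = V \<and> cstar V * V = E" for a
  proof -
    obtain V where "\<And>i. i \<in> I \<Longrightarrow> V * e i = u a i" "V * E = V" "cstar V * V = E"
      by (rule partial_isometry_sum[OF E e orth, of "u a"]) (auto simp: u)
    then show ?thesis by blast
  qed
  then obtain V where V: "\<And>a i. i \<in> I \<Longrightarrow> V a * e i = u a i" "\<And>a. V a * E = V a" "\<And>a. cstar (V a) * V a = E" by metis
  have sE: "cstar E = E" by (rule is_projD(1)[OF is_joinD(1)[OF E]])
  have EV: "E * V a = V a" for a
  proof -
    have "((1 - E) * V a) * E = 0" by (rule is_join_right(2)[OF E e]) (simp_all add: mult.assoc V(1) Eu algebra_simps)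
    then show ?thesis by (simp add: mult.assoc V(2)) (simp add: algebra_simps)
  qed
  define w where "w = cstar (V True) * V False"
  have Ew: "E * w = w" using arg_cong[OF V(2)[of True], of cstar] by (simp add: w_def cstar_mult sE mult.assoc[symmetric])
  have wE: "w * E = w" by (simp add: w_def mult.assoc V(2))
  have "w * e j = 0" if j: "j \<in> I" for j
  proof -
    have "E * (w * e j) = 0"
    proof (rule is_joinD(3)[OF E])
      fix i assume i: "i \<in> I"
      have "e i * (w * e j) = cstar (V True * e i) * (V False * e j)"
        using is_projD(1)[OF e[OF i]] by (simp add: w_def cstar_mult mult.assoc)
      then show "e i * (w * e j) = 0" using u[OF i j, of True False] V(1) i j by simp
    qed
    then show ?thesis by (simp add: mult.assoc[symmetric] Ew)
  qed
  then have "w * E = 0" by (intro is_join_right(2)[OF E e])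
  then have "w = 0" by (simp add: wE)
  then show ?thesis
    by (intro properly_infinite_projI[OF is_joinD(1)[OF E], of "V True" "V False"]) (simp_all add: V(2,3) EV w_def)
qed

text \<open>A truncated polar decomposition: \<open>e\<close> is the spectral projection of
  \<open>cstar x * x\<close> above \<open>\<epsilon>\<close>, where the modulus is invertible and
  \<open>x\<close> can be normalised. The factorisations of \<open>v\<close> and \<open>e\<close>
  through \<open>x\<close> transfer one-sided annihilation properties of \<open>x\<close> to
  them.\<close>

lemma polar_projection:
  assumes x: "x \<noteq> (0::'a)"
  shows "\<exists>e v w y. is_proj e \<and> v \<noteq> 0 \<and> cstar v * v = e \<and> v = x * w \<and> e = y * (cstar x * x)"
proof -
  define \<alpha> where "\<alpha> = cstar x * x"
  \<comment> \<open>Half the norm is a threshold that \<open>\<alpha>\<close> exceeds, which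
    guarantees \<open>e \<noteq> 0\<close>.\<close>
  define \<epsilon> where "\<epsilon> = norm \<alpha> / 2"
  have \<alpha>: "is_positive \<alpha>" unfolding \<alpha>_def by (rule is_positive_cstar_mult)
  have "norm \<alpha> > 0" using x by (simp add: \<alpha>_def cstar_identity)
  then have \<epsilon>: "\<epsilon> > 0" "norm \<alpha> > \<epsilon>" by (simp_all add: \<epsilon>_def)
  define h where "h = \<alpha> - of_real \<epsilon>"
  have sh: "cstar h = h" using is_positiveD(1)[OF \<alpha>] by (simp add: h_def cstar_diff cstar_of_real)
  define K where "K = norm h + 1"
  have K: "K > 0" "norm h \<le> K" using norm_ge_zero[of h] by (simp_all add: K_def del: norm_ge_zero)
  define s where "s = cabs K h"
  define g where "g = s + h"
  have g: "is_positive g" and gz: "g * (s - h) = 0" using cabs(4,6)[OF sh K] by (simp_all add: g_def s_def)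
  obtain e where e: "is_proj e" "e * g = g" and ez: "\<And>x. g * x = 0 \<Longrightarrow> e * x = 0" using range_projection[OF g] by blast
  have se: "cstar e = e" "e * e = e" using is_projD[OF e(1)] by auto
  have "e * (s - h) = 0" by (rule ez[OF gz])
  then have es: "e * s = e * h" by (simp add: right_diff_distrib)
  have eh: "e * h + e * h = g" using e(2) es by (simp add: g_def distrib_left)
  have he: "h * e + h * e = g"
    using arg_cong[OF eh, of cstar] is_positiveD(1)[OF g] by (simp add: cstar_add cstar_mult se sh)
  have "2 *\<^sub>R (e * h) = 2 *\<^sub>R (h * e)" using eh he by (simp add: scaleR_2)
  then have eh': "e * h = h * e" by simp
  have e\<alpha>: "e * \<alpha> = \<alpha> * e" using eh' by (simp add: h_def algebra_simps of_real_def)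
  have e0: "e \<noteq> 0"
  proof
    assume "e = 0"
    then have "g = 0" using e(2) by simp
    then have "of_real \<epsilon> - \<alpha> = s" by (simp add: g_def h_def algebra_simps eq_neg_iff_add_eq_0)
    then have "is_positive (of_real \<epsilon> - \<alpha>)" using cabs(1)[OF sh K] by (simp add: s_def)
    then have "norm \<alpha> \<le> norm (of_real \<epsilon> :: 'a)" by (rule norm_mono_positive[OF \<alpha>])
    then show False using \<epsilon> by simp
  qed
  \<comment> \<open>Adding \<open>1 - e\<close> makes the part of \<open>\<alpha>\<close> above the
    threshold invertible in the whole algebra, so that its inverse square root is available.\<close>
  define m where "m = \<alpha> * e + (1 - e)"
  define d where "d = min \<epsilon> 1"
  have d: "d > 0" "d \<le> \<epsilon>" "d \<le> 1" using \<epsilon> by (auto simp: d_def)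
  have "m - of_real d = (1/2) *\<^sub>R g + ((\<epsilon> - d) *\<^sub>R e + (1 - d) *\<^sub>R (1 - e))"
  proof -
    have "(1/2) *\<^sub>R g = \<alpha> * e - \<epsilon> *\<^sub>R e"
      unfolding he[symmetric] by (simp add: h_def left_diff_distrib of_real_def flip: scaleR_2)
    then show ?thesis by (simp add: m_def algebra_simps of_real_def)
  qed
  moreover have "is_positive ((1/2) *\<^sub>R g + ((\<epsilon> - d) *\<^sub>R e + (1 - d) *\<^sub>R (1 - e)))"
    using g d is_projD(3)[OF e(1)] is_projD(3)[OF is_projD(4)[OF e(1)]] by (intro is_positive_add is_positive_scaleR) auto
  ultimately have "is_positive (m - of_real d)" by (simp only:)
  then obtain k where k: "cstar k = k" "inv_el k" "k * m * k = 1" and kc: "\<And>y. y * m = m * y \<Longrightarrow> y * k = k * y"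
    by (rule inverse_sqrt[OF _ d(1)]) (rule that)
  have me: "m * e = \<alpha> * e" by (simp add: m_def algebra_simps se)
  have em: "e * m = \<alpha> * e" by (simp add: m_def distrib_left right_diff_distrib se e\<alpha>[THEN mult_prefix] mult.assoc)
  have ek: "e * k = k * e" by (rule kc) (simp add: me em)
  have "\<alpha> * m = m * \<alpha>" by (simp add: m_def algebra_simps e\<alpha>)
  then have \<alpha>k: "\<alpha> * k = k * \<alpha>" by (rule kc)
  have kek: "k * (\<alpha> * e) * k = e"
  proof -
    have "k * (\<alpha> * e) * k = k * m * e * k" by (simp add: me[symmetric] mult.assoc)
    also have "\<dots> = k * m * k * e" by (simp add: mult.assoc ek)
    finally show ?thesis by (simp add: k)
  qed
  define v where "v = x * (e * k)"
  have "cstar v * v = k * (e * (\<alpha> * e)) * k" by (simp add: v_def cstar_mult se k \<alpha>_def mult.assoc)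
  also have "e * (\<alpha> * e) = \<alpha> * e" by (simp add: mult.assoc[symmetric] e\<alpha>) (simp add: mult.assoc se)
  finally have ve: "cstar v * v = e" by (simp add: kek)
  moreover have "v \<noteq> 0" using ve e0 by auto
  moreover have "e = (k * k * e) * \<alpha>"
  proof -
    have "(k * k * e) * \<alpha> = k * (k * \<alpha>) * e" by (simp add: mult.assoc e\<alpha>)
    also have "\<dots> = k * \<alpha> * (k * e)" by (metis \<alpha>k mult.assoc)
    also have "\<dots> = k * (\<alpha> * e) * k" by (simp add: ek[symmetric] mult.assoc)
    finally show ?thesis by (simp add: kek)
  qed
  ultimately show ?thesis using e(1) by (intro exI[of _ e] exI[of _ v] exI[of _ "e * k"] exI[of _ "k * k * e"]) (simp add: v_def \<alpha>_def)
qed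

end

section \<open>Comparison of projections and proper infiniteness of the unit\<close>

lemma ex_maximal_orthogonal:
  "\<exists>W. (\<forall>x\<in>W. P x) \<and> (\<forall>x\<in>W. \<forall>y\<in>W. x \<noteq> y \<longrightarrow> R x y) \<and> (\<forall>z. P z \<longrightarrow> (\<forall>x\<in>W. R x z \<and> R z x) \<longrightarrow> z \<in> W)"
proof -
  define \<A> where "\<A> = {W. (\<forall>x\<in>W. P x) \<and> (\<forall>x\<in>W. \<forall>y\<in>W. x \<noteq> y \<longrightarrow> R x y)}"
  have "\<Union>\<C> \<in> \<A>" if C: "subset.chain \<A> \<C>" for \<C>
  proof -
    have "R x y" if xy: "x \<in> \<Union>\<C>" "y \<in> \<Union>\<C>" "x \<noteq> y" for x y
    proof -
      obtain X Y where XY: "X \<in> \<C>" "Y \<in> \<C>" "x \<in> X" "y \<in> Y" using xy by blast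
      then have "X \<subseteq> Y \<or> Y \<subseteq> X" using C by (auto simp: subset.chain_def)
      moreover have "X \<in> \<A>" "Y \<in> \<A>" using C XY by (auto simp: subset.chain_def)
      ultimately show ?thesis using XY xy(3) by (auto simp: \<A>_def)
    qed
    moreover have "P x" if "x \<in> \<Union>\<C>" for x using that C by (auto simp: subset.chain_def \<A>_def)
    ultimately show ?thesis by (simp add: \<A>_def)
  qed
  then obtain W where W: "W \<in> \<A>" and max: "\<And>X. X \<in> \<A> \<Longrightarrow> W \<subseteq> X \<Longrightarrow> X = W"
    using subset_Zorn'[of \<A>] by auto
  have "z \<in> W" if "P z" "\<forall>x\<in>W. R x z \<and> R z x" for z
  proof -
    have "insert z W \<in> \<A>" using W that by (auto simp: \<A>_def)
    then show ?thesis using max by blast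
  qed
  then show ?thesis using W by (intro exI[of _ W]) (auto simp: \<A>_def)
qed

text \<open>\<open>g\<close> is central in the corner of \<open>p\<close>, so the isometries of
  \<open>p\<close> can be cut down to \<open>g\<close>; the equivalence \<open>v\<close> then
  carries them over to \<open>f\<close>.\<close>

lemma properly_infinite_transfer:
  assumes p: "properly_infinite_proj p" and v: "cstar v * v = f" "v * cstar v = g"
    and g: "is_proj g" "p * g = g" and gu: "\<And>a. p * a = a \<Longrightarrow> a * p = a \<Longrightarrow> g * a = a * g"
  shows "properly_infinite_proj f"
proof -
  obtain u w where u: "p * u = u" "u * p = u" "p * w = w" "w * p = w"
    "cstar u * u = p" "cstar w * w = p" "cstar u * w = 0" using p by (rule properly_infinite_projE)
  have g2: "g * g = g" "cstar g = g" using is_projD[OF g(1)] by auto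
  have vg': "cstar v * g = cstar v"
    using partial_isometry_absorb[of "cstar v"] g(1) by (simp add: cstar_cstar v(2))
  have gv: "g * v = v" using arg_cong[OF vg', of cstar] g2 by (simp add: cstar_mult cstar_cstar)
  have ff: "f * f = f" using gv by (simp add: v(1)[symmetric] mult.assoc mult_prefix[OF v(2)])
  have fs: "cstar f = f" by (simp add: v(1)[symmetric] cstar_mult cstar_cstar)
  have vf: "v * f = v" using gv by (simp add: v(1)[symmetric] mult_prefix[OF v(2)])
  have fv: "f * cstar v = cstar v" using arg_cong[OF vf, of cstar] by (simp add: cstar_mult fs)
  have gu': "g * u = u * g" "g * w = w * g" using gu u by auto
  note r = v[THEN mult_prefix] g2(1)[THEN mult_prefix] vg'[THEN mult_prefix] gv[THEN mult_prefix] gu'[THEN mult_prefix] u[THEN mult_prefix]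
    vf[THEN mult_prefix] fv[THEN mult_prefix] g(2)[THEN mult_prefix]
  have pv: "p * v = v" using g(2) gv by (metis mult.assoc)
  show ?thesis
    by (rule properly_infinite_projI[of f "cstar v * u * v" "cstar v * w * v"])
      (simp_all add: is_proj_def ff fs cstar_mult cstar_cstar mult.assoc r vf fv v gv gu' pv)
qed

context ball_compact
begin

text \<open>\<open>R\<close>, the set of \<open>x\<close> with \<open>q * a * x = 0\<close> for all
  \<open>a\<close>, is a two-sided ideal containing \<open>s\<close>. The join \<open>c\<close> of a
  maximal orthogonal family of its projections acts as a left unit on it: a leftover would contain
  another projection of \<open>R\<close>. A self-adjoint left unit of a two-sided ideal that belongs
  to the ideal is central.\<close>

lemma central_annihilator:
  assumes s: "s \<noteq> (0::'a)" and qs: "\<And>a. q * a * s = 0"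
  obtains c :: 'a where "is_proj c" "central c" "c \<noteq> 0" "c * s = s" "q * c = 0"
proof -
  define R where "R = {x. \<forall>a. q * a * x = 0}"
  have Rl: "b * x \<in> R" if "x \<in> R" for b x unfolding R_def mem_Collect_eq
  proof
    fix a show "q * a * (b * x) = 0" using that[unfolded R_def mem_Collect_eq, THEN spec, of "a * b"] by (simp only: mult.assoc)
  qed
  have Rr: "x * b \<in> R" if "x \<in> R" for b x unfolding R_def mem_Collect_eq
  proof
    fix a show "q * a * (x * b) = 0"
      using that[unfolded R_def mem_Collect_eq, THEN spec, of a] by (simp only: mult.assoc[symmetric] mult_zero_left)
  qed
  obtain C where C: "\<forall>e\<in>C. is_proj e \<and> e \<noteq> 0 \<and> e \<in> R" "\<forall>x\<in>C. \<forall>y\<in>C. x \<noteq> y \<longrightarrow> x * y = 0"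
     "\<forall>z. (is_proj z \<and> z \<noteq> 0 \<and> z \<in> R) \<longrightarrow> (\<forall>x\<in>C. x * z = 0 \<and> z * x = 0) \<longrightarrow> z \<in> C"
    using ex_maximal_orthogonal[of "\<lambda>e. is_proj e \<and> e \<noteq> 0 \<and> e \<in> R" "\<lambda>x y. x * y = 0"]
    by (elim exE conjE) (rule that)
  have Cp: "is_proj e" if "e \<in> C" for e using C(1) that by blast
  obtain c where c: "is_join c (\<lambda>e. e) C" by (rule join_exists[of C "\<lambda>e. e"]) (use C(1,2) in blast)+
  have cp: "is_proj c" by (rule is_joinD(1)[OF c])
  have cc: "cstar c = c" "c * c = c" using is_projD[OF cp] by auto
  have cR: "c \<in> R" unfolding R_def mem_Collect_eq
  proof
    fix a show "q * a * c = 0"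
      by (rule is_join_right(2)[OF c Cp]) (use C(1) in \<open>auto simp: R_def\<close>)
  qed
  have cx: "c * x = x" if x: "x \<in> R" for x
  proof (rule ccontr)
    assume "c * x \<noteq> x"
    define y where "y = (1 - c) * x"
    have "y \<noteq> 0" using \<open>c * x \<noteq> x\<close> by (simp add: y_def algebra_simps)
    then have "cstar y \<noteq> 0" by simp
    from polar_projection[OF this] obtain e v w z where e: "is_proj e" "v \<noteq> 0" "cstar v * v = e" "e = z * (y * cstar y)"
      by (auto simp: cstar_cstar)
    have "y \<in> R" unfolding y_def by (rule Rl[OF x])
    then have eR: "e \<in> R" unfolding e(4) by (intro Rl Rr)
    have "c * y = 0" by (simp add: y_def algebra_simps mult.assoc[symmetric] cc)
    from arg_cong[OF this, of cstar] have "cstar y * c = 0" by (simp add: cstar_mult cc)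
    then have ec: "e * c = 0" by (simp add: e(4) mult.assoc)
    from arg_cong[OF this, of cstar] have ce: "c * e = 0" using is_projD(1)[OF e(1)] by (simp add: cstar_mult cc)
    have e0: "e \<noteq> 0" using e(2) cstar_mult_self_eq_0[of v] e(3) by metis
    have eorth: "f * e = 0 \<and> e * f = 0" if f: "f \<in> C" for f
    proof -
      have "f * e = (f * c) * e" using is_join_right(1)[OF c Cp f] by simp
      then have "f * e = 0" by (simp add: mult.assoc ce)
      moreover have "e * f = e * (c * f)" using is_joinD(2)[OF c f] by simp
      then have "e * f = 0" by (simp add: mult.assoc[symmetric] ec)
      ultimately show ?thesis by blast
    qed
    have "e \<in> C" using C(3) e(1) eR e0 eorth by blast
    then have "c * e = e" by (rule is_joinD(2)[OF c])
    then show False using ce e0 by simp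
  qed
  have cbc: "c * (b * c) = b * c" for b by (rule cx[OF Rl[OF cR]])
  have "central c" unfolding central_def
  proof
    fix b
    have "c * b * c = c * b" using arg_cong[OF cbc[of "cstar b"], of cstar] by (simp add: cstar_mult cstar_cstar cc)
    then show "c * b = b * c" using cbc[of b] by (simp add: mult.assoc)
  qed
  moreover have cs: "c * s = s" by (rule cx) (use qs in \<open>simp add: R_def\<close>)
  moreover have "c \<noteq> 0" using cs s by auto
  moreover have "q * c = 0" using cR by (auto simp: R_def dest: spec[of _ 1])
  ultimately show ?thesis using that cp by blast
qed

text \<open>The wandering projections of the isometry that witnesses infiniteness are pairwise equivalent.\<close>

lemma infinite_central_properly_infinite:
  assumes z: "infinite_proj (z::'a)" "central z"
  obtains E :: 'a where "properly_infinite_proj E" "E \<noteq> 0" "z * E = E"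
proof -
  obtain q v where zp: "is_proj z" and q: "is_proj q" "z * q = q" "q * z = q" "q \<noteq> z" and v: "cstar v * v = z" "v * cstar v = q"
    using z by (auto simp: infinite_proj_def mvn_equiv_def)
  define f where "f = z - q"
  have zz: "z * z = z" "cstar z = z" and qq: "q * q = q" "cstar q = q" using is_projD[OF zp] is_projD[OF q(1)] by auto
  have f: "is_proj f" "f \<noteq> 0" using q(4) by (auto simp: f_def is_proj_def cstar_diff algebra_simps zz qq q(1-3) dest: sym)
  have zf: "z * f = f" by (simp add: f_def algebra_simps zz q)
  have vz: "v * z = v" using partial_isometry_absorb[of v] zp by (simp add: v)
  have zv: "z * v = v" using z(2) vz by (simp add: central_def)
  have qv: "q * v = v" by (metis v vz mult.assoc)
  have fv: "f * v = 0" by (simp add: f_def algebra_simps zv qv)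
  define w where "w = rec_nat f (\<lambda>_ y. v * y)"
  have w0: "w 0 = f" and wS: "w (Suc n) = v * w n" for n by (simp_all add: w_def)
  have zw: "z * w n = w n" for n by (cases n) (simp_all add: w0 wS zf mult.assoc[symmetric] zv)
  have ff: "f * f = f" "cstar f = f" using is_projD[OF f(1)] by auto
  have step: "cstar (v * x) * (v * w n) = cstar x * w n" for x n
    using zw[of n] mult_prefix[OF v(1)] by (simp add: cstar_mult mult.assoc)
  have lt: "cstar (w n) * w m = 0" if "n < m" for n m
    using that
  proof (induction n arbitrary: m)
    case 0
    then obtain k where "m = Suc k" by (cases m) auto
    then show ?case by (simp add: w0 wS ff mult.assoc[symmetric] fv)
  next
    case (Suc n)
    then obtain k where "m = Suc k" "n < k" by (cases m) auto
    then show ?case using Suc.IH[of k] step[of "w n" k] by (simp only: wS)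
  qed
  have eqw: "cstar (w n) * w n = f" for n by (induction n) (simp_all add: w0 ff wS step)
  have w: "cstar (w n) * w m = (if n = m then f else 0)" for n m
  proof (cases n m rule: linorder_cases)
    case greater
    then have "cstar (cstar (w m) * w n) = 0" using lt by simp
    then show ?thesis using greater by (simp add: cstar_mult cstar_cstar)
  qed (simp_all add: lt eqw)
  have wf: "w n * f = w n" for n using partial_isometry_absorb[of "w n"] f(1) by (simp add: eqw)
  define e where "e n = w n * cstar (w n)" for n
  have fw: "f * cstar (w n) = cstar (w n)" for n using arg_cong[OF wf[of n], of cstar] by (simp add: cstar_mult ff)
  have e: "e n * e m = (if n = m then e n else 0)" for n m by (simp add: e_def mult.assoc mult_prefix[OF w] fw)
  have ep: "is_proj (e n)" for n using e[of n n] by (simp add: is_proj_def e_def cstar_mult cstar_cstar)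
  obtain E where E: "is_join E e UNIV" by (rule join_exists[of UNIV e]) (auto simp: ep e)
  have Ew: "E * w n = w n" for n
  proof -
    have "e n * w n = w n" by (simp add: e_def mult.assoc w wf)
    then show ?thesis using is_joinD(2)[OF E, of n] by (metis UNIV_I mult.assoc)
  qed
  have "properly_infinite_proj E"
  \<comment> \<open>Hilbert's hotel: the sequence of equivalent wandering projections is mapped onto
    its even and onto its odd members.\<close>
  proof (rule properly_infinite_join[OF E ep, of "\<lambda>a n. (if a then w (2 * n) else w (2 * n + 1)) * cstar (w n)"])
    show "e i * e j = 0" if "i \<noteq> j" for i j using that by (simp add: e)
    fix a b :: bool and i j :: nat
    have "2 * i \<noteq> Suc (2 * j)" "Suc (2 * i) \<noteq> 2 * j" by presburger+
    then show "cstar ((if a then w (2 * i) else w (2 * i + 1)) * cstar (w i)) * ((if b then w (2 * j) else w (2 * j + 1)) * cstar (w j)) =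
       (if a = b \<and> i = j then e i else 0)"
      by (auto simp: cstar_mult cstar_cstar mult.assoc mult_prefix[OF w] fw e_def)
    show "E * ((if a then w (2 * i) else w (2 * i + 1)) * cstar (w i)) = (if a then w (2 * i) else w (2 * i + 1)) * cstar (w i)"
      by (simp add: mult.assoc[symmetric] Ew)
  qed
  moreover have "E \<noteq> 0"
  proof
    assume "E = 0"
    then have "e 0 = 0" using is_joinD(2)[OF E, of 0] by simp
    then show False using f(2) by (simp add: e_def w0 ff)
  qed
  moreover have "z * E = E" by (rule join_absorb[OF E ep]) (simp add: e_def mult.assoc[symmetric] zw)
  ultimately show ?thesis using that by blast
qed

theorem properly_infinite_one:
  assumes inf: "properly_infinite_vN TYPE('a)"
  shows "properly_infinite_proj (1::'a)"
proof -
  obtain P where P: "\<forall>e\<in>P. properly_infinite_proj e \<and> e \<noteq> 0" "\<forall>x\<in>P. \<forall>y\<in>P. x \<noteq> y \<longrightarrow> x * y = (0::'a)"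
     "\<forall>z. (properly_infinite_proj z \<and> z \<noteq> 0) \<longrightarrow> (\<forall>x\<in>P. x * z = 0 \<and> z * x = 0) \<longrightarrow> z \<in> P"
    using ex_maximal_orthogonal[of "\<lambda>e::'a. properly_infinite_proj e \<and> e \<noteq> 0" "\<lambda>x y. x * y = 0"]
    by (elim exE conjE) (rule that)
  have Pp: "is_proj e" if "e \<in> P" for e using P(1)[rule_format, OF that] unfolding properly_infinite_proj_def by blast
  have Po: "x * y = 0" if "x \<in> P" "y \<in> P" "x \<noteq> y" for x y using P(2) that by simp
  obtain p where p: "is_join p (\<lambda>e. e) P" by (rule join_exists[OF Pp Po])
  have pp: "is_proj p" by (rule is_joinD(1)[OF p])
  have psq: "p * p = p" "cstar p = p" using is_projD[OF pp] by auto
  have "\<forall>e\<in>P. \<exists>u. \<forall>a b::bool. e * u a = u a \<and> u a * e = u a \<and> cstar (u a) * u b = (if a = b then e else 0)"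
    using P(1) unfolding properly_infinite_proj_def by blast
  then obtain u where u0: "\<forall>e\<in>P. \<forall>a b::bool. e * u e a = u e a \<and> u e a * e = u e a \<and>
      cstar (u e a) * u e b = (if a = b then e else 0)" by (rule bchoice[THEN exE])
  have u: "e * u e a = u e a" "u e a * e = u e a" "cstar (u e a) * u e b = (if a = b then e else 0)" if "e \<in> P" for e a b
    using u0[rule_format, OF that, of a b] by blast+
  have PIp: "properly_infinite_proj p"
  proof (rule properly_infinite_join[OF p Pp, of "\<lambda>a e. u e a"])
    show "i * j = 0" if "i \<in> P" "j \<in> P" "i \<noteq> j" for i j by (rule Po[OF that])
    fix a b :: bool and i j assume ij: "i \<in> P" "j \<in> P"
    show "cstar (u i a) * u j b = (if a = b \<and> i = j then i else 0)"
    proof (cases "i = j")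
      case False
      have i: "i * u i a = u i a" and j: "j * u j b = u j b" by (rule u(1)[OF ij(1)], rule u(1)[OF ij(2)])
      have "i * j = 0" by (rule Po[OF ij False])
      moreover have "cstar (u i a) * i = cstar (u i a)" using arg_cong[OF i, of cstar] is_projD(1)[OF Pp[OF ij(1)]] by (simp add: cstar_mult)
      ultimately have "cstar (u i a) * (j * u j b) = 0" by (metis mult.assoc mult_zero_left mult_zero_right)
      then have "cstar (u i a) * u j b = 0" by (simp only: j)
      then show ?thesis using False by simp
    qed (use u(3)[OF ij(1), of a b] in simp)
    show "p * u i a = u i a" using u(1)[OF ij(1), of a] is_joinD(2)[OF p ij(1)] by (metis mult.assoc)
  qed
  define r where "r = 1 - p"
  have rsq: "r * r = r" "cstar r = r" and rp: "r * p = 0" "p * r = 0"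
    using is_projD[OF is_projD(4)[OF pp]] by (simp_all add: r_def algebra_simps psq)
  have no_PI: "z = 0" if z: "properly_infinite_proj z" "r * z = z" for z
  proof (rule ccontr)
    assume z0: "z \<noteq> 0"
    have zp: "is_proj z" using z by (simp add: properly_infinite_proj_def)
    have pz: "p * z = 0" using z(2) by (metis rp(2) mult.assoc mult_zero_left)
    have ez: "e * z = 0" if e: "e \<in> P" for e using is_join_right(1)[OF p Pp e] pz by (metis mult.assoc mult_zero_right)
    have ze: "z * e = 0" if e: "e \<in> P" for e
      using arg_cong[OF ez[OF e], of cstar] is_projD(1)[OF zp] is_projD(1)[OF Pp[OF e]] by (simp add: cstar_mult)
    have "z \<in> P" using P(3)[rule_format, of z] z(1) z0 ez ze by simp
    then have "p * z = z" by (rule is_joinD(2)[OF p])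
    then show False using pz z0 by simp
  qed
  obtain W where W: "\<forall>v\<in>W. v \<noteq> 0 \<and> is_proj (cstar v * v) \<and> p * v = v \<and> v * r = v"
     "\<forall>x\<in>W. \<forall>y\<in>W. x \<noteq> y \<longrightarrow> cstar x * y = 0 \<and> x * cstar y = 0"
     "\<forall>z. (z \<noteq> 0 \<and> is_proj (cstar z * z) \<and> p * z = z \<and> z * r = z) \<longrightarrow>
        (\<forall>x\<in>W. (cstar x * z = 0 \<and> x * cstar z = 0) \<and> (cstar z * x = 0 \<and> z * cstar x = 0)) \<longrightarrow> z \<in> W"
    using ex_maximal_orthogonal[of "\<lambda>v. v \<noteq> 0 \<and> is_proj (cstar v * v) \<and> p * v = v \<and> v * r = v"
      "\<lambda>x y. cstar x * y = 0 \<and> x * cstar y = 0"]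
    by (elim exE conjE) (rule that)
  define e where "e v = cstar v * v" for v :: 'a
  have W1: "p * v = v" "v * r = v" if "v \<in> W" for v using W(1) that by simp_all
  have ep: "is_proj (e v)" if "v \<in> W" for v using W(1) that unfolding e_def by simp
  have eo: "e v * e w = 0" if "v \<in> W" "w \<in> W" "v \<noteq> w" for v w
  proof -
    have "v * cstar w = 0" using W(2) that by simp
    from mult_prefix[OF this, of w] show ?thesis by (simp add: e_def mult.assoc)
  qed
  have Wo: "cstar v * w = 0" if "v \<in> W" "w \<in> W" "v \<noteq> w" for v w using W(2) that by simp
  obtain E where E: "is_join E e W" by (rule join_exists[OF ep eo])
  obtain V where V: "\<And>v. v \<in> W \<Longrightarrow> V * e v = v" "V * E = V" "cstar V * V = E"
    by (rule partial_isometry_sum[OF E ep eo e_def[symmetric] Wo]) (assumption | rule that)+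
  have Ep: "is_proj E" by (rule is_joinD(1)[OF E])
  have Esq: "E * E = E" "cstar E = E" using is_projD[OF Ep] by auto
  have ve: "v * e v = v" if "v \<in> W" for v using partial_isometry_absorb[of v] ep[OF that] by (simp add: e_def)
  have vE: "v * E = v" if "v \<in> W" for v using is_join_right(1)[OF E ep that] ve[OF that] by (metis mult.assoc)
  have rE: "r * E = E"
  proof (rule join_absorb[OF E ep])
    fix v assume v: "v \<in> W"
    have "r * cstar v = cstar v" using arg_cong[OF W1(2)[OF v], of cstar] by (simp add: cstar_mult rsq)
    then show "r * e v = e v" by (simp add: e_def mult.assoc[symmetric])
  qed
  have Er: "E * r = E" using arg_cong[OF rE, of cstar] by (simp add: cstar_mult rsq Esq)
  have pV: "p * V = V"
  proof -
    have "((1 - p) * V) * E = 0"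
      by (rule is_join_right(2)[OF E ep]) (simp_all add: mult.assoc V(1) left_diff_distrib W1)
    then show ?thesis by (simp add: mult.assoc V(2)) (simp add: algebra_simps)
  qed
  have Vp: "cstar V * p = cstar V" using arg_cong[OF pV, of cstar] by (simp add: cstar_mult psq)
  define g where "g = V * cstar V"
  have EV: "E * cstar V = cstar V" using arg_cong[OF V(2), of cstar] by (simp add: cstar_mult Esq)
  have gsq: "g * g = g" "cstar g = g" by (simp_all add: g_def mult.assoc mult_prefix[OF V(3)] EV cstar_mult cstar_cstar)
  define s where "s = r - E"
  define q where "q = p - g"
  have pg: "p * g = g" "g * p = g" by (simp_all add: g_def mult.assoc[symmetric] pV) (simp add: mult.assoc Vp)
  have sq: "s * s = s" "cstar s = s" by (simp_all add: s_def algebra_simps rsq Esq rE Er cstar_diff)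
  have qq: "q * q = q" "cstar q = q" by (simp_all add: q_def algebra_simps psq gsq pg cstar_diff)
  have pq: "p * q = q" by (simp add: q_def algebra_simps psq pg)
  have sr: "s * r = s" by (simp add: s_def algebra_simps rsq Er)
  have sE: "s * E = 0" by (simp add: s_def algebra_simps rE Esq)
  have qV: "q * V = 0"
  proof -
    have "g * V = V" by (simp add: g_def mult.assoc V)
    then show ?thesis by (simp add: q_def algebra_simps pV)
  qed
  have qas: "q * a * s = 0" for a
  proof (rule ccontr)
    define x where "x = q * a * s"
    assume "q * a * s \<noteq> 0"
    then have "x \<noteq> 0" by (simp add: x_def)
    then obtain f v w y where v: "is_proj f" "v \<noteq> 0" "cstar v * v = f" "v = x * w" "f = y * (cstar x * x)"
      using polar_projection by blast
    have "x * s = x" by (simp add: x_def mult.assoc sq)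
    then have fs: "f * s = f" by (simp add: v(5) mult.assoc)
    have vf: "v * f = v" using partial_isometry_absorb[of v] v(1,3) by simp
    have vs: "v * s = v" by (metis vf fs mult.assoc)
    have qv: "q * v = v" by (simp add: v(4) x_def mult.assoc[symmetric] qq)
    have pv: "p * v = v" by (metis qv pq mult.assoc)
    have vr: "v * r = v" by (metis vs sr mult.assoc)
    have o: "cstar v * z = 0 \<and> v * cstar z = 0" if z: "z \<in> W" for z
    proof -
      have "q * z = 0" using V(1)[OF z] qV by (metis mult.assoc mult_zero_left)
      moreover have "cstar v * q = cstar v" using arg_cong[OF qv, of cstar] by (simp add: cstar_mult qq)
      ultimately have "cstar v * z = 0" by (metis mult.assoc mult_zero_right)
      moreover have "E * cstar z = cstar z" using arg_cong[OF vE[OF z], of cstar] by (simp add: cstar_mult Esq)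
      then have "v * cstar z = 0" using vs sE by (metis mult.assoc mult_zero_left mult_zero_right)
      ultimately show ?thesis by blast
    qed
    have o': "cstar z * v = 0 \<and> z * cstar v = 0" if "z \<in> W" for z
    proof -
      have "cstar (cstar v * z) = 0" "cstar (v * cstar z) = 0" using o[OF that] by simp_all
      then show ?thesis by (simp add: cstar_mult cstar_cstar)
    qed
    have "is_proj (cstar v * v)" using v(1) by (simp only: v(3))
    then have "v \<noteq> 0 \<and> is_proj (cstar v * v) \<and> p * v = v \<and> v * r = v" using v(2) pv vr by (intro conjI)
    moreover have "\<forall>z\<in>W. (cstar z * v = 0 \<and> z * cstar v = 0) \<and> (cstar v * z = 0 \<and> v * cstar z = 0)"
      by (intro ballI conjI o'[THEN conjunct1] o'[THEN conjunct2] o[THEN conjunct1] o[THEN conjunct2])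
    ultimately have "v \<in> W" by (rule W(3)[THEN spec, THEN mp, THEN mp])
    then have "cstar v * v = 0" using o by blast
    then show False using v(2) by (simp only: cstar_mult_self_eq_0)
  qed
  have s0: "s = 0"
  proof (rule ccontr)
    assume "s \<noteq> 0"
    then obtain c where c: "is_proj c" "central c" "c \<noteq> 0" "c * s = s" "q * c = 0" using qas by (rule central_annihilator)
    have cc: "c * c = c" "cstar c = c" using is_projD[OF c(1)] by auto
    have com: "x * c = c * x" for x using c(2) by (simp add: central_def)
    have cpg: "c * p = c * g" using c(5) com by (simp add: q_def algebra_simps)
    have cV: "c * V = V * c" by (simp add: com)
    have ccV: "c * (c * x) = c * x" for x by (simp add: mult.assoc[symmetric] cc)
    have cVcV: "cstar (c * V) * (c * V) = c * E"
    proof -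
      have "cstar (c * V) * (c * V) = cstar V * (c * (c * V))" by (simp add: cstar_mult cc mult.assoc)
      also have "\<dots> = cstar V * (V * c)" by (subst ccV) (simp only: cV)
      also have "\<dots> = (cstar V * V) * c" by (simp only: mult.assoc)
      also have "\<dots> = c * E" by (simp only: V(3) com)
      finally show ?thesis .
    qed
    have fz: "c * E = 0"
    proof (rule no_PI)
      show "r * (c * E) = c * E" using rE com by (metis mult.assoc)
      show "properly_infinite_proj (c * E)"
      proof (rule properly_infinite_transfer[OF PIp, of "c * V" _ "c * g"])
        show "cstar (c * V) * (c * V) = c * E" by (rule cVcV)
        show "c * V * cstar (c * V) = c * g"
        proof -
          have "c * V * cstar (c * V) = (c * V) * (cstar V * c)" by (simp add: cstar_mult cc)
          also have "\<dots> = c * (g * c)" by (simp only: g_def mult.assoc)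
          also have "\<dots> = c * g" by (simp only: com ccV)
          finally show ?thesis .
        qed
        have "c * g * (c * g) = c * (c * (g * g))" by (metis com mult.assoc)
        moreover have "cstar (c * g) = c * g" using com by (simp add: cstar_mult cc gsq)
        ultimately show "is_proj (c * g)" by (simp add: is_proj_def gsq ccV)
        show "p * (c * g) = c * g" by (metis com pg(1) mult.assoc)
        show "c * g * a = a * (c * g)" if "p * a = a" "a * p = a" for a
        proof -
          have "c * g * a = c * p * a" by (simp only: cpg)
          also have "\<dots> = a * p * c" by (metis that com mult.assoc)
          also have "\<dots> = a * (c * p)" by (simp only: mult.assoc com[of p])
          also have "\<dots> = a * (c * g)" by (simp only: cpg)
          finally show ?thesis .
        qed
      qed
    qed
    have "cstar (c * V) * (c * V) = 0" using cVcV fz by simp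
    then have cV0: "c * V = 0" by (simp only: cstar_mult_self_eq_0)
    then have "c * p = 0" by (simp add: cpg g_def mult.assoc[symmetric] cV0)
    then have cr: "c * r = c" by (simp add: r_def algebra_simps)
    have "infinite_proj c" using inf c by (auto simp: properly_infinite_vN_def)
    then obtain z where z: "properly_infinite_proj z" "z \<noteq> 0" "c * z = z" using c(2) by (rule infinite_central_properly_infinite)
    have "r * z = z" using cr com z(3) by (metis mult.assoc)
    then show False using no_PI z by blast
  qed
  have VV: "cstar V * V = r" using s0 V(3) by (simp add: s_def)
  obtain x y where xy: "p * x = x" "x * p = x" "p * y = y" "y * p = y"
    "cstar x * x = p" "cstar y * y = p" "cstar x * y = 0" "cstar y * x = 0"
    using PIp by (rule properly_infinite_projE)
  note xr = xy[THEN mult_prefix]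
  have xs: "cstar x * p = cstar x" "p * cstar x = cstar x" "cstar y * p = cstar y" "p * cstar y = cstar y"
    using arg_cong[OF xy(1), of cstar] arg_cong[OF xy(2), of cstar] arg_cong[OF xy(3), of cstar] arg_cong[OF xy(4), of cstar]
    by (simp_all add: cstar_mult psq)
  have Vr: "V * r = V" using V(2) Er by (metis mult.assoc)
  have Vz: "V * p = 0" by (metis Vr rp(1) mult.assoc mult_zero_right)
  have pVs: "p * cstar V = 0" using arg_cong[OF Vz, of cstar] by (simp add: cstar_mult psq)
  \<comment> \<open>\<open>x + y * V\<close> is an isometry from \<open>1 = p + r\<close> into
    \<open>p\<close>; following it by \<open>x\<close> or by \<open>y\<close> gives two isometries
    with orthogonal ranges.\<close>
  define S where "S a = (if a then x else y) * x + (if a then x else y) * y * V" for a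
  have S: "cstar (S a) * S b = (if a = b then 1 else 0)" for a b
  proof -
    have r1: "r + p = 1" by (simp add: r_def)
    show ?thesis
      by (simp add: S_def cstar_add cstar_mult algebra_simps mult.assoc xy xs xr psq Vp pV VV Vz pVs xs[THEN mult_prefix]
         pV[THEN mult_prefix] Vp[THEN mult_prefix])
        (simp add: r_def)
  qed
  show ?thesis
    by (rule properly_infinite_projI[of 1 "S True" "S False"]) (simp_all add: S is_proj_def)
qed

end

text \<open>The assumption says that \<open>cstar x * x\<close> is bounded below inside the corner
  of \<open>p\<close>; adding \<open>1 - p\<close> permits an inverse square root in the whole
  algebra, which commutes with \<open>p\<close>.\<close>

lemma corner_normalize:
  fixes x :: "'a::cstar_algebra"
  assumes p: "is_proj p" and x: "x * p = x" and \<kappa>: "\<kappa> > 0" "is_positive (cstar x * x + (1 - p) - of_real \<kappa>)"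
  shows "\<exists>\<theta>. cstar (x * \<theta>) * (x * \<theta>) = p"
proof -
  have pp: "p * p = p" "cstar p = p" using is_projD[OF p] by auto
  have px: "p * cstar x = cstar x" using arg_cong[OF x, of cstar] by (simp add: cstar_mult pp)
  define m where "m = cstar x * x + (1 - p)"
  have mp: "m * p = cstar x * x" by (simp add: m_def distrib_right left_diff_distrib mult.assoc x pp)
  have pm: "p * m = cstar x * x" by (simp add: m_def distrib_left right_diff_distrib mult.assoc[symmetric] px pp)
  have "is_positive (m - of_real \<kappa>)" using \<kappa>(2) by (simp only: m_def)
  then obtain \<theta> where \<theta>: "cstar \<theta> = \<theta>" "inv_el \<theta>" "\<theta> * m * \<theta> = 1" and \<theta>c: "\<And>y. y * m = m * y \<Longrightarrow> y * \<theta> = \<theta> * y"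
    by (rule inverse_sqrt[OF _ \<kappa>(1)]) (rule that)
  have p\<theta>: "p * \<theta> = \<theta> * p" by (rule \<theta>c) (simp only: pm mp)
  have "cstar (x * \<theta>) * (x * \<theta>) = \<theta> * (cstar x * x) * \<theta>" by (simp add: cstar_mult \<theta>(1) mult.assoc)
  also have "\<dots> = \<theta> * (m * p) * \<theta>" by (simp only: mp)
  also have "\<dots> = \<theta> * m * (p * \<theta>)" by (simp only: mult.assoc)
  also have "\<dots> = \<theta> * m * \<theta> * p" by (simp only: p\<theta> mult.assoc)
  also have "\<dots> = p" by (simp only: \<theta>(3) mult_1_left)
  finally show ?thesis by (rule exI)
qed

subsection \<open>Maximal left ideals and characters\<close>

lemma ex_maximal_left_ideal:
  assumes I: "left_ideal I" "1 \<notin> I" shows "\<exists>L. maximal_left_ideal L \<and> I \<subseteq> L"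
proof -
  define \<A> where "\<A> = {M. left_ideal M \<and> 1 \<notin> M \<and> I \<subseteq> M}"
  have "\<exists>L\<in>\<A>. \<forall>X\<in>\<A>. L \<subseteq> X \<longrightarrow> X = L"
  proof (rule subset_Zorn_nonempty)
    show "\<A> \<noteq> {}" using I by (auto simp: \<A>_def)
    fix \<C> assume ne: "\<C> \<noteq> {}" and ch: "subset.chain \<A> \<C>"
    have sub: "M \<in> \<C> \<Longrightarrow> left_ideal M \<and> 1 \<notin> M \<and> I \<subseteq> M" for M using ch by (auto simp: subset.chain_def \<A>_def)
    have "left_ideal (\<Union>\<C>)" unfolding left_ideal_def
    proof (intro conjI ballI allI)
      show "0 \<in> \<Union>\<C>" using ne sub left_idealD(1) by blast
      show "x + y \<in> \<Union>\<C>" if xy: "x \<in> \<Union>\<C>" "y \<in> \<Union>\<C>" for x y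
      proof -
        obtain X Y where XY: "X \<in> \<C>" "Y \<in> \<C>" "x \<in> X" "y \<in> Y" using xy by blast
        then have "X \<subseteq> Y \<or> Y \<subseteq> X" using ch by (auto simp: subset.chain_def)
        then obtain Z where "Z \<in> \<C>" "x \<in> Z" "y \<in> Z" using XY by blast
        moreover from this have "x + y \<in> Z" using sub left_idealD(2) by blast
        ultimately show ?thesis by blast
      qed
      show "cscale c x \<in> \<Union>\<C>" if x: "x \<in> \<Union>\<C>" for c x
      proof -
        obtain X where X: "X \<in> \<C>" "x \<in> X" using x by blast
        have "cscale c x \<in> X" using sub[OF X(1)] X(2) by (intro left_idealD(3)) auto
        then show ?thesis using X(1) by (intro UnionI)
      qed
      show "a * x \<in> \<Union>\<C>" if x: "x \<in> \<Union>\<C>" for a x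
      proof -
        obtain X where X: "X \<in> \<C>" "x \<in> X" using x by blast
        have "left_ideal X" using sub[OF X(1)] by simp
        then have "a * x \<in> X" by (rule left_idealD(4)) (rule X(2))
        then show ?thesis using X(1) by (intro UnionI)
      qed
    qed
    moreover have "1 \<notin> \<Union>\<C>" "I \<subseteq> \<Union>\<C>" using sub ne by auto
    ultimately show "\<Union>\<C> \<in> \<A>" by (simp add: \<A>_def)
  qed
  then obtain L where L: "left_ideal L" "1 \<notin> L" "I \<subseteq> L" and max: "\<And>X. X \<in> \<A> \<Longrightarrow> L \<subseteq> X \<Longrightarrow> X = L"
    by (auto simp: \<A>_def)
  have "M = L" if M: "left_ideal M" "M \<noteq> UNIV" "L \<subseteq> M" for M
  proof -
    have "1 \<notin> M" using left_ideal_eq_UNIV[OF M(1) inv_el_one] M(2) by blast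
    then show ?thesis using M L(3) by (intro max) (auto simp: \<A>_def)
  qed
  then show ?thesis using L by (intro exI[of _ L]) (auto simp: maximal_left_ideal_def)
qed

lemma maximal_left_ideal_closed:
  assumes L: "maximal_left_ideal (L :: 'a::cbanach_algebra set)" shows "closed L"
proof -
  have LI: "left_ideal L" by (rule maximal_left_idealD(1)[OF L])
  have "left_ideal (closure L)" unfolding left_ideal_def
  proof (intro conjI ballI allI)
    show "0 \<in> closure L" using left_idealD(1)[OF LI] closure_subset by blast
  next
    fix x y assume "x \<in> closure L" "y \<in> closure L"
    then obtain X Y where "\<And>n. X n \<in> L" "X \<longlonglongrightarrow> x" "\<And>n. Y n \<in> L" "Y \<longlonglongrightarrow> y" by (auto simp: closure_sequential)
    then show "x + y \<in> closure L" unfolding closure_sequential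
      by (intro exI[of _ "\<lambda>n. X n + Y n"] conjI allI left_idealD(2)[OF LI] tendsto_add)
  next
    fix c x assume "x \<in> closure L"
    then obtain X where "\<And>n. X n \<in> L" "X \<longlonglongrightarrow> x" by (auto simp: closure_sequential)
    then show "cscale c x \<in> closure L" unfolding closure_sequential
      by (intro exI[of _ "\<lambda>n. cscale c (X n)"] conjI allI left_idealD(3)[OF LI] bounded_linear.tendsto[OF bounded_linear_cscale_right])
  next
    fix a x assume "x \<in> closure L"
    then obtain X where X: "\<And>n. X n \<in> L" "X \<longlonglongrightarrow> x" by (auto simp: closure_sequential)
    have "a * X n \<in> L" for n by (rule left_idealD(4)[OF LI X(1)])
    moreover have "(\<lambda>n. a * X n) \<longlonglongrightarrow> a * x" by (rule tendsto_mult_left[OF X(2)])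
    ultimately show "a * x \<in> closure L" unfolding closure_sequential by (intro exI[of _ "\<lambda>n. a * X n"] conjI allI)
  qed
  moreover have "closure L \<noteq> UNIV"
  proof
    assume "closure L = UNIV"
    then have "(1::'a) \<in> closure L" by simp
    then obtain y where y: "y \<in> L" "dist y 1 < 1" unfolding closure_approachable by (meson zero_less_one)
    have "inv_el (1 - (1 - y))" by (rule neumann) (use y(2) in \<open>simp add: dist_norm norm_minus_commute\<close>)
    then show False using maximal_left_ideal_no_inv[OF L y(1)] by simp
  qed
  ultimately have "closure L = L" using maximal_left_idealD(3)[OF L] closure_subset by blast
  then show ?thesis by (metis closed_closure)
qed

text \<open>\<open>L\<close> behaves like a prime ideal, so for each \<open>t\<close> the positive
  or the negative part of \<open>h - t\<close> lies in \<open>L\<close>. Both alternatives are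
  closed conditions on \<open>t\<close>, each excluded at one end of a large interval; by
  connectedness they meet, and there \<open>h - t\<close> itself lies in \<open>L\<close>.\<close>

lemma square_zero_scalar_mod_left_ideal:
  assumes L: "maximal_left_ideal (L :: 'a::cstar_algebra set)" and sq: "\<And>c. c * c = 0 \<Longrightarrow> c \<in> L"
    and h: "cstar h = h"
  shows "\<exists>t. h - of_real t \<in> L"
proof -
  have LI: "left_ideal L" by (rule maximal_left_idealD(1)[OF L])
  \<comment> \<open>\<open>a * y * b\<close> has square zero, and it agrees with \<open>a\<close>
    modulo \<open>L\<close> once \<open>y * b\<close> is \<open>1\<close> modulo
    \<open>L\<close>.\<close>
  have prime: "a \<in> L \<or> b \<in> L" if ba: "b * a = 0" for a b
  proof (rule disjCI)
    assume "b \<notin> L"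
    then obtain y where y: "y * b - 1 \<in> L" using maximal_left_ideal_solve[OF L] by blast
    have "(a * y * b) * (a * y * b) = a * y * (b * a) * (y * b)" by (simp only: mult.assoc)
    then have "a * y * b \<in> L" by (intro sq) (simp add: ba)
    moreover have "a * (y * b - 1) \<in> L" by (rule left_idealD(4)[OF LI y])
    ultimately have "a * y * b - a * (y * b - 1) \<in> L" by (rule left_idealD(6)[OF LI])
    then show "a \<in> L" by (simp add: right_diff_distrib mult.assoc)
  qed
  \<comment> \<open>The extra \<open>1\<close> makes the relevant parts of \<open>h - t\<close>
    invertible at the end points, and \<open>K\<close> dominates \<open>h - t\<close> for all
    \<open>t\<close> in the interval, so one scale serves all absolute values.\<close>
  define R where "R = norm h + 1"
  define K where "K = 2 * R"
  have R: "R > 0" using norm_ge_zero[of h] unfolding R_def by linarith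
  then have K: "K > 0" by (simp add: K_def)
  define g where "g t = h - of_real t" for t :: real
  have gs: "cstar (g t) = g t" for t by (simp add: g_def cstar_diff h)
  have ng: "norm (g t) \<le> K" if "t \<in> {- R..R}" for t
  proof -
    have "norm (g t) \<le> norm h + norm (of_real t :: 'a)" unfolding g_def by (rule norm_triangle_ineq4)
    then show ?thesis using that by (auto simp: K_def R_def)
  qed
  define A where "A = {t\<in>{- R..R}. cabs K (g t) + g t \<in> L}"
  define B where "B = {t\<in>{- R..R}. cabs K (g t) - g t \<in> L}"
  have Lc: "closed L" by (rule maximal_left_ideal_closed[OF L])
  have gc: "continuous_on {- R..R} g" unfolding g_def by (intro continuous_intros)
  have "continuous_on {- R..R} (\<lambda>t. sqrt_one_minus (1 - (1 / K\<^sup>2) *\<^sub>R (g t * g t)))"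
  proof (rule continuous_on_compose2[OF continuous_on_sqrt_one_minus])
    show "continuous_on {- R..R} (\<lambda>t. 1 - (1 / K\<^sup>2) *\<^sub>R (g t * g t))" by (intro continuous_intros gc)
    show "(\<lambda>t. 1 - (1 / K\<^sup>2) *\<^sub>R (g t * g t)) ` {- R..R} \<subseteq> cball 0 1"
    proof (rule image_subsetI)
      fix t assume t: "t \<in> {- R..R}"
      have "norm (1 - (1 / K\<^sup>2) *\<^sub>R (g t * g t)) \<le> 1"
        by (rule pos_sqrt(4)[OF cabs(8)[OF gs K ng[OF t]] _ cabs(9)[OF gs K ng[OF t]]]) (use K in simp)
      then show "1 - (1 / K\<^sup>2) *\<^sub>R (g t * g t) \<in> cball 0 1" by simp
    qed
  qed
  then have cc: "continuous_on {- R..R} (\<lambda>t. cabs K (g t))"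
    unfolding cabs_def pos_sqrt_def by (rule continuous_on_scaleR[OF continuous_on_const])
  have cl: "closed {t\<in>{- R..R}. f t \<in> L}" if "continuous_on {- R..R} f" for f
  proof -
    have "closed ({- R..R} \<inter> f -` L)" by (rule continuous_closed_preimage[OF that _ Lc]) simp
    moreover have "{- R..R} \<inter> f -` L = {t\<in>{- R..R}. f t \<in> L}" by auto
    ultimately show ?thesis by simp
  qed
  have cA: "closed A" unfolding A_def by (intro cl continuous_on_add cc gc)
  have cB: "closed B" unfolding B_def by (intro cl continuous_on_diff cc gc)
  have cover: "t \<in> A \<or> t \<in> B" if t: "t \<in> {- R..R}" for t
    using prime[OF cabs(7)[OF gs K ng[OF t]]] t unfolding A_def B_def by blast
  have "R \<notin> B"
  proof
    assume "R \<in> B"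
    then have mem: "R \<in> {- R..R}" "cabs K (g R) - g R \<in> L" by (auto simp: B_def)
    have "is_positive (cabs K (g R) + (of_real (norm h) - h))"
    proof (rule is_positive_add[OF cabs(1)[OF gs K ng[OF mem(1)]]])
      show "is_positive (of_real (norm h) - h)" by (rule is_positiveI_norm[of _ "norm h"]) (simp_all add: cstar_diff h)
    qed
    moreover have "cabs K (g R) + (of_real (norm h) - h) = cabs K (g R) - g R - of_real 1" by (simp add: g_def R_def)
    ultimately have "is_positive (cabs K (g R) - g R - of_real 1)" by (simp only:)
    then have "inv_el (cabs K (g R) - g R)" by (rule strictly_positive_inv) simp
    then show False using maximal_left_ideal_no_inv[OF L mem(2)] by simp
  qed
  moreover have "- R \<notin> A"
  proof
    assume "- R \<in> A"
    then have mem: "- R \<in> {- R..R}" "cabs K (g (- R)) + g (- R) \<in> L" by (auto simp: A_def)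
    have "is_positive (cabs K (g (- R)) + (of_real (norm h) + h))"
    proof (rule is_positive_add[OF cabs(1)[OF gs K ng[OF mem(1)]]])
      show "is_positive (of_real (norm h) + h)" by (rule is_positiveI_norm[of _ "norm h"]) (simp_all add: cstar_add h)
    qed
    moreover have "cabs K (g (- R)) + (of_real (norm h) + h) = cabs K (g (- R)) + g (- R) - of_real 1" by (simp add: g_def R_def)
    ultimately have "is_positive (cabs K (g (- R)) + g (- R) - of_real 1)" by (simp only:)
    then have "inv_el (cabs K (g (- R)) + g (- R))" by (rule strictly_positive_inv) simp
    then show False using maximal_left_ideal_no_inv[OF L mem(2)] by simp
  qed
  moreover have "connected {- R..R}" by (rule connected_Icc)
  ultimately have "A \<inter> B \<noteq> {}"
    using cA cB cover R unfolding connected_closed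
    by (smt (verit, best) Int_iff atLeastAtMost_iff disjoint_iff subset_iff Un_iff)
  then obtain t where "cabs K (g t) + g t \<in> L" "cabs K (g t) - g t \<in> L" by (auto simp: A_def B_def)
  then have "cabs K (g t) + g t - (cabs K (g t) - g t) \<in> L" by (rule left_idealD(6)[OF LI])
  then have "cscale (1/2) (g t + g t) \<in> L" by (intro left_idealD(3)[OF LI]) simp
  then have "g t \<in> L" by (simp add: cscale_add_right flip: cscale_add_left)
  then show ?thesis by (auto simp: g_def)
qed

text \<open>The quotient by \<open>L\<close> is one-dimensional, so the module action on it is by
  scalars, and these scalars form the character.\<close>

lemma character_of_square_zero_left_ideal:
  assumes L: "maximal_left_ideal (L :: 'a::cstar_algebra set)" and sq: "\<And>c. c * c = 0 \<Longrightarrow> c \<in> L"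
  shows "\<exists>\<omega> :: 'a \<Rightarrow> complex. character \<omega>"
proof -
  have LI: "left_ideal L" by (rule maximal_left_idealD(1)[OF L])
  have ex: "\<exists>z. x - cscale z 1 \<in> L" for x
  proof -
    define h where "h = (1/2) *\<^sub>R (x + cstar x)"
    define k where "k = cscale (- \<i> / 2) (x - cstar x)"
    have hs: "cstar h = h" "cstar k = k"
      by (simp_all add: h_def k_def cstar_scaleR cstar_cscale cstar_add cstar_diff cstar_cstar cscale_diff_right add.commute)
    obtain s t where st: "h - of_real s \<in> L" "k - of_real t \<in> L"
      using square_zero_scalar_mod_left_ideal[OF L sq hs(1)] square_zero_scalar_mod_left_ideal[OF L sq hs(2)] by blast
    have xk: "cscale \<i> k = (1/2) *\<^sub>R (x - cstar x)" by (simp add: k_def cscale_cscale scaleR_eq_cscale)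
    have x: "x = h + cscale \<i> k" unfolding xk h_def by (simp add: algebra_simps flip: scaleR_add_left)
    have "h - of_real s + cscale \<i> (k - of_real t) \<in> L" by (intro left_idealD(2,3)[OF LI] st)
    moreover have "h - of_real s + cscale \<i> (k - of_real t) = x - cscale (of_real s + \<i> * of_real t) 1"
      unfolding of_real_eq_cscale by (subst x) (simp add: cscale_diff_right cscale_cscale cscale_add_left)
    ultimately show ?thesis by (intro exI[of _ "of_real s + \<i> * of_real t"]) (simp only:)
  qed
  define \<omega> where "\<omega> x = (SOME z. x - cscale z 1 \<in> L)" for x
  have \<omega>: "x - cscale (\<omega> x) 1 \<in> L" for x unfolding \<omega>_def using ex by (rule someI_ex)
  have uniq: "\<omega> x = z" if z: "x - cscale z 1 \<in> L" for x z
  proof (rule ccontr)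
    assume ne: "\<omega> x \<noteq> z"
    have "(x - cscale z 1) - (x - cscale (\<omega> x) 1) \<in> L" by (rule left_idealD(6)[OF LI z \<omega>])
    moreover have "(x - cscale z 1) - (x - cscale (\<omega> x) 1) = cscale (\<omega> x - z) 1" by (simp add: cscale_diff_left)
    moreover have "inv_el (cscale (\<omega> x - z) (1::'a))" using ne by (simp add: inv_el_cscale_iff)
    ultimately show False using maximal_left_ideal_no_inv[OF L] by metis
  qed
  have "\<omega> (x + y) = \<omega> x + \<omega> y" for x y
  proof (rule uniq)
    have "(x - cscale (\<omega> x) 1) + (y - cscale (\<omega> y) 1) \<in> L" by (rule left_idealD(2)[OF LI \<omega> \<omega>])
    then show "x + y - cscale (\<omega> x + \<omega> y) 1 \<in> L" by (simp add: cscale_add_left algebra_simps)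
  qed
  moreover have "\<omega> (cscale c x) = c * \<omega> x" for c x
  proof (rule uniq)
    have "cscale c (x - cscale (\<omega> x) 1) \<in> L" by (rule left_idealD(3)[OF LI \<omega>])
    then show "cscale c x - cscale (c * \<omega> x) 1 \<in> L" by (simp add: cscale_diff_right cscale_cscale)
  qed
  moreover have "\<omega> (x * y) = \<omega> x * \<omega> y" for x y
  proof (rule uniq)
    have "x * (y - cscale (\<omega> y) 1) + cscale (\<omega> y) (x - cscale (\<omega> x) 1) \<in> L"
      by (rule left_idealD(2)[OF LI left_idealD(4)[OF LI \<omega>] left_idealD(3)[OF LI \<omega>]])
    then show "x * y - cscale (\<omega> x * \<omega> y) 1 \<in> L"
      by (simp add: right_diff_distrib cscale_mult_right cscale_diff_right cscale_cscale mult.commute)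
  qed
  moreover have "\<omega> 1 = 1" by (rule uniq) (simp add: left_idealD(1)[OF LI])
  ultimately have "character \<omega>" unfolding character_def by (metis zero_neq_one)
  then show ?thesis by blast
qed

subsection \<open>The ideal generated by the properly infinite projections\<close>

text \<open>The algebraic two-sided ideal without closure: its elements are finite sums, and the
  factorisation below is an induction on their length.\<close>

inductive_set pi_ideal :: "'a::cstar_algebra set" where
  zero: "0 \<in> pi_ideal"
| add: "a \<in> pi_ideal \<Longrightarrow> properly_infinite_proj p \<Longrightarrow> a + x * p * y \<in> pi_ideal"

lemma pi_ideal_mult: "a \<in> pi_ideal \<Longrightarrow> x * a * y \<in> pi_ideal"
proof (induction rule: pi_ideal.induct)
  case (add a p b c)
  from pi_ideal.add[OF add.IH add.hyps(2), of "x * b" "c * y"] show ?case by (simp add: algebra_simps)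
qed (simp add: pi_ideal.zero)

lemma pi_ideal_add:
  assumes b: "b \<in> pi_ideal" and a: "a \<in> pi_ideal" shows "a + b \<in> pi_ideal"
  using b
proof (induction rule: pi_ideal.induct)
  case (add b p x y)
  from pi_ideal.add[OF add.IH add.hyps(2), of x y] show ?case by (simp add: add.assoc)
qed (simp add: a)

lemma left_ideal_pi_ideal: "left_ideal (pi_ideal :: 'a::cstar_algebra set)"
  unfolding left_ideal_def
proof (intro conjI ballI allI)
  fix x :: 'a assume x: "x \<in> pi_ideal"
  show "a * x \<in> pi_ideal" for a using pi_ideal_mult[OF x, of a 1] by simp
  show "cscale c x \<in> pi_ideal" for c using pi_ideal_mult[OF x, of "cscale c 1" 1] by (simp add: cscale_mult_left)
qed (auto intro: pi_ideal.zero pi_ideal_add)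

text \<open>A sum of products is a row times a column, and the column is folded into the single
  element \<open>W\<close>. The isometry \<open>s\<close> has range orthogonal to that of
  \<open>W\<close>; this spare room takes the next entry through \<open>t\<close>, and
  \<open>s'\<close> shrinks the room to keep it disjoint from the range of \<open>t\<close>.\<close>

lemma pi_ideal_factor:
  assumes "a \<in> pi_ideal"
  shows "\<exists>s W X. cstar s * s = 1 \<and> cstar s * W = 0 \<and> (a::'a::cstar_algebra) = X * W"
  using assms
proof (induction rule: pi_ideal.induct)
  case zero
  show ?case by (intro exI[of _ 1] exI[of _ 0]) simp
next
  case (add a p x y)
  then obtain s W X where s: "cstar s * s = 1" "cstar s * W = 0" "a = X * W" by blast
  obtain u t where u: "p * u = u" "u * p = u" "p * t = t" "t * p = t" "cstar u * u = p" "cstar t * t = p" "cstar u * t = 0" "cstar t * u = 0"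
    using add.hyps(2) by (rule properly_infinite_projE)
  have p: "p * p = p" "cstar p = p" using add.hyps(2) by (auto simp: properly_infinite_proj_def is_proj_def)
  have us: "cstar u * p = cstar u" "p * cstar u = cstar u"
    using arg_cong[OF u(1), of cstar] arg_cong[OF u(2), of cstar] by (simp_all add: cstar_mult p)
  define s' where "s' = (1 - p) + u"
  have s's: "cstar s' = (1 - p) + cstar u" by (simp add: s'_def cstar_add cstar_diff p)
  have s': "cstar s' * s' = 1" "cstar s' * t = 0"
    unfolding s's by (simp_all add: s'_def algebra_simps us u p)
  note r = s(1,2)[THEN mult_prefix] s'[THEN mult_prefix] u(6)[THEN mult_prefix]
  show ?case
  proof (intro exI conjI)
    show "cstar (s * s') * (s * s') = 1" by (simp add: cstar_mult mult.assoc r s')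
    show "cstar (s * s') * (W + s * t * y) = 0" by (simp add: cstar_mult distrib_left mult.assoc r s s')
    show "a + x * p * y = (X * (1 - s * cstar s) + x * cstar t * cstar s) * (W + s * t * y)"
      by (simp add: algebra_simps mult.assoc r s)
  qed
qed

text \<open>From \<open>1 = X * W\<close> the element \<open>cstar W * W\<close> is bounded below in
  terms of \<open>norm X\<close>, so \<open>W\<close> can be normalised to an isometry, with range
  still orthogonal to that of \<open>s\<close>.\<close>

lemma properly_infinite_one_of_pi_ideal:
  assumes "(1::'a::cstar_algebra) \<in> pi_ideal" shows "properly_infinite_proj (1::'a)"
proof -
  obtain s W X :: 'a where s: "cstar s * s = 1" "cstar s * W = 0" "1 = X * W" using pi_ideal_factor[OF assms] by blast
  define K where "K = (norm X)\<^sup>2 + 1"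
  have K: "K > 0" by (simp add: K_def add_nonneg_pos)
  have "is_positive (of_real K - cstar X * X)"
    by (rule is_positive_norm_diff[OF is_positive_cstar_mult]) (simp add: K_def cstar_identity)
  from is_positive_scaleR[OF is_positive_conj[OF this, of W], of "1 / K"]
  have "is_positive ((1 / K) *\<^sub>R (cstar W * (of_real K - cstar X * X) * W))" using K by simp
  moreover have "(1 / K) *\<^sub>R (cstar W * (of_real K - cstar X * X) * W) = cstar W * W + (1 - 1) - of_real (1 / K)"
  proof -
    have "cstar W * (cstar X * X) * W = cstar (X * W) * (X * W)" by (simp add: cstar_mult mult.assoc)
    then have "cstar W * (of_real K - cstar X * X) * W = K *\<^sub>R (cstar W * W) - 1"
      unfolding s(3)[symmetric] by (simp add: algebra_simps of_real_def)
    then show ?thesis using K by (simp add: scaleR_diff_right of_real_def)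
  qed
  ultimately have "is_positive (cstar W * W + (1 - 1) - of_real (1 / K))" by (simp only:)
  then obtain \<theta> where "cstar (W * \<theta>) * (W * \<theta>) = 1"
    using corner_normalize[of 1 W "1 / K"] K by (auto simp: is_proj_def)
  then show ?thesis
    by (intro properly_infinite_projI[of 1 s "W * \<theta>"]) (simp_all add: is_proj_def s(1,2) mult_prefix[OF s(2)])
qed

subsection \<open>Purely infinite algebras of real rank zero\<close>

lemma ideal_gen_sum: "(\<Sum>i<n::nat. x i * a * y i) \<in> ideal_gen (a :: 'a::cstar_algebra)"
  unfolding ideal_gen_def by (rule subsetD[OF closure_subset], rule CollectI, rule exI, rule exI, rule exI, rule conjI, rule refl, rule TrueI)

text \<open>The sum \<open>E\<close> of the two range projections lies in the ideal generated by
  \<open>p\<close>, so pure infiniteness approximates \<open>E\<close> by some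
  \<open>cstar r * p * r\<close>. An error below \<open>1/2\<close> suffices to normalise this to a
  partial isometry from \<open>E\<close> into \<open>p\<close>, which brings both copies below
  \<open>p\<close>.\<close>

lemma properly_infinite_of_orthogonal_copies:
  fixes p :: "'a::cstar_algebra"
  assumes pi: "purely_infinite TYPE('a)" and p: "is_proj p"
    and v: "cstar v * v = p" "cstar w * w = p" "cstar v * w = 0"
  shows "properly_infinite_proj p"
proof -
  have pp: "p * p = p" "cstar p = p" using is_projD[OF p] by auto
  have vp: "v * p = v" "w * p = w" using partial_isometry_absorb[of v] partial_isometry_absorb[of w] p by (simp_all add: v)
  have pv: "p * cstar v = cstar v" "p * cstar w = cstar w"
    using arg_cong[OF vp(1), of cstar] arg_cong[OF vp(2), of cstar] by (simp_all add: cstar_mult pp)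
  have wv: "cstar w * v = 0" using arg_cong[OF v(3), of cstar] by (simp add: cstar_mult cstar_cstar)
  note r = v[THEN mult_prefix] wv[THEN mult_prefix] vp[THEN mult_prefix] pv[THEN mult_prefix]
  define E where "E = v * cstar v + w * cstar w"
  have E: "is_proj E" by (simp add: is_proj_def E_def cstar_add cstar_mult cstar_cstar algebra_simps mult.assoc r pv)
  have EE: "E * E = E" "cstar E = E" using is_projD[OF E] by auto
  have Ev: "E * v = v" "E * w = w" by (simp_all add: E_def distrib_right mult.assoc v wv vp)
  have "E = (\<Sum>i<2::nat. (if i = 0 then v else w) * p * (if i = 0 then cstar v else cstar w))"
    by (simp add: numeral_2_eq_2 E_def vp)
  then have "E \<in> ideal_gen p"
    using ideal_gen_sum[of "\<lambda>i. if i = 0 then v else w" p "\<lambda>i. if i = 0 then cstar v else cstar w" 2] by (simp only:)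
  have "is_positive E" "is_positive p" using is_projD(3) E p by blast+
  then have "cuntz_below E p" using pi \<open>E \<in> ideal_gen p\<close> unfolding purely_infinite_def by simp
  then obtain r0 where "(\<lambda>n. cstar (r0 n) * p * r0 n) \<longlonglongrightarrow> E" by (auto simp: cuntz_below_def)
  then have "\<forall>\<^sub>F n in sequentially. dist (cstar (r0 n) * p * r0 n) E < 1/2" by (rule tendstoD) simp
  then obtain n where n: "norm (cstar (r0 n) * p * r0 n - E) < 1/2" by (auto simp: eventually_sequentially dist_norm)
  define x where "x = p * r0 n * E"
  define y where "y = cstar (r0 n) * p * r0 n - E"
  have xE: "x * E = x" by (simp add: x_def mult.assoc EE)
  have xx: "cstar x * x = E * y * E + E"
    by (simp add: x_def y_def cstar_mult pp EE algebra_simps mult.assoc mult_prefix[OF pp(1)])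
  have ny: "norm (E * y * E) \<le> 1/2"
  proof -
    have "norm (E * y * E) \<le> norm E * norm y * norm E"
      by (intro order_trans[OF norm_mult_ineq] mult_right_mono norm_mult_ineq) auto
    also have "\<dots> \<le> 1 * (1/2) * 1" using is_projD(5)[OF E] n by (intro mult_mono) (auto simp: y_def)
    finally show ?thesis by simp
  qed
  have ys: "cstar (E * y * E) = E * y * E"
    by (simp add: y_def cstar_mult cstar_diff cstar_cstar pp EE mult.assoc)
  have "is_positive (cstar x * x + (1 - E) - of_real (1/2))"
  proof (rule is_positiveI_norm[of _ "1/2"])
    have e: "cstar x * x + (1 - E) - of_real (1/2) = E * y * E + (1 - of_real (1/2))" by (simp add: xx)
    show "cstar (cstar x * x + (1 - E) - of_real (1/2)) = cstar x * x + (1 - E) - of_real (1/2)"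
      unfolding e cstar_add cstar_diff ys by simp
    have "of_real (1/2) - (E * y * E + (1 - of_real (1/2))) = - (E * y * E) - (1 - (of_real (1/2) + of_real (1/2)))"
      by simp
    also have "\<dots> = - (E * y * E)" by (simp flip: of_real_add)
    finally show "norm (of_real (1/2) - (cstar x * x + (1 - E) - of_real (1/2))) \<le> 1/2"
      unfolding e using ny by simp
  qed
  then obtain \<theta> where \<theta>: "cstar (x * \<theta>) * (x * \<theta>) = E"
    using corner_normalize[OF E xE, of "1/2"] by auto
  define u where "u = x * \<theta>"
  have u: "cstar u * u = E" using \<theta> by (simp add: u_def)
  have pu: "p * u = u" by (simp add: u_def x_def mult.assoc mult_prefix[OF pp(1)])
  show ?thesis
    by (rule properly_infinite_projI[OF p, of "u * v" "u * w"])
      (simp_all add: cstar_mult mult.assoc mult_prefix[OF u] mult_prefix[OF pu] Ev vp v)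
qed

text \<open>Real rank zero replaces \<open>\<alpha> - \<epsilon>\<close> by a nearby invertible
  \<open>k\<close>, whose positive spectral projection is \<open>p\<close>. Off \<open>p\<close> the
  element \<open>\<alpha>\<close> is small, so \<open>c * p\<close> is close to \<open>c\<close>; on
  \<open>p\<close> it is bounded below, so \<open>c * p\<close> and \<open>\<alpha> * p\<close> can
  be normalised. Their ranges are orthogonal because \<open>c * c = 0\<close>, which gives two
  orthogonal copies of \<open>p\<close>.\<close>

lemma square_zero_near_projection:
  fixes c :: "'a::cstar_algebra"
  assumes pi: "purely_infinite TYPE('a)" and rr0: "real_rank_zero TYPE('a)" and c: "c * c = 0" and \<epsilon>: "\<epsilon> > 0"
  shows "\<exists>p. properly_infinite_proj p \<and> (norm (c - c * p))\<^sup>2 \<le> 2 * \<epsilon>"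
proof -
  define \<alpha> where "\<alpha> = cstar c * c"
  have \<alpha>s: "cstar \<alpha> = \<alpha>" by (simp add: \<alpha>_def cstar_mult cstar_cstar)
  define \<delta> where "\<delta> = \<epsilon> / 2"
  have \<delta>: "\<delta> > 0" "\<delta> < \<epsilon>" using \<epsilon> by (simp_all add: \<delta>_def)
  have "cstar (\<alpha> - of_real \<epsilon>) = \<alpha> - of_real \<epsilon>" by (simp add: cstar_diff \<alpha>s)
  then have "\<alpha> - of_real \<epsilon> \<in> closure {k. cstar k = k \<and> inv_el k}" using rr0 by (simp add: real_rank_zero_def)
  then have "\<exists>k\<in>{k. cstar k = k \<and> inv_el k}. dist k (\<alpha> - of_real \<epsilon>) < \<delta>" using \<delta>(1) unfolding closure_approachable by blast
  then obtain k where ks: "cstar k = k" "inv_el k" and kn: "dist k (\<alpha> - of_real \<epsilon>) < \<delta>" by blast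
  define d where "d = \<alpha> - of_real \<epsilon> - k"
  have nd: "norm d \<le> \<delta>" using kn by (simp add: d_def dist_norm norm_minus_commute)
  have ds: "cstar d = d" by (simp add: d_def cstar_diff \<alpha>s ks)
  have \<alpha>e: "\<alpha> = k + (d + of_real \<epsilon>)" by (simp add: d_def)
  define K where "K = norm k + 1"
  have K: "K > 0" "norm k \<le> K" using norm_ge_zero[of k] unfolding K_def by linarith+
  define s where "s = cabs K k"
  have s: "is_positive s" "s * s = k * k" "is_positive (s + k)" "is_positive (s - k)"
    unfolding s_def by (rule cabs[OF ks(1) K])+
  have sk: "k * s = s * k" unfolding s_def by (rule cabs(3)[OF ks(1) K refl])
  have "inv_el (s * s)" unfolding s(2) by (rule inv_el_mult[OF ks(2) ks(2)])
  then have si: "inv_el s" by (rule inv_el_factor) simp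
  define j where "j = alg_inv s"
  have j: "s * j = 1" "j * s = 1" unfolding j_def by (rule alg_inv[OF si])+
  have js: "cstar j = j" unfolding j_def using alg_inv_cstar(2)[OF si] is_positiveD(1)[OF s(1)] by simp
  have jk: "j * k = k * j"
  proof -
    have "j * k = j * (k * s) * j" by (simp add: mult.assoc j)
    also have "\<dots> = k * j" by (simp add: sk mult.assoc mult_prefix[OF j(2)])
    finally show ?thesis .
  qed
  \<comment> \<open>The sign of \<open>k\<close>: \<open>k\<close> times the inverse of its absolute
    value, a self-adjoint unitary.\<close>
  define w where "w = k * j"
  have kjs: "j * s = s * j" using j by simp
  have wk: "w * k = s" "k * w = s"
  proof -
    have "w * k = j * (k * k)" by (simp add: w_def jk[symmetric] mult.assoc)
    then show 1: "w * k = s" by (simp add: s(2)[symmetric] mult_prefix[OF j(2)])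
    show "k * w = s" using 1 by (simp add: w_def mult.assoc jk)
  qed
  have ww: "w * w = 1" using wk(1) by (simp add: w_def mult.assoc[symmetric] j)
  have ws: "cstar w = w" by (simp add: w_def cstar_mult ks js jk)
  define p where "p = (1/2) *\<^sub>R (1 + w)"
  have p: "is_proj p"
  proof -
    have "(1 + w) * (1 + w) = 2 *\<^sub>R (1 + w)" by (simp add: algebra_simps ww scaleR_2)
    then show ?thesis by (simp add: is_proj_def p_def cstar_scaleR cstar_add ws)
  qed
  have pp: "p * p = p" "cstar p = p" using is_projD[OF p] by auto
  have pk: "p * k = k * p" "k * p = (1/2) *\<^sub>R (s + k)" by (simp_all add: p_def algebra_simps wk)
  have conj_p: "is_positive (q * x * q)" if "is_positive x" "cstar q = q" for q x :: 'a
    using is_positive_conj[OF that(1), of q] that(2) by simp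
  have small: "(norm (c - c * p))\<^sup>2 \<le> 2 * \<epsilon>"
  proof -
    define q where "q = 1 - p"
    have qq: "q * q = q" "cstar q = q" using is_projD[OF is_projD(4)[OF p]] by (simp_all add: q_def)
    define y where "y = q * (d + of_real \<epsilon>) * q"
    have "norm y \<le> norm q * norm (d + of_real \<epsilon>) * norm q"
      unfolding y_def by (intro order_trans[OF norm_mult_ineq] mult_right_mono norm_mult_ineq) auto
    also have "\<dots> \<le> 1 * (2 * \<epsilon>) * 1"
    proof (intro mult_mono)
      have "norm (d + of_real \<epsilon>) \<le> norm d + norm (of_real \<epsilon> :: 'a)" by (rule norm_triangle_ineq)
      then show "norm (d + of_real \<epsilon>) \<le> 2 * \<epsilon>" using nd \<delta> \<epsilon> by simp
    qed (use is_projD(5)[OF is_projD(4)[OF p]] \<epsilon> in \<open>auto simp: q_def\<close>)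
    finally have ny: "norm y \<le> 2 * \<epsilon>" by simp
    have "is_positive (of_real (2 * \<epsilon>) - y)"
    proof (rule is_positiveI_norm[of _ "2 * \<epsilon>"])
      show "cstar (of_real (2 * \<epsilon>) - y) = of_real (2 * \<epsilon>) - y"
        unfolding y_def cstar_diff cstar_mult qq cstar_of_real cstar_add ds by (simp only: mult.assoc)
      have "of_real (2 * \<epsilon>) - (of_real (2 * \<epsilon>) - y) = y" by simp
      then show "norm (of_real (2 * \<epsilon>) - (of_real (2 * \<epsilon>) - y)) \<le> 2 * \<epsilon>" using ny by (simp only:)
    qed
    then have 1: "is_positive ((1/2) *\<^sub>R (s - k) + (of_real (2 * \<epsilon>) - y))" by (intro is_positive_add is_positive_scaleR s) auto
    have "q * k * q = k * q"
    proof -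
      have "q * k = k * q" using pk(1) by (simp add: q_def algebra_simps)
      then show ?thesis by (simp add: mult.assoc qq)
    qed
    moreover have "k * q = - ((1/2) *\<^sub>R (s - k))"
      using pk(2) by (simp add: q_def algebra_simps scaleR_half_double flip: scaleR_add_left)
    ultimately have "q * \<alpha> * q = - ((1/2) *\<^sub>R (s - k)) + y" unfolding \<alpha>e y_def by (simp add: distrib_left distrib_right)
    then have "(1/2) *\<^sub>R (s - k) + (of_real (2 * \<epsilon>) - y) = of_real (2 * \<epsilon>) - q * \<alpha> * q" by simp
    then have "is_positive (of_real (2 * \<epsilon>) - q * \<alpha> * q)" using 1 by (simp only:)
    moreover have "c - c * p = c * q" by (simp add: q_def algebra_simps)
    then have cq: "cstar (c - c * p) * (c - c * p) = q * \<alpha> * q" by (simp add: cstar_mult qq \<alpha>_def mult.assoc)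
    moreover have "is_positive (q * \<alpha> * q)" unfolding cq[symmetric] by (rule is_positive_cstar_mult)
    ultimately have "norm (q * \<alpha> * q) \<le> norm (of_real (2 * \<epsilon>) :: 'a)" by (intro norm_mono_positive)
    then show ?thesis unfolding cstar_identity[symmetric] cq norm_of_real using \<epsilon> by simp
  qed
  \<comment> \<open>\<open>\<epsilon> - \<delta>\<close> is the lower bound of
    \<open>\<alpha>\<close> on the range of \<open>p\<close>; the minimum with \<open>1\<close> also
    accommodates the summand \<open>1 - p\<close>.\<close>
  define \<kappa> where "\<kappa> = min (\<epsilon> - \<delta>) 1"
  have \<kappa>: "\<kappa> > 0" "\<kappa> \<le> \<epsilon> - \<delta>" "\<kappa> \<le> 1" using \<delta> by (auto simp: \<kappa>_def)
  define m where "m = p * \<alpha> * p + (1 - p)"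
  have m\<kappa>: "is_positive (m - of_real \<kappa>)"
  proof -
    have "m - of_real \<kappa> = (1/2) *\<^sub>R (s + k) + (p * (d + of_real \<delta>) * p + ((\<epsilon> - \<delta> - \<kappa>) *\<^sub>R p + (1 - \<kappa>) *\<^sub>R (1 - p)))"
    proof -
      have "p * k * p = (k * p) * p" by (simp only: pk(1))
      also have "\<dots> = k * p" by (simp only: mult.assoc pp(1))
      finally have "p * k * p = (1/2) *\<^sub>R (s + k)" by (simp only: pk(2))
      then have "p * \<alpha> * p = (1/2) *\<^sub>R (s + k) + p * d * p + \<epsilon> *\<^sub>R p"
        unfolding \<alpha>e by (simp add: distrib_left distrib_right of_real_def pp)
      moreover have "p * (d + of_real \<delta>) * p = p * d * p + \<delta> *\<^sub>R p"
        by (simp add: distrib_left distrib_right of_real_def pp)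
      ultimately show ?thesis unfolding m_def by (simp add: algebra_simps of_real_def pp(1))
    qed
    moreover have "is_positive (d + of_real \<delta>)"
      by (rule is_positiveI_norm[of _ \<delta>]) (simp_all add: cstar_add ds nd)
    then have "is_positive (p * (d + of_real \<delta>) * p)" by (rule conj_p[OF _ pp(2)])
    note is_positive_add[OF is_positive_scaleR[OF s(3)] is_positive_add[OF this
      is_positive_add[OF is_positive_scaleR[OF is_projD(3)[OF p]] is_positive_scaleR[OF is_projD(3)[OF is_projD(4)[OF p]]]]]]
    then have "is_positive ((1/2) *\<^sub>R (s + k) + (p * (d + of_real \<delta>) * p + ((\<epsilon> - \<delta> - \<kappa>) *\<^sub>R p + (1 - \<kappa>) *\<^sub>R (1 - p))))"
      using \<kappa> by simp
    ultimately show ?thesis by (simp only:)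
  qed
  have absorb: "x * p * p = x * p" for x by (simp only: mult.assoc pp(1))
  have "cstar (c * p) * (c * p) + (1 - p) - of_real \<kappa> = m - of_real \<kappa>" by (simp add: m_def cstar_mult pp \<alpha>_def mult.assoc)
  then have "is_positive (cstar (c * p) * (c * p) + (1 - p) - of_real \<kappa>)" using m\<kappa> by (simp only:)
  then obtain \<theta> where \<theta>: "cstar (c * p * \<theta>) * (c * p * \<theta>) = p"
    using corner_normalize[OF p absorb \<kappa>(1)] by blast
  have "is_positive (cstar (\<alpha> * p) * (\<alpha> * p) + (1 - p) - of_real (\<kappa> * \<kappa>))"
  proof -
    \<comment> \<open>Compressing the middle of \<open>p * \<alpha> * \<alpha> * p\<close> by
      \<open>p\<close> can only decrease it, so the square of the bound for \<open>m\<close> serves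
      \<open>\<alpha> * p\<close>.\<close>
    have mm: "m * m = p * \<alpha> * p * \<alpha> * p + (1 - p)"
      by (simp add: m_def algebra_simps pp mult.assoc mult_prefix[OF pp(1)])
    have "is_positive (m - of_real \<kappa> + of_real (\<kappa> + \<kappa>))" using \<kappa>(1) by (intro is_positive_add m\<kappa> is_positive_of_real) simp
    moreover have "m - of_real \<kappa> + of_real (\<kappa> + \<kappa>) = m + of_real \<kappa>"
      by (simp only: of_real_add add.assoc[symmetric] diff_add_cancel)
    ultimately have "is_positive (m + of_real \<kappa>)" by (simp only:)
    then have "is_positive ((m - of_real \<kappa>) * (m + of_real \<kappa>))"
      by (intro positive_mult_commute[OF m\<kappa>]) (simp_all add: algebra_simps of_real_def)
    moreover have "(m - of_real \<kappa>) * (m + of_real \<kappa>) = m * m - of_real (\<kappa> * \<kappa>)" by (simp add: algebra_simps of_real_def)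
    ultimately have 1: "is_positive (m * m - of_real (\<kappa> * \<kappa>))" by (simp only:)
    have "is_positive (cstar (\<alpha> * p) * (1 - p) * (\<alpha> * p))" by (rule is_positive_conj[OF is_projD(3)[OF is_projD(4)[OF p]]])
    then have "is_positive (cstar (\<alpha> * p) * (1 - p) * (\<alpha> * p) + (m * m - of_real (\<kappa> * \<kappa>)))" using 1 by (rule is_positive_add)
    moreover have "cstar (\<alpha> * p) * (1 - p) * (\<alpha> * p) + (m * m - of_real (\<kappa> * \<kappa>)) =
      cstar (\<alpha> * p) * (\<alpha> * p) + (1 - p) - of_real (\<kappa> * \<kappa>)"
      unfolding mm by (simp add: cstar_mult pp \<alpha>s algebra_simps mult.assoc)
    ultimately show ?thesis by (simp only:)
  qed
  then obtain \<gamma> where \<gamma>: "cstar (\<alpha> * p * \<gamma>) * (\<alpha> * p * \<gamma>) = p"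
    using corner_normalize[OF p absorb mult_pos_pos[OF \<kappa>(1) \<kappa>(1)]] by blast
  have "cstar c * cstar c = 0" using c by (simp flip: cstar_mult)
  then have "cstar (c * p * \<theta>) * (\<alpha> * p * \<gamma>) = 0"
    by (simp add: cstar_mult \<alpha>_def mult.assoc mult_prefix[OF \<open>cstar c * cstar c = 0\<close>])
  then have "properly_infinite_proj p" by (rule properly_infinite_of_orthogonal_copies[OF pi p \<theta> \<gamma>])
  then show ?thesis using small by blast
qed

theorem properly_infinite_one_real_rank_zero:
  assumes pi: "purely_infinite TYPE('a::cstar_algebra)" and rr0: "real_rank_zero TYPE('a)"
  shows "properly_infinite_proj (1::'a)"
proof (rule ccontr)
  assume "\<not> properly_infinite_proj (1::'a)"
  then have "(1::'a) \<notin> pi_ideal" using properly_infinite_one_of_pi_ideal by blast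
  then obtain L :: "'a set" where L: "maximal_left_ideal L" "pi_ideal \<subseteq> L" using ex_maximal_left_ideal[OF left_ideal_pi_ideal] by blast
  have sq: "c \<in> L" if c: "c * c = 0" for c :: 'a
  proof -
    have "\<exists>y\<in>L. dist y c < e" if e: "e > 0" for e
    proof -
      \<comment> \<open>The squared distance in \<open>square_zero_near_projection\<close> is at
        most twice its tolerance, so a quarter of \<open>e\<^sup>2\<close> leaves a strict
        inequality.\<close>
      have "e\<^sup>2 / 4 > 0" using e by simp
      from square_zero_near_projection[OF pi rr0 c this]
      obtain p where p: "properly_infinite_proj p" "(norm (c - c * p))\<^sup>2 \<le> 2 * (e\<^sup>2 / 4)" by blast
      have "c * p \<in> pi_ideal" using pi_ideal.add[OF pi_ideal.zero p(1), of c 1] by simp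
      then have "c * p \<in> L" by (rule subsetD[OF L(2)])
      moreover have "(norm (c - c * p))\<^sup>2 < e\<^sup>2" using p(2) \<open>e\<^sup>2 / 4 > 0\<close> by linarith
      then have "norm (c - c * p) < e" by (rule power2_less_imp_less) (use e in simp)
      then have "dist (c * p) c < e" by (simp only: dist_norm norm_minus_commute)
      ultimately show ?thesis by (rule bexI[rotated])
    qed
    then have "c \<in> closure L" unfolding closure_approachable by (intro allI impI)
    then show ?thesis by (simp only: closure_closed[OF maximal_left_ideal_closed[OF L(1)]])
  qed
  have "\<exists>\<omega> :: 'a \<Rightarrow> complex. character \<omega>" by (rule character_of_square_zero_left_ideal[OF L(1)]) (rule sq)
  then show False using pi unfolding purely_infinite_def by blast
qed

lemma properly_infinite_one_von_neumann:
  assumes vN: "von_neumann_algebra TYPE('a::cstar_algebra)" and inf: "properly_infinite_vN TYPE('a)"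
  shows "properly_infinite_proj (1::'a)"
proof -
  interpret ball_compact "TYPE('a)" by unfold_locales (rule von_neumann_ball_intersection[OF vN])
  show ?thesis by (rule properly_infinite_one[OF inf])
qed

theorem theorem4p3:
  fixes T :: "'a::cstar_algebra \<Rightarrow> 'b::cbanach_algebra"
  assumes "semisimple TYPE('b)"
    and "c_linear T" and "surj T" and "spectrally_bounded T"
    and "(von_neumann_algebra TYPE('a) \<and> properly_infinite_vN TYPE('a)) \<or>
         (purely_infinite TYPE('a) \<and> real_rank_zero TYPE('a))"
  shows "(\<exists>!J. jordan_epi J \<and> (\<forall>x. T x = T 1 * J x)) \<and> central (T 1) \<and> inv_el (T 1)"
  using assms(5) properly_infinite_one_von_neumann properly_infinite_one_real_rank_zero
    weighted_jordan_properly_infinite[OF assms(1-4)] by blast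

end
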